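(* Let $g:\mathbb{N}\to\{0,1\}$ be a pretentious multiplicative function with unique Furstenberg measure $\nu_g$ on $\{0,1\}^{\mathbb{Z}}$. Let $\mathcal{P}$ be a set of primes with $\sum_{p\in\mathcal{P}}\frac1p=\infty$ and relative density $0$ in the primes, and let $f(n)=(-1)^{\Omega_{\mathcal{P}}(n)}$ or $f(n)=(-1)^{\omega_{\mathcal{P}}(n)}$. Then $fg$ has a unique Furstenberg measure $\nu_{fg}$ on $\{-1,0,+1\}^{\mathbb{Z}}$, given on cylinder sets $C$ by $$\nu_{fg}(C)=2^{-|\mathrm{Supp}(C)|}\nu_g(C^2).$$
   Context: Pretentious: $\sum_p\frac{1-\mathrm{Re}(g(p)\overline{\chi(p)}p^{-it})}{p}<\infty$ for some Dirichlet character $\chi$ and $t\in\mathbb{R}$. A Furstenberg measure of a sequence $\eta$ with values in a finite set $V$ (extended by $0$ to nonpositive integers, viewed in $V^{\mathbb{Z}}$ with left shift $T$) is a $T$-invariant Borel probability measure $\nu$ such that $\frac1{x_j}\sum_{n\le x_j}F(T^n\eta)\to\int F\,d\nu$ for all continuous $F$, along some $x_j\to\infty$. A cylinder set is $C=\{\mathbf{x}\in\{-1,0,1\}^{\mathbb{Z}}:\ \mathbf{x}(h_i)=v_i,\ 1\le i\le k\}$ with distinct $h_i\in\mathbb{Z}$ and $v_i\in\{-1,0,1\}$; $\mathrm{Supp}(C)=\{h_i:\ v_i\ne0\}$; $C^2=\{\mathbf{x}^2:\mathbf{x}\in C\}=\{\mathbf{y}\in\{0,1\}^{\mathbb{Z}}:\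 \mathbf{y}(h_i)=v_i^2\}$, squaring pointwise. $\omega_{\mathcal{P}}$, $\Omega_{\mathcal{P}}$ count prime factors in $\mathcal{P}$ without/with multiplicity; relative density is $\lim_x|\mathcal{P}\cap[1,x]|/|\mathbb{P}\cap[1,x]|$. *)

theory Defs
  imports
    "HOL-Probability.Probability"
    "HOL-Computational_Algebra.Computational_Algebra"
begin

section \<open>Multiplicative functions and pretentiousness\<close>

text \<open>Arithmetic functions live on the positive integers; their value at \<open>0\<close> is irrelevant.\<close>

definition multiplicative_fun :: "(nat \<Rightarrow> 'a::comm_semiring_1) \<Rightarrow> bool" where
  "multiplicative_fun g \<longleftrightarrow>
     g 1 = 1 \<and> (\<forall>m>0. \<forall>n>0. coprime m n \<longrightarrow> g (m * n) = g m * g n)"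

definition dirichlet_character :: "nat \<Rightarrow> (nat \<Rightarrow> complex) \<Rightarrow> bool" where
  "dirichlet_character q \<psi> \<longleftrightarrow>
     q > 0 \<and> \<psi> 1 = 1 \<and>
     (\<forall>m n. \<psi> (m * n) = \<psi> m * \<psi> n) \<and>
     (\<forall>n. \<psi> (n + q) = \<psi> n) \<and>
     (\<forall>n. \<psi> n \<noteq> 0 \<longleftrightarrow> coprime n q)"

text \<open>For \<open>g\<close> with values in the unit disc all terms are nonnegative, so unconditional
  summability over the primes is finiteness of the sum.\<close>

definition pretentious :: "(nat \<Rightarrow> complex) \<Rightarrow> bool" where
  "pretentious g \<longleftrightarrow>
     (\<exists>q \<psi>. \<exists>t::real. dirichlet_character q \<psi> \<and>
        (\<lambda>p. (1 - Re (g p * cnj (\<psi> p) * of_nat p powr (- (\<i> * of_real t)))) / real p)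
          summable_on {p. prime p})"

definition has_relative_prime_density :: "nat set \<Rightarrow> real \<Rightarrow> bool" where
  "has_relative_prime_density P d \<longleftrightarrow>
     (\<lambda>x::nat. real (card (P \<inter> {1..x})) / real (card ({p. prime p} \<inter> {1..x}))) \<longlonglongrightarrow> d"

definition small_omega_in :: "nat set \<Rightarrow> nat \<Rightarrow> nat" where
  "small_omega_in P n = card (prime_factors n \<inter> P)"

definition big_Omega_in :: "nat set \<Rightarrow> nat \<Rightarrow> nat" where
  "big_Omega_in P n = (\<Sum>p \<in> prime_factors n \<inter> P. multiplicity p n)"


section \<open>Furstenberg measures\<close>

definition full_shift :: "int set \<Rightarrow> (int \<Rightarrow> int) set" where
  "full_shift V = {x. \<forall>k. x k \<in> V}"

definition left_shift :: "(int \<Rightarrow> int) \<Rightarrow> (int \<Rightarrow> int)" where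
  "left_shift x = (\<lambda>k. x (k + 1))"

definition extend_by_zero :: "(nat \<Rightarrow> int) \<Rightarrow> (int \<Rightarrow> int)" where
  "extend_by_zero \<eta> = (\<lambda>k. if k > 0 then \<eta> (nat k) else 0)"

text \<open>The type \<^typ>\<open>int \<Rightarrow> int\<close> carries the product topology of the discrete topology on
  \<^typ>\<open>int\<close>, so that \<^term>\<open>full_shift V\<close> is a compact subspace for finite \<open>V\<close>, and
  restricting \<^term>\<open>borel\<close> to it gives its Borel sets. The set \<open>V\<close> should contain \<open>0\<close>, so that
  the extension of a \<open>V\<close>-valued sequence is again \<open>V\<close>-valued.\<close>

definition furstenberg_measure ::
    "int set \<Rightarrow> (nat \<Rightarrow> int) \<Rightarrow> (int \<Rightarrow> int) measure \<Rightarrow> bool" where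
  "furstenberg_measure V \<eta> \<nu> \<longleftrightarrow>
     sets \<nu> = sets (restrict_space borel (full_shift V)) \<and>
     prob_space \<nu> \<and>
     distr \<nu> \<nu> left_shift = \<nu> \<and>
     (\<exists>x :: nat \<Rightarrow> real. filterlim x at_top sequentially \<and>
        (\<forall>F :: (int \<Rightarrow> int) \<Rightarrow> complex. continuous_on (full_shift V) F \<longrightarrow>
           (\<lambda>j. (1 / x j) *\<^sub>R
              (\<Sum>n = 1..nat \<lfloor>x j\<rfloor>. F ((left_shift ^^ n) (extend_by_zero \<eta>))))
             \<longlonglongrightarrow> (LINT y|\<nu>. F y)))"

definition unique_furstenberg_measure ::
    "int set \<Rightarrow> (nat \<Rightarrow> int) \<Rightarrow> (int \<Rightarrow> int) measure \<Rightarrow> bool" where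
  "unique_furstenberg_measure V \<eta> \<nu> \<longleftrightarrow>
     furstenberg_measure V \<eta> \<nu> \<and> (\<forall>\<nu>'. furstenberg_measure V \<eta> \<nu>' \<longrightarrow> \<nu>' = \<nu>)"


section \<open>Cylinder sets\<close>

text \<open>A cylinder is given by the finite set \<open>H\<close> of prescribed positions and a function \<open>v\<close>,
  of which only the restriction to \<open>H\<close> matters.\<close>

definition cylinder :: "int set \<Rightarrow> int set \<Rightarrow> (int \<Rightarrow> int) \<Rightarrow> (int \<Rightarrow> int) set" where
  "cylinder V H v = {x \<in> full_shift V. \<forall>h\<in>H. x h = v h}"

definition cylinder_supp :: "int set \<Rightarrow> (int \<Rightarrow> int) \<Rightarrow> int set" where
  "cylinder_supp H v = {h \<in> H. v h \<noteq> 0}"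

definition square_set :: "(int \<Rightarrow> int) set \<Rightarrow> (int \<Rightarrow> int) set" where
  "square_set C = (\<lambda>x k. (x k)\<^sup>2) ` C"

lemma square_set_cylinder:
  assumes "v ` H \<subseteq> {-1, 0, 1}"
  shows "square_set (cylinder {-1, 0, 1} H v) = cylinder {0, 1} H (\<lambda>h. (v h)\<^sup>2)"
proof (intro equalityI subsetI)
  fix y assume "y \<in> square_set (cylinder {-1, 0, 1} H v)"
  then obtain x where x: "\<forall>k. x k \<in> {-1, 0, 1}" "\<forall>h\<in>H. x h = v h" "y = (\<lambda>k. (x k)\<^sup>2)"
    by (auto simp: square_set_def cylinder_def full_shift_def)
  have "(x k)\<^sup>2 \<in> {0, 1}" for k using x(1)[rule_format, of k] by auto
  then show "y \<in> cylinder {0, 1} H (\<lambda>h. (v h)\<^sup>2)"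
    using x by (auto simp: cylinder_def full_shift_def)
next
  fix y assume "y \<in> cylinder {0, 1} H (\<lambda>h. (v h)\<^sup>2)"
  then have y: "\<And>k. y k \<in> {0, 1}" "\<And>h. h \<in> H \<Longrightarrow> y h = (v h)\<^sup>2"
    by (auto simp: cylinder_def full_shift_def)
  define x where "x = (\<lambda>k. if k \<in> H then v k else y k)"
  have "x k \<in> {-1, 0, 1}" for k using assms y(1)[of k] by (auto simp: x_def)
  then have "x \<in> cylinder {-1, 0, 1} H v"
    by (auto simp: cylinder_def full_shift_def x_def)
  moreover have "y k = (x k)\<^sup>2" for k using y(1)[of k] y(2)[of k] by (auto simp: x_def)
  ultimately show "y \<in> square_set (cylinder {-1, 0, 1} H v)"
    by (auto simp: square_set_def intro!: image_eqI[where x = x])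
qed

end

theory Submission
  imports Defs "HOL-Number_Theory.Cong" "HOL-Real_Asymp.Real_Asymp"
begin

text \<open>
  Pretentiousness of the \<open>{0,1}\<close>-valued \<open>g\<close> forces \<open>\<Sum> 1/p < \<infinity>\<close> over the primes with \<open>g p = 0\<close>, so up to a
  set of small density \<open>g\<close> is periodic. By inclusion-exclusion on cylinders everything then reduces
  to showing that the correlations \<open>f (n + h\<^sub>1) \<cdots> f (n + h\<^sub>k)\<close>, \<open>k \<ge> 1\<close>, have mean value \<open>0\<close> along
  every arithmetic progression. Relative density \<open>0\<close> makes the sum of \<open>1/p\<close> over \<open>p \<in> P\<close>,
  \<open>\<surd>u < p \<le> u\<close>, tend to \<open>0\<close>; hence the primes of \<open>P\<close> beyond a small power of \<open>N\<close> can be dropped, and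
  the remaining ones are treated by Brun's sieve: they are cut into blocks \<open>(\<surd>z, z]\<close>, the \<open>j\<close>-th block
  almost never contains more than \<open>j + 1\<close> of the primes dividing some \<open>n + h\<^sub>i\<close>, and so its parity
  may be replaced by a short divisor sum. The main term is about \<open>\<Prod> (1 - 2k/p)\<close>, which tends to \<open>0\<close> since
  \<open>\<Sum> 1/p\<close> diverges over \<open>P\<close>. The limit measure is the law of \<open>(\<epsilon>\<^sub>k y\<^sub>k)\<close> with \<open>y\<close> distributed by
  \<open>\<nu>\<^sub>g\<close> and independent uniform signs \<open>\<epsilon>\<^sub>k\<close>.
\<close>

subsection \<open>Counting in residue classes\<close>

text \<open>The full divisor expansion of the parity has far too many terms to be averaged over n <=
  N, and cutting it at a fixed length in every block leaves an error that grows with the number of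
  blocks. Letting the length grow by one per block settles both. Block j lies below
  \<open>2 ^ (E div 2 ^ j)\<close>, so j + 2 primes from each block have a product of at most 2^(6
  E), because the sum of (j + 2) / 2^j stays below 6; this is at most N^(1/4). A failed truncation
  in block j costs a factor 1 + (const eta)^(j + 2), and the product of these over any number of
  blocks is 1 + O(eta). The parity is signed, so the truncation is not one-sided. Its error is
  bounded by a second divisor sum, a nonnegative majorant, which the same sieve averages. Uniqueness
  does not follow from the correlations alone: a competing measure comes with its own cutoffs.
  Squaring coordinates turns it into a Furstenberg measure of g along the same cutoffs, which brings
  the hypothesis on g into play.\<close>

lemma card_cong_atLeastAtMost:
  fixes W r N :: nat
  assumes "W > 0"
  shows "\<bar>real (card {n\<in>{1..N}. [n = r] (mod W)}) - real N / real W\<bar> \<le> 1"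
proof -
  define A where "A = {n\<in>{1..N}. [n = r] (mod W)}"
  define s where "s = r mod W"
  have s: "s < W" using assms by (simp add: s_def)
  have modA: "n mod W = s" if "n \<in> A" for n using that by (simp add: A_def cong_def s_def)
  have inj: "inj_on (\<lambda>n. n div W) A"
    by (rule inj_onI) (metis modA div_mult_mod_eq)
  have card_eq: "card A = card ((\<lambda>n. n div W) ` A)" using inj by (simp add: card_image)
  \<comment> \<open>In the class of 0 the quotient 0 would come from n = 0, which lies outside
    \<open>{1..N}\<close>; the quotients then start at 1.\<close>
  define d where "d = (if s = 0 then 1 else 0 :: nat)"
  have up: "(\<lambda>n. n div W) ` A \<subseteq> {d..N div W}"
  proof
    fix k assume "k \<in> (\<lambda>n. n div W) ` A"
    then obtain n where n: "n \<in> A" "k = n div W" by auto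
    then have "n \<ge> 1" "n \<le> N" by (auto simp: A_def)
    moreover have "n div W \<ge> 1" if "s = 0" using modA[OF n(1)] that \<open>n \<ge> 1\<close> assms
      by (metis One_nat_def Suc_leI div_greater_zero_iff dvd_imp_le mod_0_imp_dvd neq0_conv not_one_le_zero)
    ultimately show "k \<in> {d..N div W}" using n by (auto simp: d_def div_le_mono)
  qed
  have low: "{d..<N div W + d} \<subseteq> (\<lambda>n. n div W) ` A"
  proof
    fix k assume k: "k \<in> {d..<N div W + d}"
    define n where "n = k * W + s"
    have "n div W = k" "n mod W = s" using s by (auto simp: n_def)
    moreover have "n \<ge> 1" using k s assms by (auto simp: n_def d_def split: if_splits)
    moreover have "n \<le> N"
    proof (cases "s = 0")
      case True
      then have "k \<le> N div W" using k by (auto simp: d_def)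
      then show ?thesis using True
        by (metis add.right_neutral n_def div_times_less_eq_dividend le_trans mult_le_mono1)
    next
      case False
      then have "Suc k \<le> N div W" using k by (auto simp: d_def)
      then have "Suc k * W \<le> N"
        by (metis div_times_less_eq_dividend le_trans mult_le_mono1)
      then show ?thesis using s by (simp add: n_def)
    qed
    ultimately have "n \<in> A" by (auto simp: A_def cong_def s_def)
    with \<open>n div W = k\<close> show "k \<in> (\<lambda>n. n div W) ` A" by force
  qed
  have "card A \<le> N div W + 1"
    using card_mono[OF _ up] card_eq by simp
  moreover have "card A \<ge> N div W"
    using card_mono[OF _ low] card_eq by (simp add: A_def)
  moreover have "real N = real (N div W) * real W + real (N mod W)"
    by (metis div_mult_mod_eq of_nat_add of_nat_mult)
  then have "real N / real W = real (N div W) + real (N mod W) / real W"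
    using assms by (simp add: field_simps)
  moreover have "0 \<le> real (N mod W) / real W" "real (N mod W) / real W \<le> 1"
    using assms by (auto intro: less_imp_le)
  ultimately show ?thesis unfolding A_def by linarith
qed

lemma cong_conj_dvd_add:
  fixes W p r h :: nat
  assumes "coprime W p" "p > 0"
  shows "\<exists>t. \<forall>n. [n = r] (mod W) \<and> p dvd n + h \<longleftrightarrow> [n = t] (mod W * p)"
proof -
  \<comment> \<open>With p = q + 1 the number h * q represents -h modulo p, which avoids subtraction
    of naturals.\<close>
  obtain q where "p = Suc q" using assms(2) gr0_implies_Suc by blast
  then have "h * q + h = p * h" by simp
  then have "p dvd h * q + h" by simp
  then obtain u where u: "p dvd u + h" by blast
  obtain t where t: "[t = r] (mod W)" "[t = u] (mod p)"
    using binary_chinese_remainder_nat[OF assms(1)] by blast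
  have "[n = r] (mod W) \<and> p dvd n + h \<longleftrightarrow> [n = t] (mod W * p)" for n
  proof -
    have "p dvd n + h \<longleftrightarrow> [n + h = u + h] (mod p)"
      using u by (metis cong_dvd_iff cong_def dvd_imp_mod_0)
    also have "\<dots> \<longleftrightarrow> [n = u] (mod p)" by (simp add: cong_add_rcancel_nat)
    also have "\<dots> \<longleftrightarrow> [n = t] (mod p)" using t(2) cong_sym cong_trans by blast
    finally have 1: "p dvd n + h \<longleftrightarrow> [n = t] (mod p)" .
    have 2: "[n = r] (mod W) \<longleftrightarrow> [n = t] (mod W)" using t(1) cong_sym cong_trans by blast
    show ?thesis unfolding 1 2 using assms
      by (meson coprime_cong_mult_nat cong_modulus_mult_nat cong_mult_self_left cong_dvd_modulus_nat dvd_triv_left dvd_triv_right)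
  qed
  then show ?thesis by blast
qed

text \<open>By induction on \<open>D\<close>: the condition at \<open>p\<close> splits a progression modulo \<open>W\<close> into \<open>card S\<close> disjoint
  progressions modulo \<open>W * p\<close>.\<close>

lemma card_cong_sieve:
  fixes W r N :: nat and S D :: "nat set"
  assumes "finite D" "W > 0" "finite S"
    and "\<And>p. p \<in> D \<Longrightarrow> prime p" "\<And>p. p \<in> D \<Longrightarrow> coprime W p"
    and "\<And>p h. p \<in> D \<Longrightarrow> h \<in> S \<Longrightarrow> h < p"
  shows "\<bar>real (card {n\<in>{1..N}. [n = r] (mod W) \<and> (\<forall>p\<in>D. \<exists>h\<in>S. p dvd n + h)})
            - real N / real W * (\<Prod>p\<in>D. real (card S) / real p)\<bar> \<le> real (card S) ^ card D"
  using assms(1,2,4-)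
proof (induction D arbitrary: W r rule: finite_induct)
  case empty
  then show ?case using card_cong_atLeastAtMost[of W N r] by simp
next
  case (insert p D)
  define k where "k = card S"
  define A where "A = (\<lambda>h. {n\<in>{1..N}. ([n = r] (mod W) \<and> p dvd n + h) \<and> (\<forall>p\<in>D. \<exists>h\<in>S. p dvd n + h)})"
  define B where "B = real N / real (W * p) * (\<Prod>p\<in>D. real k / real p)"
  have p: "prime p" "coprime W p" "\<And>h. h \<in> S \<Longrightarrow> h < p" using insert.prems by auto
  have "p > 0" using p(1) by (simp add: prime_gt_0_nat)
  have A: "\<bar>real (card (A h)) - B\<bar> \<le> real k ^ card D" for h
  proof -
    obtain t where t: "\<And>n. [n = r] (mod W) \<and> p dvd n + h \<longleftrightarrow> [n = t] (mod W * p)"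
      using cong_conj_dvd_add[OF p(2) \<open>p > 0\<close>] by blast
    have "coprime p q" if "q \<in> D" for q
      using that insert p(1) by (metis insertCI primes_coprime)
    then show ?thesis unfolding A_def t B_def k_def
      using insert.prems \<open>p > 0\<close> by (intro insert.IH) auto
  qed
  have disj: "A h \<inter> A h' = {}" if "h \<in> S" "h' \<in> S" "h \<noteq> h'" for h h'
  proof (rule ccontr)
    assume "A h \<inter> A h' \<noteq> {}"
    then obtain n where "p dvd n + h" "p dvd n + h'" by (auto simp: A_def)
    then have "[n + h = n + h'] (mod p)" by (metis cong_def dvd_imp_mod_0)
    then have "[h = h'] (mod p)" by (simp add: cong_add_lcancel_nat)
    then show False using that p(3) by (simp add: cong_def)
  qed
  have eq: "{n\<in>{1..N}. [n = r] (mod W) \<and> (\<forall>p\<in>insert p D. \<exists>h\<in>S. p dvd n + h)} = (\<Union>h\<in>S. A h)"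
    by (auto simp: A_def)
  have "card (\<Union>h\<in>S. A h) = (\<Sum>h\<in>S. card (A h))"
    using disj assms(3) by (intro card_UN_disjoint) (auto simp: A_def)
  then have "real (card (\<Union>h\<in>S. A h)) - k * B = (\<Sum>h\<in>S. real (card (A h)) - B)"
    by (simp add: sum_subtractf k_def)
  also have "\<bar>\<dots>\<bar> \<le> (\<Sum>h\<in>S. real k ^ card D)"
    using A by (intro order_trans[OF sum_abs] sum_mono) auto
  also have "\<dots> = real k ^ card (insert p D)" using insert.hyps by (simp add: k_def)
  finally show ?case unfolding eq using insert.hyps by (simp add: k_def B_def mult_ac)
qed

text \<open>Elementary symmetric polynomials in the \<open>w p\<close>, added up over the degrees in
  \<open>L\<close>. Degrees \<open>{..J}\<close> give a truncated expansion, degrees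
  \<open>{0, m}\<close> a majorant for its error.\<close>

definition subset_sum :: "'a set \<Rightarrow> nat set \<Rightarrow> ('a \<Rightarrow> real) \<Rightarrow> real" where
  "subset_sum I L w = (\<Sum>D | D \<subseteq> I \<and> card D \<in> L. \<Prod>p\<in>D. w p)"

definition block_subsets :: "(nat \<Rightarrow> 'a set) \<Rightarrow> (nat \<Rightarrow> nat set) \<Rightarrow> nat \<Rightarrow> 'a set set" where
  "block_subsets I L M = {D. D \<subseteq> (\<Union>j<M. I j) \<and> (\<forall>j<M. card (D \<inter> I j) \<in> L j)}"

text \<open>A subset of a disjoint union amounts to one subset of each block, so distributivity
  turns the product of blockwise sums into a single sum over divisors, the form that can be averaged
  over n.\<close>

lemma sum_block_subsets:
  fixes w :: "'a \<Rightarrow> real"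
  assumes "\<And>j. finite (I j)" "disjoint_family I"
  shows "(\<Sum>D\<in>block_subsets I L M. \<Prod>p\<in>D. w p) = (\<Prod>j<M. subset_sum (I j) (L j) w)"
proof (induction M)
  case 0
  have "block_subsets I L 0 = {{}}" by (auto simp: block_subsets_def)
  then show ?case by simp
next
  case (Suc M)
  have "I j \<inter> I M = {}" if "j < M" for j
    by (rule disjoint_family_onD[OF assms(2)]) (use that in auto)
  then have dj: "(\<Union>j<M. I j) \<inter> I M = {}" by (fastforce simp: disjoint_iff)
  define B where "B = {D. D \<subseteq> I M \<and> card D \<in> L M}"
  have finB: "finite B" using assms(1) by (auto simp: B_def)
  have finA: "finite (block_subsets I L M)"
    by (rule finite_subset[of _ "Pow (\<Union>j<M. I j)"]) (auto simp: block_subsets_def assms(1))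
  have "(\<Sum>D\<in>block_subsets I L (Suc M). \<Prod>p\<in>D. w p)
      = (\<Sum>(D1, D2)\<in>block_subsets I L M \<times> B. (\<Prod>p\<in>D1. w p) * (\<Prod>p\<in>D2. w p))"
  proof (rule sum.reindex_bij_witness[of _ "\<lambda>(D1, D2). D1 \<union> D2" "\<lambda>D. (D \<inter> (\<Union>j<M. I j), D \<inter> I M)"])
    fix D assume D: "D \<in> block_subsets I L (Suc M)"
    then have sub: "D \<subseteq> (\<Union>j<M. I j) \<union> I M" by (auto simp: block_subsets_def lessThan_Suc)
    show "(case (D \<inter> (\<Union>j<M. I j), D \<inter> I M) of (D1, D2) \<Rightarrow> D1 \<union> D2) = D"
      using sub by auto
    have "D \<inter> (\<Union>j<M. I j) \<inter> I j = D \<inter> I j" if "j < M" for j using that by auto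
    then show "(D \<inter> (\<Union>j<M. I j), D \<inter> I M) \<in> block_subsets I L M \<times> B"
      using D by (auto simp: block_subsets_def B_def)
    have "D = (D \<inter> (\<Union>j<M. I j)) \<union> (D \<inter> I M)" using sub by auto
    moreover have "finite (D \<inter> (\<Union>j<M. I j))" "finite (D \<inter> I M)" using assms(1) by auto
    moreover have "(D \<inter> (\<Union>j<M. I j)) \<inter> (D \<inter> I M) = {}" using dj by auto
    ultimately have "(\<Prod>p\<in>D. w p) = (\<Prod>p\<in>D \<inter> (\<Union>j<M. I j). w p) * (\<Prod>p\<in>D \<inter> I M. w p)"
      by (metis prod.union_disjoint)
    then show "(case (D \<inter> (\<Union>j<M. I j), D \<inter> I M) of (D1, D2) \<Rightarrow> (\<Prod>p\<in>D1. w p) * (\<Prod>p\<in>D2. w p)) = (\<Prod>p\<in>D. w p)"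
      by simp
  next
    fix DD assume DD: "DD \<in> block_subsets I L M \<times> B"
    then obtain D1 D2 where eq: "DD = (D1, D2)" "D1 \<in> block_subsets I L M" "D2 \<in> B" by auto
    have 1: "D1 \<subseteq> (\<Union>j<M. I j)" "D2 \<subseteq> I M" using eq by (auto simp: block_subsets_def B_def)
    then show "((case DD of (D1, D2) \<Rightarrow> D1 \<union> D2) \<inter> (\<Union>j<M. I j), (case DD of (D1, D2) \<Rightarrow> D1 \<union> D2) \<inter> I M) = DD"
      using dj eq(1) by auto
    have "(D1 \<union> D2) \<inter> I M = D2" using 1 dj by auto
    moreover have "(D1 \<union> D2) \<inter> I j = D1 \<inter> I j" if "j < M" for j using 1 dj that by auto
    ultimately have "card ((D1 \<union> D2) \<inter> I j) \<in> L j" if "j < Suc M" for j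
      using that eq by (cases "j = M") (auto simp: block_subsets_def B_def)
    then show "(case DD of (D1, D2) \<Rightarrow> D1 \<union> D2) \<in> block_subsets I L (Suc M)"
      using eq(1) 1 by (auto simp: block_subsets_def lessThan_Suc)
  qed
  also have "\<dots> = (\<Sum>D\<in>block_subsets I L M. \<Prod>p\<in>D. w p) * subset_sum (I M) (L M) w"
    unfolding subset_sum_def B_def[symmetric] sum_product sum.cartesian_product by simp
  finally show ?case using Suc by simp
qed

subsection \<open>Truncated divisor sums\<close>

lemma finite_subsets_card: "finite I \<Longrightarrow> finite {D. D \<subseteq> I \<and> card D \<in> L}"
  by (rule finite_subset[of _ "Pow I"]) auto

lemma sum_Pow_power_card:
  fixes c :: real
  assumes "finite A"
  shows "(\<Sum>D\<in>Pow A. c ^ card D) = (1 + c) ^ card A"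
  using prod_add[OF assms, of "\<lambda>_. c" "\<lambda>_. 1"] by (simp add: add.commute)

lemma subset_sum_of_bool:
  assumes "finite I"
  shows "subset_sum I L (\<lambda>p. c * of_bool (p \<in> X)) = (\<Sum>D | D \<subseteq> I \<inter> X \<and> card D \<in> L. c ^ card D)"
proof -
  have eq: "(\<Prod>p\<in>D. c * of_bool (p \<in> X)) = (if D \<subseteq> X then c ^ card D else 0)" if "D \<subseteq> I" for D
  proof (cases "D \<subseteq> X")
    case True
    then have "(\<Prod>p\<in>D. c * of_bool (p \<in> X)) = (\<Prod>p\<in>D. c)" by (intro prod.cong) auto
    then show ?thesis using True by simp
  next
    case False
    then show ?thesis using finite_subset[OF that assms] by (auto intro!: prod_zero)
  qed
  have "subset_sum I L (\<lambda>p. c * of_bool (p \<in> X))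
      = (\<Sum>D | D \<subseteq> I \<and> card D \<in> L. if D \<subseteq> X then c ^ card D else 0)"
    unfolding subset_sum_def by (intro sum.cong refl eq) auto
  also have "\<dots> = (\<Sum>D\<in>{D. D \<subseteq> I \<and> card D \<in> L} \<inter> {D. D \<subseteq> X}. c ^ card D)"
    using finite_subsets_card[OF assms, of L] by (subst sum.inter_restrict) auto
  also have "{D. D \<subseteq> I \<and> card D \<in> L} \<inter> {D. D \<subseteq> X} = {D. D \<subseteq> I \<inter> X \<and> card D \<in> L}" by auto
  finally show ?thesis .
qed

lemma subset_sum_zero: "finite I \<Longrightarrow> subset_sum I {0} w = 1"
proof -
  assume "finite I"
  then have "{D. D \<subseteq> I \<and> card D \<in> {0}} = {{}}" by (auto dest: finite_subset)
  then show ?thesis by (simp add: subset_sum_def)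
qed

lemma subset_sum_one:
  assumes "finite I"
  shows "subset_sum I {1} w = sum w I"
proof -
  have "{D. D \<subseteq> I \<and> card D \<in> {1}} = (\<lambda>x. {x}) ` I" by (auto simp: card_1_singleton_iff)
  then show ?thesis by (simp add: subset_sum_def sum.reindex inj_on_def)
qed

lemma subset_sum_union:
  assumes "finite I" "L \<inter> L' = {}"
  shows "subset_sum I (L \<union> L') w = subset_sum I L w + subset_sum I L' w"
proof -
  have "{D. D \<subseteq> I \<and> card D \<in> L \<union> L'} = {D. D \<subseteq> I \<and> card D \<in> L} \<union> {D. D \<subseteq> I \<and> card D \<in> L'}" by auto
  moreover have "{D. D \<subseteq> I \<and> card D \<in> L} \<inter> {D. D \<subseteq> I \<and> card D \<in> L'} = {}" using assms by auto
  ultimately show ?thesis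
    unfolding subset_sum_def using finite_subsets_card[OF assms(1)]
    by (simp only: sum.union_disjoint)
qed

lemma subset_sum_nonneg: "(\<And>p. p \<in> I \<Longrightarrow> w p \<ge> 0) \<Longrightarrow> subset_sum I L w \<ge> 0"
  unfolding subset_sum_def by (intro sum_nonneg prod_nonneg) auto

text \<open>Each product over an l-subset occurs when the l-th power of the total is multiplied out.
  The induction splits the l-subsets by whether they contain the new element, as in Pascal's
  rule.\<close>

lemma subset_sum_le_power:
  assumes "finite I" "\<And>p. p \<in> I \<Longrightarrow> w p \<ge> 0"
  shows "subset_sum I {l} w \<le> (sum w I) ^ l"
  using assms
proof (induction I arbitrary: l rule: finite_induct)
  case empty
  have "{D. D = {} \<and> card D = l} = (if l = 0 then {{}} else ({} :: 'a set set))" by auto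
  then show ?case by (simp add: subset_sum_def)
next
  case (insert a I)
  show ?case
  proof (cases l)
    case 0
    then show ?thesis using insert.hyps by (simp add: subset_sum_zero)
  next
    case (Suc m)
    have eq: "{D. D \<subseteq> insert a I \<and> card D \<in> {l}} =
        {D. D \<subseteq> I \<and> card D \<in> {l}} \<union> insert a ` {D. D \<subseteq> I \<and> card D \<in> {m}}" (is "?A = ?B \<union> ?C")
    proof (intro equalityI subsetI)
      fix D assume D: "D \<in> ?A"
      show "D \<in> ?B \<union> ?C"
      proof (cases "a \<in> D")
        case True
        then have "D = insert a (D - {a})" by auto
        moreover have "card (D - {a}) = m" "D - {a} \<subseteq> I"
          using True D Suc finite_subset[of D "insert a I"] insert.hyps by auto
        ultimately show ?thesis by blast
      qed (use D in auto)
    next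
      fix D assume "D \<in> ?B \<union> ?C"
      moreover have "card (insert a E) = Suc (card E)" if "E \<subseteq> I" for E
        using that insert.hyps by (intro card_insert_disjoint) (auto intro: finite_subset)
      ultimately show "D \<in> ?A" using Suc by auto
    qed
    have "?B \<inter> ?C = {}" using insert.hyps by auto
    then have "subset_sum (insert a I) {l} w = subset_sum I {l} w + (\<Sum>D\<in>?C. \<Prod>p\<in>D. w p)"
      using insert.hyps unfolding subset_sum_def eq
      by (intro sum.union_disjoint finite_imageI finite_subsets_card)
    also have "(\<Sum>D\<in>?C. \<Prod>p\<in>D. w p) = (\<Sum>D | D \<subseteq> I \<and> card D \<in> {m}. \<Prod>p\<in>insert a D. w p)"
      using insert.hyps by (subst sum.reindex) (auto simp: inj_on_def)
    also have "\<dots> = (\<Sum>D | D \<subseteq> I \<and> card D \<in> {m}. w a * (\<Prod>p\<in>D. w p))"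
      using insert.hyps by (intro sum.cong refl prod.insert) (auto intro: finite_subset)
    also have "\<dots> = w a * subset_sum I {m} w" by (simp add: subset_sum_def sum_distrib_left)
    finally have "subset_sum (insert a I) {l} w = subset_sum I {l} w + w a * subset_sum I {m} w" .
    also have "\<dots> \<le> sum w I ^ l + w a * sum w I ^ m"
      using insert by (intro add_mono mult_left_mono) auto
    also have "\<dots> = (sum w I + w a) * sum w I ^ m" using Suc by (simp add: algebra_simps)
    also have "\<dots> \<le> (sum w I + w a) * (sum w I + w a) ^ m"
      using insert by (intro mult_left_mono power_mono) (auto intro!: sum_nonneg add_nonneg_nonneg)
    finally show ?thesis using insert.hyps Suc by (simp add: algebra_simps)
  qed
qed

lemma subset_sum_atMost:
  assumes "finite I"
  shows "subset_sum I {..J} w = (\<Sum>l\<le>J. subset_sum I {l} w)"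
proof (induction J)
  case 0
  have "{..0} = {0::nat}" by auto
  then show ?case by simp
next
  case (Suc J)
  have "{..Suc J} = {..J} \<union> {Suc J}" by auto
  then show ?case using Suc subset_sum_union[OF assms, of "{..J}" "{Suc J}" w] by simp
qed

lemma subset_sum_uminus:
  "subset_sum I {l} (\<lambda>p. - w p) = (-1) ^ l * subset_sum I {l} w"
  unfolding subset_sum_def sum_distrib_left
  by (intro sum.cong refl) (auto simp: prod_uminus)

text \<open>With s the total weight, degrees 0 and 1 give 1 - s; both are kept because the
  truncation is at \<open>Suc J\<close>. The rest is at most s^2 / (1 - s) <= 2 s^2 <= s / 2 for s
  <= 1/4, so half of the linear gain survives in every block.\<close>

lemma abs_subset_sum_atMost_le:
  assumes "finite I" "\<And>p. p \<in> I \<Longrightarrow> w p \<ge> 0" "sum w I \<le> 1 / 4"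
  shows "\<bar>subset_sum I {..Suc J} (\<lambda>p. - w p)\<bar> \<le> 1 - sum w I / 2"
proof -
  define s where "s = sum w I"
  have s: "0 \<le> s" "s \<le> 1 / 4" using assms by (auto simp: s_def intro: sum_nonneg)
  define R where "R = (\<Sum>l\<in>{2..Suc J}. subset_sum I {l} (\<lambda>p. - w p))"
  have "{..Suc J} = {0, 1} \<union> {2..Suc J}" by auto
  then have "subset_sum I {..Suc J} (\<lambda>p. - w p) = (\<Sum>l\<in>{0,1}. subset_sum I {l} (\<lambda>p. - w p)) + R"
    unfolding subset_sum_atMost[OF assms(1)] R_def by (simp only:) (rule sum.union_disjoint, auto)
  also have "(\<Sum>l\<in>{0,1}. subset_sum I {l} (\<lambda>p. - w p)) = 1 - s"
    using subset_sum_one[OF assms(1), of "\<lambda>p. - w p"] subset_sum_zero[OF assms(1)]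
    by (simp add: s_def sum_negf)
  finally have eq: "subset_sum I {..Suc J} (\<lambda>p. - w p) = 1 - s + R" .
  have "\<bar>subset_sum I {l} (\<lambda>p. - w p)\<bar> \<le> s ^ l" for l
    using subset_sum_le_power[of I w l] subset_sum_nonneg[of I w "{l}"] assms
    by (simp add: subset_sum_uminus abs_mult s_def)
  then have "\<bar>R\<bar> \<le> (\<Sum>l\<in>{2..Suc J}. s ^ l)"
    unfolding R_def by (intro order_trans[OF sum_abs] sum_mono)
  also have "\<dots> \<le> 2 * s\<^sup>2"
  proof (cases "J = 0")
    case False
    then have "(\<Sum>l\<in>{2..Suc J}. s ^ l) = (s\<^sup>2 - s ^ Suc (Suc J)) / (1 - s)"
      using s by (subst sum_gp) auto
    also have "\<dots> \<le> s\<^sup>2 / (1 - s)" using s by (intro divide_right_mono) auto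
    also have "\<dots> \<le> s\<^sup>2 / (1 / 2)" using s by (intro divide_left_mono) auto
    finally show ?thesis by simp
  qed auto
  also have "\<dots> \<le> s / 2"
    using mult_left_mono[OF s(2) s(1)] by (simp add: power2_eq_square)
  finally show ?thesis using s unfolding eq s_def[symmetric] by linarith
qed

lemma subset_sum_zero_or_le:
  assumes "finite I" "\<And>p. p \<in> I \<Longrightarrow> w p \<ge> 0" "m > 0"
  shows "subset_sum I {0, m} w \<le> 1 + sum w I ^ m" "1 \<le> subset_sum I {0, m} w"
proof -
  have "subset_sum I {0, m} w = 1 + subset_sum I {m} w"
    using subset_sum_union[OF assms(1), of "{0}" "{m}" w] assms(3) subset_sum_zero[OF assms(1)]
    by (simp add: insert_commute)
  then show "subset_sum I {0, m} w \<le> 1 + sum w I ^ m" "1 \<le> subset_sum I {0, m} w"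
    using subset_sum_le_power[OF assms(1,2)] subset_sum_nonneg[of I w "{m}"] assms(2) by auto
qed

text \<open>If \<open>I \<inter> X\<close> has more than \<open>J\<close> elements, then each of its subsets of size at most \<open>J\<close> lies in one of
  size \<open>J + 1\<close>; this is why the weight \<open>4\<close> in \<open>U\<close> suffices to dominate \<open>T\<close>.\<close>

lemma truncated_parity:
  fixes I X :: "'a set" and J :: nat
  assumes "finite I"
  defines "T \<equiv> subset_sum I {..J} (\<lambda>p. -2 * of_bool (p \<in> X))"
    and "U \<equiv> subset_sum I {0, Suc J} (\<lambda>p. 4 * of_bool (p \<in> X))"
  shows "T = (-1) ^ card (I \<inter> X) \<or> 2 \<le> U \<and> \<bar>T\<bar> \<le> U - 1"
proof (cases "card (I \<inter> X) \<le> J")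
  define Y where "Y = I \<inter> X"
  have Y: "finite Y" using assms by (simp add: Y_def)
  case True
  then have "card D \<le> J" if "D \<subseteq> Y" for D
    using card_mono[OF Y that] by (simp add: Y_def)
  then have "{D. D \<subseteq> Y \<and> card D \<in> {..J}} = Pow Y" by auto
  \<comment> \<open>All subsets of \<open>Y\<close> occur here, and the sum of (-2)^|D| over them is
    (1 - 2)^|Y|.\<close>
  then have "T = (-1) ^ card Y"
    unfolding T_def subset_sum_of_bool[OF assms(1)] Y_def[symmetric]
    using sum_Pow_power_card[OF Y, of "-2"] by simp
  then show ?thesis by (simp add: Y_def)
next
  define Y where "Y = I \<inter> X"
  have Y: "finite Y" using assms by (simp add: Y_def)
  case False
  define A where "A = {E. E \<subseteq> Y \<and> card E = Suc J}"
  have A: "finite A" unfolding A_def using Y by auto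
  obtain E where "E \<subseteq> Y" "card E = Suc J"
    using False obtain_subset_with_card_n[of "Suc J" Y] by (metis Y_def not_less_eq_eq)
  then have "A \<noteq> {}" unfolding A_def by blast
  then have cA: "card A \<ge> 1" using A by (simp add: Suc_leI card_gt_0_iff)
  have "U = subset_sum I {0} (\<lambda>p. 4 * of_bool (p \<in> X)) + subset_sum I {Suc J} (\<lambda>p. 4 * of_bool (p \<in> X))"
    unfolding U_def using subset_sum_union[OF assms(1), of "{0}" "{Suc J}"] by (simp add: insert_commute)
  also have "\<dots> = 1 + (\<Sum>E\<in>A. 4 ^ card E)"
    unfolding subset_sum_zero[OF assms(1)] by (simp add: subset_sum_of_bool[OF assms(1)] A_def Y_def)
  also have "(\<Sum>E\<in>A. 4 ^ card E) = (\<Sum>E\<in>A. 4 ^ Suc J :: real)"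
    by (intro sum.cong) (auto simp: A_def)
  finally have U: "U = 1 + real (card A) * 4 ^ Suc J" by simp
  have sub: "{D. D \<subseteq> Y \<and> card D \<in> {..J}} \<subseteq> (\<Union>E\<in>A. Pow E)"
  proof
    fix D assume "D \<in> {D. D \<subseteq> Y \<and> card D \<in> {..J}}"
    then have D: "D \<subseteq> Y" "card D \<le> J" by auto
    obtain E where "D \<subseteq> E" "E \<subseteq> Y" "card E = Suc J"
      using exists_subset_between[of D "Suc J" Y] D False Y by (metis Y_def le_SucI not_less_eq_eq)
    then show "D \<in> (\<Union>E\<in>A. Pow E)" by (auto simp: A_def)
  qed
  have "\<bar>T\<bar> \<le> (\<Sum>D | D \<subseteq> Y \<and> card D \<in> {..J}. 2 ^ J)"
    unfolding T_def subset_sum_of_bool[OF assms(1)] Y_def[symmetric]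
    by (intro order_trans[OF sum_abs] sum_mono) (auto simp: power_abs intro!: power_increasing)
  also have "\<dots> = real (card {D. D \<subseteq> Y \<and> card D \<in> {..J}}) * 2 ^ J" by simp
  also have "\<dots> \<le> real (card (\<Union>E\<in>A. Pow E)) * 2 ^ J"
    using A Y by (intro mult_right_mono of_nat_mono card_mono[OF _ sub])
      (auto simp: A_def intro: finite_subset)
  also have "card (\<Union>E\<in>A. Pow E) \<le> (\<Sum>E\<in>A. card (Pow E))" by (rule card_UN_le[OF A])
  also have "\<dots> = (\<Sum>E\<in>A. 2 ^ Suc J)"
    using Y by (intro sum.cong refl) (auto simp: A_def card_Pow dest: finite_subset)
  \<comment> \<open>Each \<open>E\<close> has 2^(J+1) subsets of weight at most 2^J, in total 2 *
    4^J, which stays below the 4^(J+1) that \<open>E\<close> contributes to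
    \<open>U\<close>.\<close>
  also have "real (\<Sum>E\<in>A. 2 ^ Suc J) * 2 ^ J = real (card A) * (2 * 4 ^ J)"
    by (simp add: power_mult_distrib[symmetric])
  also have "\<dots> \<le> U - 1" unfolding U by simp
  finally have T: "\<bar>T\<bar> \<le> U - 1" by simp
  have "real 1 * 1 \<le> real (card A) * 4 ^ Suc J" 
    by (intro mult_mono of_nat_mono cA one_le_power) auto
  then show ?thesis using T U by simp
qed

text \<open>If every factor is right, the difference is 0. Otherwise one wrong factor suffices:
  there \<open>U i - 1\<close> dominates \<open>T i\<close> and \<open>U i\<close> is at least 2, so
  the product of the \<open>U j\<close> minus 1 dominates both the product of the \<open>T j\<close>
  and the modulus 1 of the true sign.\<close>

lemma prod_diff_le_majorant:
  fixes a T U :: "nat \<Rightarrow> real"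
  assumes "\<And>j. j < M \<Longrightarrow> \<bar>a j\<bar> = 1" "\<And>j. j < M \<Longrightarrow> U j \<ge> 1"
    and "\<And>j. j < M \<Longrightarrow> T j = a j \<or> 2 \<le> U j \<and> \<bar>T j\<bar> \<le> U j - 1"
  shows "\<bar>(\<Prod>j<M. a j) - (\<Prod>j<M. T j)\<bar> \<le> 2 * ((\<Prod>j<M. U j) - 1)"
proof (cases "\<forall>j<M. T j = a j")
  case True
  moreover have "(\<Prod>j<M. U j) \<ge> 1" using assms(2) by (intro prod_ge_1) auto
  ultimately show ?thesis by simp
next
  case False
  then obtain i where i: "i < M" "2 \<le> U i" "\<bar>T i\<bar> \<le> U i - 1" using assms(3) by blast
  have 1: "(\<Prod>j\<in>{..<M} - {i}. U j) \<ge> 1" using assms(2) by (intro prod_ge_1) auto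
  have T: "\<bar>T j\<bar> \<le> U j" if "j < M" for j using assms[OF that] by auto
  have eq: "(\<Prod>j<M. U j) = U i * (\<Prod>j\<in>{..<M} - {i}. U j)" using i by (subst prod.remove[of _ i]) auto
  have "\<bar>\<Prod>j<M. T j\<bar> = \<bar>T i\<bar> * (\<Prod>j\<in>{..<M} - {i}. \<bar>T j\<bar>)"
    using i by (subst prod.remove[of _ i]) (auto simp: abs_mult abs_prod)
  also have "\<dots> \<le> (U i - 1) * (\<Prod>j\<in>{..<M} - {i}. U j)"
    using i T by (intro mult_mono prod_mono prod_nonneg) auto
  also have "\<dots> \<le> (\<Prod>j<M. U j) - 1" using 1 by (simp add: eq algebra_simps)
  finally have 2: "\<bar>\<Prod>j<M. T j\<bar> \<le> (\<Prod>j<M. U j) - 1" .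
  have 3: "\<bar>\<Prod>j<M. a j\<bar> = 1" using assms(1) by (simp add: abs_prod)
  have "2 * 1 \<le> U i * (\<Prod>j\<in>{..<M} - {i}. U j)" using i 1 by (intro mult_mono) auto
  then have "1 \<le> (\<Prod>j<M. U j) - 1" unfolding eq by simp
  have "\<bar>(\<Prod>j<M. a j) - (\<Prod>j<M. T j)\<bar> \<le> \<bar>\<Prod>j<M. a j\<bar> + \<bar>\<Prod>j<M. T j\<bar>"
    by (rule abs_triangle_ineq4)
  also have "\<dots> \<le> ((\<Prod>j<M. U j) - 1) + ((\<Prod>j<M. U j) - 1)"
    unfolding 3 by (intro add_mono 2) fact
  finally show ?thesis by simp
qed

subsection \<open>Brun's sieve for the parity of a divisor count\<close>

lemma finite_block_subsets: "(\<And>j. finite (I j)) \<Longrightarrow> finite (block_subsets I L M)"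
  by (rule finite_subset[of _ "Pow (\<Union>j<M. I j)"]) (auto simp: block_subsets_def)

text \<open>By unique factorisation \<open>D\<close> is determined by its product, so there are at
  most \<open>B\<close> sets; and since \<open>a\<close> is at most every prime in \<open>D\<close>,
  each term is at most that product, again at most \<open>B\<close>.\<close>

lemma sum_power_card_le:
  fixes a :: real and DD :: "nat set set"
  assumes "finite DD" "\<And>D. D \<in> DD \<Longrightarrow> finite D"
    and "\<And>D p. D \<in> DD \<Longrightarrow> p \<in> D \<Longrightarrow> prime p" "\<And>D p. D \<in> DD \<Longrightarrow> p \<in> D \<Longrightarrow> a \<le> real p"
    and "\<And>D. D \<in> DD \<Longrightarrow> \<Prod>D \<le> B" "a \<ge> 0"
  shows "(\<Sum>D\<in>DD. a ^ card D) \<le> (real B)\<^sup>2"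
proof -
  have "(\<Sum>D\<in>DD. a ^ card D) \<le> (\<Sum>D\<in>DD. real B)"
  proof (rule sum_mono)
    fix D assume D: "D \<in> DD"
    have "a ^ card D = (\<Prod>p\<in>D. a)" by simp
    also have "\<dots> \<le> (\<Prod>p\<in>D. real p)" using assms D by (intro prod_mono) auto
    also have "\<dots> = real (\<Prod>D)" by simp
    finally show "a ^ card D \<le> real B" using assms(5)[OF D] by linarith
  qed
  also have "\<dots> = real (card DD) * real B" by simp
  also have "card DD = card (Prod ` DD)"
    using assms by (intro card_image[symmetric] inj_on_Prod_primes) auto
  also have "Prod ` DD \<subseteq> {1..B}"
  proof clarify
    fix D assume D: "D \<in> DD"
    have "\<Prod>D > 0" using assms(2,3)[OF D] by (intro prod_pos) (auto simp: prime_gt_0_nat)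
    then show "\<Prod>D \<in> {1..B}" using assms(5)[OF D] by simp
  qed
  then have "card (Prod ` DD) \<le> B" using card_mono[of "{1..B}"] by fastforce
  then have "real (card (Prod ` DD)) * real B \<le> real B * real B" by (intro mult_right_mono) auto
  finally show ?thesis by (simp add: power2_eq_square)
qed

text \<open>\<open>I_shift\<close> keeps the classes of -h distinct modulo each prime,
  \<open>I_large\<close> lets a prime absorb the factor 4 |S| that it costs in the error, and
  \<open>level\<close> bounds the divisors that occur. The allowance j + 2 exceeds the truncation
  length j + 1 by one because the majorant uses sets of that size.\<close>

locale sieve =
  fixes S :: "nat set" and W :: nat and I :: "nat \<Rightarrow> nat set" and M B :: nat
  assumes S: "finite S" "S \<noteq> {}" and W: "W > 0"
    and I: "\<And>j. finite (I j)" "disjoint_family I"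
    and I_prime: "\<And>j p. p \<in> I j \<Longrightarrow> prime p"
    and I_coprime: "\<And>j p. p \<in> I j \<Longrightarrow> coprime W p"
    and I_shift: "\<And>j p h. p \<in> I j \<Longrightarrow> h \<in> S \<Longrightarrow> h < p"
    and I_large: "\<And>j p. p \<in> I j \<Longrightarrow> 4 * card S \<le> p"
    and level: "\<And>D. D \<subseteq> (\<Union>j<M. I j) \<Longrightarrow> (\<And>j. j < M \<Longrightarrow> card (D \<inter> I j) \<le> j + 2) \<Longrightarrow> \<Prod>D \<le> B"
begin

definition X :: "nat \<Rightarrow> nat set" where
  "X n = {p. \<exists>h\<in>S. p dvd n + h}"

definition prog :: "nat \<Rightarrow> nat \<Rightarrow> nat set" where
  "prog r N = {n\<in>{1..N}. [n = r] (mod W)}"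

text \<open>A prime p of the block divides some n + h with density |S| / p; under the weights -2
  this is the linear term of the block up to sign.\<close>

definition mass :: "nat \<Rightarrow> real" where
  "mass j = (\<Sum>p\<in>I j. 2 * real (card S) / real p)"

lemma finite_prog: "finite (prog r N)"
  by (simp add: prog_def)

text \<open>Serves both the truncation (c = -2) and the majorant (c = 4). After expanding over
  divisors \<open>D\<close> and exchanging the sums, each \<open>D\<close> is counted with error at
  most |S|^|D|; with its coefficient this is at most (4 |S|)^|D|, and these add up to at most
  B^2.\<close>

lemma average_truncation:
  fixes c :: real
  assumes L: "\<And>j l. j < M \<Longrightarrow> l \<in> L j \<Longrightarrow> l \<le> j + 2" and c: "\<bar>c\<bar> \<le> 4"
  shows "\<bar>(\<Sum>n\<in>prog r N. \<Prod>j<M. subset_sum (I j) (L j) (\<lambda>p. c * of_bool (p \<in> X n)))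
      - real N / real W * (\<Prod>j<M. subset_sum (I j) (L j) (\<lambda>p. c * real (card S) / real p))\<bar> \<le> (real B)\<^sup>2"
proof -
  define DD where "DD = block_subsets I L M"
  define k where "k = real (card S)"
  have fin: "finite DD" unfolding DD_def using I(1) by (rule finite_block_subsets)
  have D_sub: "D \<subseteq> (\<Union>j<M. I j)" if "D \<in> DD" for D using that by (auto simp: DD_def block_subsets_def)
  have D_fin: "finite D" if "D \<in> DD" for D
    by (rule finite_subset[OF D_sub[OF that]]) (simp add: I(1))
  have D_le: "\<Prod>D \<le> B" if "D \<in> DD" for D
    using that L by (intro level) (auto simp: DD_def block_subsets_def)
  have term_eq: "(\<Sum>n\<in>prog r N. \<Prod>p\<in>D. c * of_bool (p \<in> X n))
      = c ^ card D * real (card {n\<in>{1..N}. [n = r] (mod W) \<and> (\<forall>p\<in>D. \<exists>h\<in>S. p dvd n + h)})"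
    if "D \<in> DD" for D
  proof -
    have "(\<Prod>p\<in>D. c * of_bool (p \<in> X n)) = c ^ card D * of_bool (D \<subseteq> X n)" for n
      using D_fin[OF that] by (auto simp: prod.distrib subset_eq)
    then have "(\<Sum>n\<in>prog r N. \<Prod>p\<in>D. c * of_bool (p \<in> X n))
        = c ^ card D * (\<Sum>n\<in>prog r N. of_bool (D \<subseteq> X n))"
      by (simp add: sum_distrib_left)
    also have "(\<Sum>n\<in>prog r N. of_bool (D \<subseteq> X n)) = real (card (prog r N \<inter> {n. D \<subseteq> X n}))"
      by (simp add: finite_prog)
    also have "prog r N \<inter> {n. D \<subseteq> X n} = {n\<in>{1..N}. [n = r] (mod W) \<and> (\<forall>p\<in>D. \<exists>h\<in>S. p dvd n + h)}"
      by (auto simp: prog_def X_def)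
    finally show ?thesis .
  qed
  have err: "\<bar>(\<Sum>n\<in>prog r N. \<Prod>p\<in>D. c * of_bool (p \<in> X n)) - real N / real W * (\<Prod>p\<in>D. c * k / real p)\<bar>
      \<le> (4 * k) ^ card D" if D: "D \<in> DD" for D
  proof -
    define m where "m = real (card {n\<in>{1..N}. [n = r] (mod W) \<and> (\<forall>p\<in>D. \<exists>h\<in>S. p dvd n + h)})"
    have "\<bar>m - real N / real W * (\<Prod>p\<in>D. k / real p)\<bar> \<le> k ^ card D"
      unfolding m_def k_def using D_fin[OF D] D_sub[OF D] S(1) W I_prime I_coprime I_shift
      by (intro card_cong_sieve) blast+
    then have "\<bar>c\<bar> ^ card D * \<bar>m - real N / real W * (\<Prod>p\<in>D. k / real p)\<bar> \<le> 4 ^ card D * k ^ card D"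
      using c by (intro mult_mono power_mono) (auto simp: k_def)
    also have "\<bar>c\<bar> ^ card D * \<bar>m - real N / real W * (\<Prod>p\<in>D. k / real p)\<bar>
        = \<bar>c ^ card D * m - real N / real W * (\<Prod>p\<in>D. c * k / real p)\<bar>"
      by (simp add: power_abs[symmetric] abs_mult[symmetric] prod.distrib prod_dividef algebra_simps power_mult_distrib)
    finally show ?thesis by (simp add: term_eq[OF D] m_def power_mult_distrib)
  qed
  have "(\<Sum>n\<in>prog r N. \<Prod>j<M. subset_sum (I j) (L j) (\<lambda>p. c * of_bool (p \<in> X n)))
      = (\<Sum>D\<in>DD. \<Sum>n\<in>prog r N. \<Prod>p\<in>D. c * of_bool (p \<in> X n))"
    by (subst sum.swap) (simp add: DD_def sum_block_subsets[OF I])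
  moreover have "real N / real W * (\<Prod>j<M. subset_sum (I j) (L j) (\<lambda>p. c * k / real p))
      = (\<Sum>D\<in>DD. real N / real W * (\<Prod>p\<in>D. c * k / real p))"
    unfolding DD_def sum_block_subsets[OF I, symmetric] sum_distrib_left ..
  ultimately have "\<bar>(\<Sum>n\<in>prog r N. \<Prod>j<M. subset_sum (I j) (L j) (\<lambda>p. c * of_bool (p \<in> X n)))
      - real N / real W * (\<Prod>j<M. subset_sum (I j) (L j) (\<lambda>p. c * k / real p))\<bar>
      \<le> (\<Sum>D\<in>DD. (4 * k) ^ card D)"
    unfolding sum_subtractf[symmetric] using err
    by (simp only: sum_subtractf[symmetric]) (intro order_trans[OF sum_abs] sum_mono, auto)
  also have "\<dots> \<le> (real B)\<^sup>2"
  proof (rule sum_power_card_le[OF fin D_fin _ _ D_le])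
    fix D p assume "D \<in> DD" "p \<in> D"
    then obtain j where "p \<in> I j" using D_sub by blast
    then show "prime p" "4 * k \<le> real p" using I_prime I_large[of p j] by (auto simp: k_def)
  qed (auto simp: k_def)
  finally show ?thesis unfolding k_def .
qed

text \<open>The parity over the union is the product of the block parities. Passing to the
  truncations costs twice the sum of the majorant minus 1. The sieve error occurs once for the
  truncation and twice for the majorant, hence 3 B^2.\<close>

lemma parity_sum_le:
  assumes small: "\<And>j. j < M \<Longrightarrow> mass j \<le> 1 / 4"
  shows "\<bar>\<Sum>n\<in>prog r N. (-1) ^ card ((\<Union>j<M. I j) \<inter> X n)\<bar>
    \<le> real N / real W * ((\<Prod>j<M. 1 - mass j / 2) + 2 * ((\<Prod>j<M. 1 + (2 * mass j) ^ (j + 2)) - 1))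
      + 3 * (real B)\<^sup>2 + 2"
proof -
  define T where "T = (\<lambda>j n. subset_sum (I j) {..Suc j} (\<lambda>p. -2 * of_bool (p \<in> X n)))"
  define U where "U = (\<lambda>j n. subset_sum (I j) {0, Suc (Suc j)} (\<lambda>p. 4 * of_bool (p \<in> X n)))"
  define a where "a = (\<lambda>j n. (-1) ^ card (I j \<inter> X n) :: real)"
  define b where "b = real N / real W"
  have b: "b \<ge> 0" by (simp add: b_def)
  have F: "(-1) ^ card ((\<Union>j<M. I j) \<inter> X n) = (\<Prod>j<M. a j n)" for n
  proof -
    have "card ((\<Union>j<M. I j) \<inter> X n) = card (\<Union>j<M. I j \<inter> X n)" by (simp add: Int_UN_distrib2)
    also have "\<dots> = (\<Sum>j<M. card (I j \<inter> X n))"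
    proof (intro card_UN_disjoint ballI impI)
      fix i j :: nat assume "i \<noteq> j"
      then show "(I i \<inter> X n) \<inter> (I j \<inter> X n) = {}" using disjoint_family_onD[OF I(2), of i j] by auto
    qed (auto simp: I(1))
    finally show ?thesis by (simp add: a_def power_sum)
  qed
  have diff: "\<bar>(\<Prod>j<M. a j n) - (\<Prod>j<M. T j n)\<bar> \<le> 2 * ((\<Prod>j<M. U j n) - 1)" for n
  proof (rule prod_diff_le_majorant)
    fix j assume "j < M"
    show "\<bar>a j n\<bar> = 1" by (simp add: a_def power_abs)
    show "U j n \<ge> 1" unfolding U_def using I(1) by (intro subset_sum_zero_or_le) auto
    show "T j n = a j n \<or> 2 \<le> U j n \<and> \<bar>T j n\<bar> \<le> U j n - 1"
      unfolding T_def U_def a_def by (rule truncated_parity[OF I(1)])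
  qed
  have "\<bar>(\<Sum>n\<in>prog r N. \<Prod>j<M. T j n) -
      b * (\<Prod>j<M. subset_sum (I j) {..Suc j} (\<lambda>p. -2 * real (card S) / real p))\<bar> \<le> (real B)\<^sup>2"
    unfolding T_def b_def by (rule average_truncation) auto
  moreover have "\<bar>\<Prod>j<M. subset_sum (I j) {..Suc j} (\<lambda>p. -2 * real (card S) / real p)\<bar> \<le> (\<Prod>j<M. 1 - mass j / 2)"
    unfolding abs_prod
  proof (intro prod_mono conjI abs_ge_zero)
    fix j assume "j \<in> {..<M}"
    then show "\<bar>subset_sum (I j) {..Suc j} (\<lambda>p. -2 * real (card S) / real p)\<bar> \<le> 1 - mass j / 2"
      using abs_subset_sum_atMost_le[OF I(1), of j "\<lambda>p. 2 * real (card S) / real p" j] small[of j]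
      by (simp add: mass_def)
  qed
  then have "\<bar>b * (\<Prod>j<M. subset_sum (I j) {..Suc j} (\<lambda>p. -2 * real (card S) / real p))\<bar> \<le> b * (\<Prod>j<M. 1 - mass j / 2)"
    using b by (simp only: abs_mult abs_of_nonneg) (rule mult_left_mono)
  ultimately have T: "\<bar>\<Sum>n\<in>prog r N. \<Prod>j<M. T j n\<bar> \<le> b * (\<Prod>j<M. 1 - mass j / 2) + (real B)\<^sup>2"
    by linarith
  have "\<bar>(\<Sum>n\<in>prog r N. \<Prod>j<M. U j n) -
      b * (\<Prod>j<M. subset_sum (I j) {0, Suc (Suc j)} (\<lambda>p. 4 * real (card S) / real p))\<bar> \<le> (real B)\<^sup>2"
    unfolding U_def b_def by (rule average_truncation) auto
  moreover have "(\<Prod>j<M. subset_sum (I j) {0, Suc (Suc j)} (\<lambda>p. 4 * real (card S) / real p)) \<le> (\<Prod>j<M. 1 + (2 * mass j) ^ (j + 2))"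
  proof (intro prod_mono conjI)
    fix j assume "j \<in> {..<M}"
    have "(\<Sum>p\<in>I j. 4 * real (card S) / real p) = 2 * mass j"
      by (simp add: mass_def sum_distrib_left)
    then show "subset_sum (I j) {0, Suc (Suc j)} (\<lambda>p. 4 * real (card S) / real p) \<le> 1 + (2 * mass j) ^ (j + 2)"
      using subset_sum_zero_or_le(1)[OF I(1), of j "\<lambda>p. 4 * real (card S) / real p" "Suc (Suc j)"] by simp
    show "0 \<le> subset_sum (I j) {0, Suc (Suc j)} (\<lambda>p. 4 * real (card S) / real p)"
      by (intro subset_sum_nonneg) auto
  qed
  then have "b * (\<Prod>j<M. subset_sum (I j) {0, Suc (Suc j)} (\<lambda>p. 4 * real (card S) / real p))
      \<le> b * (\<Prod>j<M. 1 + (2 * mass j) ^ (j + 2))"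
    using b by (rule mult_left_mono)
  ultimately have U: "(\<Sum>n\<in>prog r N. \<Prod>j<M. U j n) \<le> b * (\<Prod>j<M. 1 + (2 * mass j) ^ (j + 2)) + (real B)\<^sup>2"
    by linarith
  \<comment> \<open>The majorant enters minus the number of terms, so the progression must be
    bounded from below; the loss of 1, doubled, is the final 2.\<close>
  have card: "real (card (prog r N)) \<ge> b - 1"
    using card_cong_atLeastAtMost[OF W, of N r] by (simp add: prog_def b_def abs_le_iff)
  have "\<bar>(\<Sum>n\<in>prog r N. \<Prod>j<M. a j n) - (\<Sum>n\<in>prog r N. \<Prod>j<M. T j n)\<bar>
      \<le> (\<Sum>n\<in>prog r N. 2 * ((\<Prod>j<M. U j n) - 1))"
    unfolding sum_subtractf[symmetric] by (intro order_trans[OF sum_abs] sum_mono diff)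
  also have "\<dots> = 2 * ((\<Sum>n\<in>prog r N. \<Prod>j<M. U j n) - real (card (prog r N)))"
    by (simp add: sum_distrib_left[symmetric] sum_subtractf)
  also have "\<dots> \<le> 2 * (b * (\<Prod>j<M. 1 + (2 * mass j) ^ (j + 2)) + (real B)\<^sup>2 - (b - 1))"
    using U card by simp
  finally show ?thesis unfolding F b_def[symmetric] using T by (simp add: algebra_simps)
qed

end

subsection \<open>Primes of relative density zero\<close>

text \<open>Chebyshev's argument: every prime in (n, 2n] divides the central binomial coefficient,
  which is at most 4^n; here n = 2^i.\<close>

lemma card_primes_dyadic_le:
  "i * card {p. prime p \<and> 2 ^ i < p \<and> p \<le> (2::nat) ^ Suc i} \<le> 2 ^ Suc i"
proof -
  define n :: nat where "n = 2 ^ i"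
  define A where "A = {p. prime p \<and> n < p \<and> p \<le> 2 * n}"
  have A: "finite A" unfolding A_def by auto
  have "p dvd (2 * n) choose n" if "p \<in> A" for p
  proof -
    have p: "prime p" "n < p" "p \<le> 2 * n" using that by (auto simp: A_def)
    have "p dvd fact (2 * n)" using p prime_dvd_fact_iff by blast
    also have "fact (2 * n) = fact n * fact n * (2 * n choose n)"
      using binomial_fact_lemma[of n "2 * n"] by simp
    finally show ?thesis using p by (simp add: prime_dvd_mult_iff prime_dvd_fact_iff)
  qed
  then have "\<Prod>A dvd (2 * n) choose n"
  proof -
    assume *: "\<And>p. p \<in> A \<Longrightarrow> p dvd (2 * n) choose n"
    have "(\<Prod>p\<in>B. p) dvd (2 * n) choose n" if "B \<subseteq> A" for B
      using finite_subset[OF that A] that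
    proof (induction B rule: finite_induct)
      case (insert p B)
      have "coprime p (\<Prod>p\<in>B. p)"
        using insert by (intro prod_coprime_right) (auto simp: A_def intro!: primes_coprime)
      then show ?case using insert * by (simp add: divides_mult)
    qed simp
    then show ?thesis by simp
  qed
  then have "\<Prod>A \<le> (2 * n) choose n" by (intro dvd_imp_le) auto
  also have "\<dots> \<le> 2 ^ (2 * n)" by (rule binomial_le_pow2)
  finally have "\<Prod>A \<le> 2 ^ (2 * n)" .
  moreover have "(\<Prod>p\<in>A. n) \<le> \<Prod>A" by (intro prod_mono) (auto simp: A_def)
  ultimately have "n ^ card A \<le> 2 ^ (2 * n)" by simp
  then have "2 ^ (i * card A) \<le> (2::nat) ^ (2 * n)" by (simp only: n_def power_mult)
  then have "i * card A \<le> 2 * n" using power_le_imp_le_exp by (metis one_less_numeral_iff semiring_norm(76))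
  then show ?thesis by (simp add: A_def n_def)
qed

text \<open>Chebyshev's upper bound at powers of two. With constant 6 the induction step needs 8 (i
  + 1) <= 12 i, that is i >= 2; below that the trivial count is enough.\<close>

lemma card_primes_power_le: "i * card {p. prime p \<and> p \<le> (2::nat) ^ i} \<le> 6 * 2 ^ i"
proof (induction i)
  case (Suc i)
  define \<pi> where "\<pi> = (\<lambda>i. card {p. prime p \<and> p \<le> (2::nat) ^ i})"
  define d where "d = card {p. prime p \<and> 2 ^ i < p \<and> p \<le> (2::nat) ^ Suc i}"
  have IH: "i * \<pi> i \<le> 6 * 2 ^ i" using Suc by (simp add: \<pi>_def)
  show ?case
  proof (cases "i < 2")
    case True
    have "\<pi> (Suc i) \<le> card {1..(2::nat) ^ Suc i}"
      unfolding \<pi>_def by (intro card_mono) (auto simp: Suc_le_eq prime_gt_0_nat)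
    then have "Suc i * \<pi> (Suc i) \<le> 2 * 2 ^ Suc i" using True by (intro mult_mono) auto
    also have "\<dots> \<le> 6 * 2 ^ Suc i" by simp
    finally show ?thesis by (simp add: \<pi>_def)
  next
    case False
    have "{p. prime p \<and> p \<le> (2::nat) ^ Suc i} =
        {p. prime p \<and> p \<le> 2 ^ i} \<union> {p. prime p \<and> 2 ^ i < p \<and> p \<le> 2 ^ Suc i}" by auto
    then have "\<pi> (Suc i) \<le> \<pi> i + d" unfolding \<pi>_def d_def by (metis card_Un_le)
    then have "i * \<pi> (Suc i) \<le> i * \<pi> i + i * d" by (metis mult_le_mono2 distrib_left)
    also have "i * d \<le> 2 ^ Suc i" unfolding d_def by (rule card_primes_dyadic_le)
    finally have *: "i * \<pi> (Suc i) \<le> 8 * 2 ^ i" using IH by simp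
    have "i * (Suc i * \<pi> (Suc i)) = Suc i * (i * \<pi> (Suc i))" by (rule mult.left_commute)
    also have "\<dots> \<le> Suc i * (8 * 2 ^ i)" using * by (rule mult_le_mono2)
    also have "\<dots> \<le> i * (6 * 2 ^ Suc i)"
    proof -
      have "Suc i * 8 \<le> i * 12" using False by simp
      then have "Suc i * 8 * 2 ^ i \<le> i * 12 * 2 ^ i" by (rule mult_le_mono1)
      then show ?thesis by (simp add: mult_ac)
    qed
    finally show ?thesis using False by (simp add: \<pi>_def)
  qed
qed simp

section \<open>Sums of reciprocals over half-open intervals\<close>

definition recip_sum :: "nat set \<Rightarrow> nat \<Rightarrow> nat \<Rightarrow> real" where
  "recip_sum P a b = (\<Sum>p\<in>P \<inter> {a<..b}. 1 / real p)"

lemma recip_sum_nonneg: "recip_sum P a b \<ge> 0"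
  unfolding recip_sum_def by (intro sum_nonneg) auto

lemma recip_sum_add:
  assumes "a \<le> b" "b \<le> c"
  shows "recip_sum P a c = recip_sum P a b + recip_sum P b c"
proof -
  have "P \<inter> {a<..c} = P \<inter> {a<..b} \<union> P \<inter> {b<..c}" using assms by auto
  then show ?thesis unfolding recip_sum_def by (simp only:) (rule sum.union_disjoint, auto)
qed

lemma recip_sum_mono: "a' \<le> a \<Longrightarrow> b \<le> b' \<Longrightarrow> recip_sum P a b \<le> recip_sum P a' b'"
  unfolding recip_sum_def by (intro sum_mono2) auto

lemma recip_sum_le_card:
  assumes "a > 0"
  shows "recip_sum P a b \<le> real (card (P \<inter> {1..b})) / real a"
proof -
  have "recip_sum P a b \<le> (\<Sum>p\<in>P \<inter> {a<..b}. 1 / real a)"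
    unfolding recip_sum_def using assms by (intro sum_mono divide_left_mono) auto
  also have "\<dots> = real (card (P \<inter> {a<..b})) / real a" by simp
  also have "\<dots> \<le> real (card (P \<inter> {1..b})) / real a"
    by (intro divide_right_mono of_nat_mono card_mono) auto
  finally show ?thesis .
qed

lemma recip_sum_dyadic:
  "recip_sum P (2 ^ m) (2 ^ (m + k)) = (\<Sum>i\<in>{m..<m + k}. recip_sum P (2 ^ i) (2 ^ Suc i))"
proof (induction k)
  case 0
  then show ?case by (simp add: recip_sum_def)
next
  case (Suc k)
  have "(2::nat) ^ m \<le> 2 ^ (m + k)" by (intro power_increasing) auto
  moreover have "(2::nat) ^ (m + k) \<le> 2 ^ (m + Suc k)" by (intro power_increasing) auto
  ultimately show ?case
    using Suc recip_sum_add[of "2 ^ m" "2 ^ (m + k)" "2 ^ (m + Suc k)" P] by simp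
qed

text \<open>Between the square root of u and u there are about (log u) / 2 dyadic pieces, and by
  Chebyshev's bound all primes of a piece contribute O(1 / log u). Relative density 0 gains a small
  factor in each piece. With u = 2^a the square root is a halving of the exponent.\<close>

lemma recip_sum_sqrt_small:
  assumes P: "P \<subseteq> {p. prime p}" "has_relative_prime_density P 0" and "\<epsilon> > 0"
  shows "\<forall>\<^sub>F a in sequentially. recip_sum P (2 ^ (a div 2)) (2 ^ a) \<le> \<epsilon>"
proof -
  \<comment> \<open>24 = 12 * 2: a dyadic piece contributes at most
    \<open>12 * \<delta> / (real m + 1)\<close>, where 12 is Chebyshev's 6 times the ratio 2 of the
    end points, and there are at most 2 (m + 1) pieces.\<close>
  define \<delta> where "\<delta> = \<epsilon> / 24"
  have \<delta>: "\<delta> > 0" using assms by (simp add: \<delta>_def)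
  have "\<forall>\<^sub>F x::nat in sequentially. real (card (P \<inter> {1..x})) / real (card ({p. prime p} \<inter> {1..x})) < \<delta>"
    using P(2) \<delta> unfolding has_relative_prime_density_def by (rule order_tendstoD(2))
  then obtain x0 where x0: "\<And>x. x \<ge> x0 \<Longrightarrow> real (card (P \<inter> {1..x})) / real (card ({p. prime p} \<inter> {1..x})) < \<delta>"
    by (auto simp: eventually_sequentially)
  have card_le: "real (card (P \<inter> {1..x})) \<le> \<delta> * real (card {p. prime p \<and> p \<le> x})" if "x \<ge> max x0 2" for x
  proof -
    have eq: "{p. prime p} \<inter> {1..x} = {p. prime p \<and> p \<le> x}" by (auto simp: Suc_le_eq prime_gt_0_nat)
    have "card {2::nat} \<le> card {p. prime p \<and> p \<le> x}"
      using that by (intro card_mono) (auto simp: two_is_prime_nat)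
    then have "card {p. prime p \<and> p \<le> x} > 0" by simp
    then show ?thesis using x0[of x] that unfolding eq by (simp add: field_simps)
  qed
  have "\<forall>\<^sub>F a in sequentially. a \<ge> 2 * max x0 2" by (rule eventually_ge_at_top)
  then show ?thesis
  proof eventually_elim
    case (elim a)
    define m where "m = a div 2"
    have m: "m \<ge> max x0 2" "a \<le> 2 * (m + 1)" "m \<le> a" using elim by (auto simp: m_def)
    have each: "recip_sum P (2 ^ i) (2 ^ Suc i) \<le> 12 * \<delta> / (real m + 1)" if "i \<ge> m" for i
    proof -
      have "i < 2 ^ Suc i" by (metis less_exp lessI order_less_trans power_strict_increasing_iff one_less_numeral_iff semiring_norm(76))
      then have big: "2 ^ Suc i \<ge> max x0 2" using that m by linarith
      have "recip_sum P (2 ^ i) (2 ^ Suc i) \<le> real (card (P \<inter> {1..2 ^ Suc i})) / real (2 ^ i)"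
        by (rule recip_sum_le_card) simp
      also have "\<dots> \<le> (\<delta> * real (card {p. prime p \<and> p \<le> (2::nat) ^ Suc i})) / real (2 ^ i)"
        by (intro divide_right_mono card_le[OF big]) simp
      also have "real (card {p. prime p \<and> p \<le> (2::nat) ^ Suc i}) \<le> 6 * 2 ^ Suc i / real (Suc i)"
      proof -
        have "real (Suc i * card {p. prime p \<and> p \<le> (2::nat) ^ Suc i}) \<le> real (6 * 2 ^ Suc i)"
          by (intro of_nat_mono card_primes_power_le)
        then show ?thesis by (simp only: of_nat_mult of_nat_power of_nat_numeral) (simp add: field_simps)
      qed
      then have "(\<delta> * real (card {p. prime p \<and> p \<le> (2::nat) ^ Suc i})) / real (2 ^ i)
          \<le> (\<delta> * (6 * 2 ^ Suc i / real (Suc i))) / real (2 ^ i)"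
        using \<delta> by (intro divide_right_mono mult_left_mono) auto
      also have "\<dots> = 12 * \<delta> / (real i + 1)" by (simp add: add.commute)
      also have "\<dots> \<le> 12 * \<delta> / (real m + 1)" using that \<delta> by (intro divide_left_mono) auto
      finally show ?thesis .
    qed
    have "recip_sum P (2 ^ m) (2 ^ a) = (\<Sum>i\<in>{m..<a}. recip_sum P (2 ^ i) (2 ^ Suc i))"
      using recip_sum_dyadic[of P m "a - m"] m by simp
    also have "\<dots> \<le> (\<Sum>i\<in>{m..<a}. 12 * \<delta> / (real m + 1))" by (intro sum_mono each) auto
    also have "\<dots> = real (a - m) * (12 * \<delta> / (real m + 1))" by simp
    also have "\<dots> \<le> (2 * (real m + 1)) * (12 * \<delta> / (real m + 1))"
      using m \<delta> by (intro mult_right_mono) auto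
    also have "\<dots> = 24 * \<delta>" by (simp add: field_simps)
    finally show ?case by (simp add: m_def \<delta>_def)
  qed
qed

subsection \<open>Almost periodicity of multiplicative functions\<close>

lemma multiplicative_fun_prod_prime_powers:
  assumes "multiplicative_fun h" "finite A" "\<And>p. p \<in> A \<Longrightarrow> prime p"
  shows "h (\<Prod>p\<in>A. p ^ e p) = (\<Prod>p\<in>A. h (p ^ e p))"
  using assms(2,3)
proof (induction A rule: finite_induct)
  case empty
  then show ?case using assms(1) by (simp add: multiplicative_fun_def)
next
  case (insert p A)
  have "coprime (p ^ e p) (\<Prod>q\<in>A. q ^ e q)"
  proof (intro prod_coprime_right)
    fix q assume "q \<in> A"
    then have "coprime p q" using insert by (intro primes_coprime) auto
    then show "coprime (p ^ e p) (q ^ e q)" by simp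
  qed
  moreover have "p ^ e p > 0" "(\<Prod>q\<in>A. q ^ e q) > 0"
    using insert.prems by (auto intro!: prod_pos simp: prime_gt_0_nat)
  ultimately show ?case using insert assms(1) by (simp add: multiplicative_fun_def)
qed

lemma multiplicative_fun_eq_prod:
  assumes "multiplicative_fun h" "n > 0"
  shows "h n = (\<Prod>p\<in>prime_factors n. h (p ^ multiplicity p n))"
proof -
  have "n = (\<Prod>p\<in>prime_factors n. p ^ multiplicity p n)"
    using assms(2) by (simp add: prod_prime_factors)
  then show ?thesis
    using multiplicative_fun_prod_prime_powers[OF assms(1), of "prime_factors n" "\<lambda>p. multiplicity p n"]
    by (metis finite_set_mset in_prime_factors_imp_prime)
qed

text \<open>A periodic approximation to \<open>h\<close>: \<open>gcd m (p ^ K)\<close> is the exact \<open>p\<close>-part of \<open>m\<close> unless \<open>p ^ K dvd m\<close>.\<close>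

definition smooth_part :: "(nat \<Rightarrow> int) \<Rightarrow> nat \<Rightarrow> nat \<Rightarrow> nat \<Rightarrow> int" where
  "smooth_part h y K m = (\<Prod>p | prime p \<and> p \<le> y. h (gcd m (p ^ K)))"

definition smooth_modulus :: "nat \<Rightarrow> nat \<Rightarrow> nat" where
  "smooth_modulus y K = (\<Prod>p | prime p \<and> p \<le> y. p ^ K)"

lemma smooth_modulus_pos: "smooth_modulus y K > 0"
  unfolding smooth_modulus_def by (intro prod_pos) (auto simp: prime_gt_0_nat)

lemma coprime_smooth_modulus:
  assumes "prime p" "p > y"
  shows "coprime (smooth_modulus y K) p"
  unfolding smooth_modulus_def
proof (rule prod_coprime_left)
  fix q assume "q \<in> {p. prime p \<and> p \<le> y}"
  then have "coprime q p" using assms by (intro primes_coprime) auto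
  then show "coprime (q ^ K) p" by simp
qed

lemma smooth_part_cong:
  assumes "[m = n] (mod smooth_modulus y K)"
  shows "smooth_part h y K m = smooth_part h y K n"
  unfolding smooth_part_def
proof (rule prod.cong)
  fix p assume p: "p \<in> {p. prime p \<and> p \<le> y}"
  have "p ^ K dvd smooth_modulus y K"
    unfolding smooth_modulus_def using p by (intro dvd_prodI) auto
  then have "[m = n] (mod p ^ K)" using assms by (rule cong_dvd_modulus_nat[rotated])
  then show "h (gcd m (p ^ K)) = h (gcd n (p ^ K))" by (simp add: cong_gcd_eq)
qed simp

text \<open>For p <= y the exponent of p in m is below \<open>K\<close>, so the gcd with p^K sees it
  exactly; for p > y every exponent is 1. The first factor is periodic in m, the second depends only
  on values of h at primes.\<close>

lemma multiplicative_fun_split: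
  assumes h: "multiplicative_fun h" and "m > 0"
    and small: "\<And>p. prime p \<Longrightarrow> p \<le> y \<Longrightarrow> \<not> p ^ K dvd m"
    and large: "\<And>p. prime p \<Longrightarrow> y < p \<Longrightarrow> \<not> p\<^sup>2 dvd m"
  shows "h m = smooth_part h y K m * (\<Prod>p\<in>prime_factors m \<inter> {y<..}. h p)"
proof -
  have "prime_factors m = prime_factors m \<inter> {..y} \<union> prime_factors m \<inter> {y<..}" by auto
  then have "h m = (\<Prod>p\<in>prime_factors m \<inter> {..y} \<union> prime_factors m \<inter> {y<..}. h (p ^ multiplicity p m))"
    using multiplicative_fun_eq_prod[OF h \<open>m > 0\<close>] by simp
  also have "\<dots> = (\<Prod>p\<in>prime_factors m \<inter> {..y}. h (p ^ multiplicity p m))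
      * (\<Prod>p\<in>prime_factors m \<inter> {y<..}. h (p ^ multiplicity p m))"
    by (rule prod.union_disjoint) auto
  also have "(\<Prod>p\<in>prime_factors m \<inter> {y<..}. h (p ^ multiplicity p m)) = (\<Prod>p\<in>prime_factors m \<inter> {y<..}. h p)"
  proof (rule prod.cong)
    fix p assume p: "p \<in> prime_factors m \<inter> {y<..}"
    then have "prime p" "p dvd m" by (auto simp: in_prime_factors_iff)
    then have "multiplicity p m \<ge> 1" using \<open>m > 0\<close> by (intro multiplicity_geI) auto
    moreover have "multiplicity p m < 2"
      using large[of p] p \<open>prime p\<close> \<open>m > 0\<close> by (intro multiplicity_lessI) auto
    ultimately have "multiplicity p m = 1" by simp
    then show "h (p ^ multiplicity p m) = h p" by simp
  qed simp
  also have "(\<Prod>p\<in>prime_factors m \<inter> {..y}. h (p ^ multiplicity p m)) = smooth_part h y K m"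
    unfolding smooth_part_def
  proof (rule prod.mono_neutral_cong_left)
    show "finite {p. prime p \<and> p \<le> y}" by simp
    show "prime_factors m \<inter> {..y} \<subseteq> {p. prime p \<and> p \<le> y}" by auto
    have *: "gcd m (p ^ K) = p ^ multiplicity p m" if p: "prime p" "p \<le> y" for p
    proof -
      have "multiplicity p m < K" using small[OF p] \<open>m > 0\<close> p(1) by (intro multiplicity_lessI) auto
      obtain m' where m': "m = p ^ multiplicity p m * m'" "\<not> p dvd m'"
        using multiplicity_decompose'[of m p] \<open>m > 0\<close> p(1) by (auto simp: prime_nat_iff)
      have "coprime p m'" using p(1) m'(2) by (rule prime_imp_coprime)
      then have "coprime m' (p ^ (K - multiplicity p m))" by (simp add: coprime_commute)
      then have "gcd (p ^ multiplicity p m * m') (p ^ multiplicity p m * p ^ (K - multiplicity p m)) = p ^ multiplicity p m"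
        by (simp add: gcd_mult_distrib_nat[symmetric])
      then show ?thesis using m'(1) \<open>multiplicity p m < K\<close> by (simp flip: power_add)
    qed
    show "h (p ^ multiplicity p m) = h (gcd m (p ^ K))" if "p \<in> prime_factors m \<inter> {..y}" for p
    proof -
      have "prime p" "p \<le> y" using that by auto
      then show ?thesis by (simp add: *)
    qed
    show "\<forall>p\<in>{p. prime p \<and> p \<le> y} - prime_factors m \<inter> {..y}. h (gcd m (p ^ K)) = 1"
    proof
      fix p assume "p \<in> {p. prime p \<and> p \<le> y} - prime_factors m \<inter> {..y}"
      then have p: "prime p" "p \<le> y" "\<not> p dvd m" using \<open>m > 0\<close> by (auto simp: in_prime_factors_iff)
      then show "h (gcd m (p ^ K)) = 1" using h
        by (simp add: * not_dvd_imp_multiplicity_0 multiplicative_fun_def)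
    qed
  qed
  finally show ?thesis .
qed

section \<open>Counting integers with a divisor from a given family\<close>

lemma card_multiples_le: "real (card {m\<in>{1..M}. q dvd m}) \<le> real M / real q"
proof (cases "q = 0")
  case False
  have "{m\<in>{1..M}. q dvd m} \<subseteq> (\<lambda>k. q * k) ` {1..M div q}"
  proof
    fix m assume m: "m \<in> {m\<in>{1..M}. q dvd m}"
    then obtain k where k: "m = q * k" by auto
    then have "k \<le> M div q" using m False by (auto simp: less_eq_div_iff_mult_less_eq mult.commute)
    moreover have "k \<ge> 1" using k m by (cases k) auto
    ultimately show "m \<in> (\<lambda>k. q * k) ` {1..M div q}" using k by auto
  qed
  then have "card {m\<in>{1..M}. q dvd m} \<le> card ((\<lambda>k. q * k) ` {1..M div q})" by (intro card_mono) auto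
  also have "\<dots> \<le> M div q" using card_image_le[of "{1..M div q}"] by simp
  finally have "real (card {m\<in>{1..M}. q dvd m}) \<le> real (M div q)" by simp
  also have "real (M div q) \<le> real M / real q"
  proof -
    have "real (M div q) * real q \<le> real M"
      by (simp only: of_nat_mult[symmetric] of_nat_le_iff div_times_less_eq_dividend)
    then show ?thesis using False by (simp add: pos_le_divide_eq)
  qed
  finally show ?thesis .
qed (auto simp: card_eq_0_iff)

text \<open>A union bound. The condition on \<open>\<phi>\<close> confines the union to p <= M and
  so keeps the sum finite; it is applied to p^K, p^2 and p.\<close>

lemma card_has_divisor_le:
  fixes \<phi> :: "nat \<Rightarrow> nat"
  assumes "\<And>p. p \<in> A \<Longrightarrow> p \<le> \<phi> p"
  shows "real (card {m\<in>{1..M}. \<exists>p\<in>A. \<phi> p dvd m}) \<le> real M * (\<Sum>p\<in>A \<inter> {..M}. 1 / real (\<phi> p))"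
proof -
  have "{m\<in>{1..M}. \<exists>p\<in>A. \<phi> p dvd m} \<subseteq> (\<Union>p\<in>A \<inter> {..M}. {m\<in>{1..M}. \<phi> p dvd m})"
  proof
    fix m assume m: "m \<in> {m\<in>{1..M}. \<exists>p\<in>A. \<phi> p dvd m}"
    then obtain p where p: "p \<in> A" "\<phi> p dvd m" by blast
    then have "p \<le> M" using assms[OF p(1)] dvd_imp_le[OF p(2)] m by auto
    then show "m \<in> (\<Union>p\<in>A \<inter> {..M}. {m\<in>{1..M}. \<phi> p dvd m})" using m p by auto
  qed
  then have "card {m\<in>{1..M}. \<exists>p\<in>A. \<phi> p dvd m} \<le> card (\<Union>p\<in>A \<inter> {..M}. {m\<in>{1..M}. \<phi> p dvd m})"
    by (intro card_mono) auto
  also have "\<dots> \<le> (\<Sum>p\<in>A \<inter> {..M}. card {m\<in>{1..M}. \<phi> p dvd m})" by (intro card_UN_le) auto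
  finally have "real (card {m\<in>{1..M}. \<exists>p\<in>A. \<phi> p dvd m}) \<le> (\<Sum>p\<in>A \<inter> {..M}. real (card {m\<in>{1..M}. \<phi> p dvd m}))"
    by (simp flip: of_nat_sum)
  also have "\<dots> \<le> (\<Sum>p\<in>A \<inter> {..M}. real M / real (\<phi> p))" by (intro sum_mono card_multiples_le)
  finally show ?thesis by (simp add: sum_distrib_left)
qed

text \<open>Telescoping, from 1 / (t + 1)^2 <= 1 / t - 1 / (t + 1).\<close>

lemma sum_inverse_squares_le:
  assumes "y > 0"
  shows "(\<Sum>p\<in>{y<..} \<inter> {..M}. 1 / real (p\<^sup>2)) \<le> 1 / real y"
proof -
  have "(\<Sum>p\<in>{y<..y + k}. 1 / real (p\<^sup>2)) \<le> 1 / real y - 1 / real (y + k)" for k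
  proof (induction k)
    case (Suc k)
    have "{y<..y + Suc k} = insert (y + Suc k) {y<..y + k}" by auto
    then have "(\<Sum>p\<in>{y<..y + Suc k}. 1 / real (p\<^sup>2)) \<le> 1 / real y - 1 / real (y + k) + 1 / real ((y + Suc k)\<^sup>2)"
      using Suc by simp
    also have "1 / real ((y + Suc k)\<^sup>2) \<le> 1 / real (y + k) - 1 / real (y + Suc k)"
    proof -
      define t where "t = real (y + k)"
      have "t > 0" using assms by (simp add: t_def)
      then have "1 / (t + 1)\<^sup>2 \<le> 1 / t - 1 / (t + 1)"
        by (simp add: power2_eq_square divide_simps)
      moreover have "real (y + Suc k) = t + 1" by (simp add: t_def)
      ultimately show ?thesis unfolding of_nat_power t_def[symmetric] by (simp add: add.commute)
    qed
    finally show ?case by simp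
  qed simp
  from this[of "M - y"] have "(\<Sum>p\<in>{y<..y + (M - y)}. 1 / real (p\<^sup>2)) \<le> 1 / real y"
    by (rule order_trans) simp
  moreover have "(\<Sum>p\<in>{y<..} \<inter> {..M}. 1 / real (p\<^sup>2)) \<le> (\<Sum>p\<in>{y<..y + (M - y)}. 1 / real (p\<^sup>2))"
    by (intro sum_mono2) auto
  ultimately show ?thesis by linarith
qed

text \<open>The obstructions to reading off f and g at m: the first two clauses spoil the splitting
  into a periodic part and large simple primes, the third lets a large prime affect g, and the
  fourth lets a prime of \<open>P\<close> escape the sieving range up to \<open>z\<close>.\<close>

definition exceptional :: "nat set \<Rightarrow> nat set \<Rightarrow> nat \<Rightarrow> nat \<Rightarrow> nat \<Rightarrow> nat \<Rightarrow> bool" where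
  "exceptional Z P y K z m \<longleftrightarrow>
     (\<exists>p\<in>{p. prime p \<and> p \<le> y}. p ^ K dvd m) \<or> (\<exists>p\<in>{y<..}. p\<^sup>2 dvd m) \<or>
     (\<exists>p\<in>Z \<inter> {y<..}. p dvd m) \<or> (\<exists>p\<in>P \<inter> {z<..}. p dvd m)"

lemma card_exceptional_le:
  assumes "y > 0" "K > 0"
  shows "real (card {m\<in>{1..M}. exceptional Z P y K z m})
    \<le> real M * (real y / 2 ^ K + 1 / real y + recip_sum Z y M + recip_sum P z M)"
proof -
  define A where "A = {m\<in>{1..M}. \<exists>p\<in>{p. prime p \<and> p \<le> y}. p ^ K dvd m}"
  define B where "B = {m\<in>{1..M}. \<exists>p\<in>{y<..}. p\<^sup>2 dvd m}"
  define C where "C = {m\<in>{1..M}. \<exists>p\<in>Z \<inter> {y<..}. p dvd m}"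
  define D where "D = {m\<in>{1..M}. \<exists>p\<in>P \<inter> {z<..}. p dvd m}"
  have "real (card A) \<le> real M * (\<Sum>p\<in>{p. prime p \<and> p \<le> y} \<inter> {..M}. 1 / real (p ^ K))"
    unfolding A_def using assms(2) by (intro card_has_divisor_le) (auto intro!: self_le_power simp: Suc_le_eq prime_gt_0_nat)
  also have "\<dots> \<le> real M * (\<Sum>p\<in>{p. prime p \<and> p \<le> y} \<inter> {..M}. 1 / 2 ^ K)"
    by (intro mult_left_mono sum_mono divide_left_mono)
      (auto simp: prime_gt_0_nat prime_ge_2_nat intro!: power_mono)
  also have "\<dots> = real M * (real (card ({p. prime p \<and> p \<le> y} \<inter> {..M})) / 2 ^ K)" by simp
  also have "\<dots> \<le> real M * (real (card {1..y}) / 2 ^ K)"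
    by (intro mult_left_mono divide_right_mono of_nat_mono card_mono) (auto simp: Suc_le_eq prime_gt_0_nat)
  finally have A: "real (card A) \<le> real M * (real y / 2 ^ K)" by simp
  have "real (card B) \<le> real M * (\<Sum>p\<in>{y<..} \<inter> {..M}. 1 / real (p\<^sup>2))"
    unfolding B_def by (intro card_has_divisor_le) (auto simp: power2_eq_square)
  also have "\<dots> \<le> real M * (1 / real y)" by (intro mult_left_mono sum_inverse_squares_le assms) auto
  finally have B: "real (card B) \<le> real M * (1 / real y)" .
  have "Z \<inter> {y<..} \<inter> {..M} = Z \<inter> {y<..M}" by auto
  then have C: "real (card C) \<le> real M * recip_sum Z y M"
    using card_has_divisor_le[of "Z \<inter> {y<..}" "\<lambda>p. p" M] by (simp add: C_def recip_sum_def)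
  have "P \<inter> {z<..} \<inter> {..M} = P \<inter> {z<..M}" by auto
  then have D: "real (card D) \<le> real M * recip_sum P z M"
    using card_has_divisor_le[of "P \<inter> {z<..}" "\<lambda>p. p" M] by (simp add: D_def recip_sum_def)
  have "{m\<in>{1..M}. exceptional Z P y K z m} = A \<union> B \<union> C \<union> D"
    unfolding A_def B_def C_def D_def exceptional_def by blast
  then have "card {m\<in>{1..M}. exceptional Z P y K z m} \<le> card A + card B + card C + card D"
    using card_Un_le[of "A \<union> B \<union> C" D] card_Un_le[of "A \<union> B" C] card_Un_le[of A B] by simp
  then have "real (card {m\<in>{1..M}. exceptional Z P y K z m}) \<le> real (card A) + real (card B) + real (card C) + real (card D)"
    by (simp flip: of_nat_add)
  then show ?thesis unfolding distrib_left using A B C D by linarith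
qed

lemma recip_sum_tail_small:
  assumes "(\<lambda>p. 1 / real p) summable_on Z" "\<epsilon> > 0"
  shows "\<forall>\<^sub>F y in sequentially. \<forall>M. recip_sum Z y M \<le> \<epsilon>"
proof -
  define s where "s = infsum (\<lambda>p. 1 / real p) Z"
  have "(sum (\<lambda>p. 1 / real p) \<longlongrightarrow> s) (finite_subsets_at_top Z)"
    using assms(1) unfolding s_def by (rule infsum_tendsto)
  then have "\<forall>\<^sub>F F in finite_subsets_at_top Z. sum (\<lambda>p. 1 / real p) F > s - \<epsilon>"
    using assms(2) by (intro order_tendstoD) auto
  then obtain F where F: "finite F" "F \<subseteq> Z" "sum (\<lambda>p. 1 / real p) F > s - \<epsilon>"
    by (auto simp: eventually_finite_subsets_at_top)
  define y0 where "y0 = Max (insert 0 F)"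
  have y0: "p \<le> y0" if "p \<in> F" for p using F(1) that by (simp add: y0_def)
  have "recip_sum Z y M \<le> \<epsilon>" if "y \<ge> y0" for y M
  proof -
    have "sum (\<lambda>p. 1 / real p) F + recip_sum Z y M = sum (\<lambda>p. 1 / real p) (F \<union> Z \<inter> {y<..M})"
      unfolding recip_sum_def using F(1) y0 that by (intro sum.union_disjoint[symmetric]) fastforce+
    also have "\<dots> \<le> s"
      unfolding s_def using assms(1) F by (intro finite_sum_le_infsum) auto
    finally show ?thesis using F(3) by linarith
  qed
  then show ?thesis unfolding eventually_sequentially by blast
qed

text \<open>Values below C at arbitrarily large E would bound every finite partial sum: a finite set
  fits below such a 2^E, and the integers up to y add only a constant.\<close>

lemma recip_sum_unbounded:
  assumes "\<not> (\<lambda>p. 1 / real p) summable_on P"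
  shows "\<forall>\<^sub>F E in sequentially. recip_sum P y (2 ^ E) \<ge> C"
proof (rule ccontr)
  assume "\<not> ?thesis"
  then have *: "\<exists>E\<ge>E0. recip_sum P y (2 ^ E) < C" for E0
    unfolding eventually_sequentially by (meson not_le)
  have "bdd_above (sum (\<lambda>p. 1 / real p) ` {F. F \<subseteq> P \<and> finite F})"
  proof (rule bdd_aboveI2)
    fix F assume F: "F \<in> {F. F \<subseteq> P \<and> finite F}"
    define n where "n = Max (insert 0 F)"
    have n: "p \<le> n" if "p \<in> F" for p using F that by (simp add: n_def)
    obtain E where E: "E \<ge> n" "recip_sum P y (2 ^ E) < C" using * by blast
    have "n \<le> 2 ^ E" using E(1) less_exp[of E] by linarith
    then have "F \<subseteq> {..y} \<union> P \<inter> {y<..2 ^ E}" using F n by fastforce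
    then have "(\<Sum>p\<in>F. 1 / real p) \<le> (\<Sum>p\<in>{..y} \<union> P \<inter> {y<..2 ^ E}. 1 / real p)"
      by (intro sum_mono2) auto
    also have "\<dots> = (\<Sum>p\<le>y. 1 / real p) + recip_sum P y (2 ^ E)"
      unfolding recip_sum_def by (intro sum.union_disjoint) auto
    finally show "(\<Sum>p\<in>F. 1 / real p) \<le> (\<Sum>p\<le>y. 1 / real p) + C" using E(2) by linarith
  qed
  then have "(\<lambda>p. 1 / real p) summable_on P" by (intro nonneg_bdd_above_summable_on) auto
  then show False using assms by contradiction
qed

subsection \<open>Dyadic blocks\<close>

text \<open>Halving the exponent takes a square root up to rounding, so block j is the j-th interval
  of the form (sqrt z, z] counted downwards from 2^E. Adjacent blocks share their end point, so the
  rounding leaves no gaps.\<close>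

definition block :: "nat set \<Rightarrow> nat \<Rightarrow> nat \<Rightarrow> nat \<Rightarrow> nat set" where
  "block P y E j = P \<inter> {max y (2 ^ (E div 2 ^ Suc j))<..2 ^ (E div 2 ^ j)}"

lemma finite_block: "finite (block P y E j)"
  by (simp add: block_def)

lemma disjoint_family_block: "disjoint_family (block P y E)"
proof -
  have *: "block P y E i \<inter> block P y E j = {}" if "i < j" for i j
  proof -
    have "(2::nat) ^ Suc i \<le> 2 ^ j" using that by (intro power_increasing) auto
    then have "E div 2 ^ j \<le> E div 2 ^ Suc i" by (intro div_le_mono2) auto
    then have "(2::nat) ^ (E div 2 ^ j) \<le> 2 ^ (E div 2 ^ Suc i)" by (intro power_increasing) auto
    then have False if "x \<in> block P y E i \<inter> block P y E j" for x
    proof -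
      have "x \<le> 2 ^ (E div 2 ^ j)" "2 ^ (E div 2 ^ Suc i) < x"
        using that unfolding block_def by (simp_all del: power_Suc)
      then show False using \<open>(2::nat) ^ (E div 2 ^ j) \<le> 2 ^ (E div 2 ^ Suc i)\<close> by linarith
    qed
    then show ?thesis by blast
  qed
  show ?thesis
    unfolding disjoint_family_on_def
  proof (intro ballI impI)
    fix i j :: nat assume "i \<noteq> j"
    then show "block P y E i \<inter> block P y E j = {}"
      using *[of i j] *[of j i] by (cases i j rule: linorder_cases) (auto simp: Int_commute)
  qed
qed

lemma UN_block: "(\<Union>j<M. block P y E j) = P \<inter> {max y (2 ^ (E div 2 ^ M))<..2 ^ E}"
proof (induction M)
  case (Suc M)
  have "(2::nat) ^ M \<le> 2 ^ Suc M" by simp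
  then have "E div 2 ^ Suc M \<le> E div 2 ^ M" by (intro div_le_mono2) auto
  then have 1: "(2::nat) ^ (E div 2 ^ Suc M) \<le> 2 ^ (E div 2 ^ M)" by (intro power_increasing) auto
  have "E div 2 ^ M \<le> E" by simp
  then have 2: "(2::nat) ^ (E div 2 ^ M) \<le> 2 ^ E" by (intro power_increasing) auto
  have "(\<Union>j<Suc M. block P y E j) = P \<inter> {max y (2 ^ (E div 2 ^ M))<..2 ^ E} \<union> block P y E M"
    by (simp add: lessThan_Suc Suc Un_commute)
  also have "\<dots> = P \<inter> {max y (2 ^ (E div 2 ^ Suc M))<..2 ^ E}"
  proof -
    have "P \<inter> {max y b<..c} \<union> P \<inter> {max y a<..b} = P \<inter> {max y a<..c}" if "a \<le> b" "b \<le> c" for a b c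
      using that by auto
    from this[OF 1 2] show ?thesis by (simp only: block_def)
  qed
  finally show ?case .
qed auto

text \<open>After E halvings the exponent is 0, because E < 2^E, and 2^0 = 1 does not exceed
  y.\<close>

lemma UN_block_full: "y > 0 \<Longrightarrow> (\<Union>j<E. block P y E j) = P \<inter> {y<..2 ^ E}"
  unfolding UN_block by (simp add: max_absorb1 Suc_le_eq)

lemma sum_add_2_div_power_2: "(\<Sum>j<M. (real j + 2) / 2 ^ j) = 6 - (real M + 3) * 2 / 2 ^ M"
proof (induction M)
  case (Suc M)
  define t where "t = 1 / (2::real) ^ M"
  have eq: "x / 2 ^ M = x * t" "x / 2 ^ Suc M = x * t / 2" for x by (simp_all add: t_def)
  show ?case unfolding sum.lessThan_Suc Suc eq by (simp add: algebra_simps)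
qed simp

text \<open>A prime of block j is at most 2^(E / 2^j), and the weights (j + 2) / 2^j add up to less
  than 6. A linearly growing number of primes per block is therefore affordable.\<close>

lemma prod_block_le:
  assumes "D \<subseteq> (\<Union>j<M. block P y E j)" "\<And>j. j < M \<Longrightarrow> card (D \<inter> block P y E j) \<le> j + 2"
  shows "\<Prod>D \<le> 2 ^ (6 * E)"
proof -
  have D: "D = (\<Union>j<M. D \<inter> block P y E j)" using assms(1) by blast
  have "\<Prod>D = (\<Prod>j<M. \<Prod>(D \<inter> block P y E j))"
  proof (subst D, rule prod.UNION_disjoint)
    show "\<forall>i\<in>{..<M}. \<forall>j\<in>{..<M}. i \<noteq> j \<longrightarrow> D \<inter> block P y E i \<inter> (D \<inter> block P y E j) = {}"
      using disjoint_family_onD[OF disjoint_family_block[of P y E]] by blast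
  qed (auto simp: finite_block)
  also have "\<dots> \<le> (\<Prod>j<M. 2 ^ ((E div 2 ^ j) * (j + 2)))"
  proof (intro prod_mono conjI)
    fix j assume j: "j \<in> {..<M}"
    have "\<Prod>(D \<inter> block P y E j) \<le> (\<Prod>p\<in>D \<inter> block P y E j. 2 ^ (E div 2 ^ j))"
      by (intro prod_mono) (auto simp: block_def)
    also have "\<dots> = (2 ^ (E div 2 ^ j)) ^ card (D \<inter> block P y E j)" by simp
    also have "\<dots> \<le> (2 ^ (E div 2 ^ j)) ^ (j + 2)" using assms(2) j by (intro power_increasing) auto
    finally show "\<Prod>(D \<inter> block P y E j) \<le> 2 ^ ((E div 2 ^ j) * (j + 2))" by (simp only: power_mult)
  qed auto
  also have "\<dots> = 2 ^ (\<Sum>j<M. (E div 2 ^ j) * (j + 2))" by (simp add: power_sum)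
  also have "\<dots> \<le> (2::nat) ^ (6 * E)"
  proof (intro power_increasing)
    have "real (\<Sum>j<M. (E div 2 ^ j) * (j + 2)) = (\<Sum>j<M. real (E div 2 ^ j) * (real j + 2))"
      by (simp add: algebra_simps)
    also have "\<dots> \<le> (\<Sum>j<M. (real E / 2 ^ j) * (real j + 2))"
    proof (intro sum_mono mult_right_mono)
      fix j :: nat
      have "real (E div 2 ^ j) * real (2 ^ j) \<le> real E"
        by (simp only: of_nat_mult[symmetric] of_nat_le_iff div_times_less_eq_dividend)
      then show "real (E div 2 ^ j) \<le> real E / 2 ^ j" by (simp add: pos_le_divide_eq)
    qed auto
    also have "\<dots> = real E * (\<Sum>j<M. (real j + 2) / 2 ^ j)" by (simp add: sum_distrib_left)
    also have "\<dots> \<le> real E * 6" unfolding sum_add_2_div_power_2 by (intro mult_left_mono) auto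
    finally show "(\<Sum>j<M. (E div 2 ^ j) * (j + 2)) \<le> 6 * E" by linarith
  qed simp
  finally show ?thesis .
qed

text \<open>Either the upper exponent is at least \<open>b\<close> and the block lies in an interval
  from a square root, or the block would lie below the cutoff \<open>2 ^ b\<close> and is empty. So
  one bound serves all blocks and all E.\<close>

lemma block_recip_small:
  assumes "\<And>a. a \<ge> b \<Longrightarrow> recip_sum P (2 ^ (a div 2)) (2 ^ a) \<le> \<eta>" "\<eta> \<ge> 0"
  shows "(\<Sum>p\<in>block P (2 ^ b) E j. 1 / real p) \<le> \<eta>"
proof (cases "E div 2 ^ j \<ge> b")
  case True
  have "(\<Sum>p\<in>block P (2 ^ b) E j. 1 / real p)
      = recip_sum P (max (2 ^ b) (2 ^ (E div 2 ^ Suc j))) (2 ^ (E div 2 ^ j))"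
    by (simp add: block_def recip_sum_def)
  also have "\<dots> \<le> recip_sum P (2 ^ (E div 2 ^ Suc j)) (2 ^ (E div 2 ^ j))"
    by (intro recip_sum_mono) auto
  also have "E div 2 ^ Suc j = E div 2 ^ j div 2" by (simp add: div_mult2_eq[symmetric] mult.commute)
  finally show ?thesis using assms(1)[OF True] by linarith
next
  case False
  then have "(2::nat) ^ (E div 2 ^ j) \<le> 2 ^ b" by (intro power_increasing) auto
  moreover have "{max a c<..d} = {}" if "d \<le> a" for a c d :: nat using that by auto
  ultimately have "block P (2 ^ b) E j = {}" by (simp only: block_def Int_empty_right)
  then show ?thesis using assms(2) by simp
qed

text \<open>Both parity functions fit: they differ only at higher prime powers, and such a power
  either belongs to a small prime, hence to the periodic part, or makes the integer
  exceptional.\<close>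

locale sparse_parity =
  fixes f g :: "nat \<Rightarrow> int" and P Z :: "nat set"
  assumes P: "P \<subseteq> {p. prime p}" "has_relative_prime_density P 0" "\<not> (\<lambda>p. 1 / real p) summable_on P"
    and Z: "Z = {p. prime p \<and> g p \<noteq> 1}" "(\<lambda>p. 1 / real p) summable_on Z"
    and mult: "multiplicative_fun f" "multiplicative_fun g"
    and f_abs: "\<And>n. n > 0 \<Longrightarrow> \<bar>f n\<bar> = 1"
    and f_prime: "\<And>p. prime p \<Longrightarrow> f p = (if p \<in> P then -1 else 1)"
begin

section \<open>Factorisation off the exceptional integers\<close>

lemma f_split:
  assumes "m > 0" "\<not> exceptional Z P y K z m"
  shows "f m = smooth_part f y K m * (-1) ^ card {p\<in>P \<inter> {y<..z}. p dvd m}"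
proof -
  have "f m = smooth_part f y K m * (\<Prod>p\<in>prime_factors m \<inter> {y<..}. f p)"
    using assms by (intro multiplicative_fun_split mult) (auto simp: exceptional_def)
  also have "(\<Prod>p\<in>prime_factors m \<inter> {y<..}. f p) = (\<Prod>p\<in>prime_factors m \<inter> {y<..}. if p \<in> P then -1 else 1)"
    by (intro prod.cong) (auto simp: f_prime in_prime_factors_imp_prime)
  also have "\<dots> = (-1) ^ card (prime_factors m \<inter> {y<..} \<inter> P)"
    by (subst prod.inter_restrict[symmetric]) auto
  \<comment> \<open>The upper end z can be inserted because a prime factor in \<open>P\<close>
    beyond z would make m exceptional.\<close>
  also have "prime_factors m \<inter> {y<..} \<inter> P = {p\<in>P \<inter> {y<..z}. p dvd m}"
    using assms P(1) by (auto simp: exceptional_def in_prime_factors_iff)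
  finally show ?thesis .
qed

lemma g_split:
  assumes "m > 0" "\<not> exceptional Z P y K z m"
  shows "g m = smooth_part g y K m"
proof -
  have "g m = smooth_part g y K m * (\<Prod>p\<in>prime_factors m \<inter> {y<..}. g p)"
    using assms by (intro multiplicative_fun_split mult) (auto simp: exceptional_def)
  also have "(\<Prod>p\<in>prime_factors m \<inter> {y<..}. g p) = 1"
    using assms by (intro prod.neutral) (auto simp: exceptional_def Z in_prime_factors_iff)
  finally show ?thesis by simp
qed

lemma abs_smooth_part: "\<bar>smooth_part f y K m\<bar> = 1"
  unfolding smooth_part_def abs_prod
  by (intro prod.neutral) (auto intro!: f_abs simp: prime_gt_0_nat)

text \<open>The pattern of g is carried along with the signs; off the exceptional integers it merges
  with the periodic part of f into one periodic weight.\<close>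

definition corr :: "nat set \<Rightarrow> nat set \<Rightarrow> (nat \<Rightarrow> int) \<Rightarrow> nat \<Rightarrow> real" where
  "corr S H w n = (\<Prod>h\<in>S. real_of_int (f (n + h))) * of_bool (\<forall>h\<in>H. g (n + h) = w h)"

definition smooth_corr :: "nat set \<Rightarrow> nat set \<Rightarrow> (nat \<Rightarrow> int) \<Rightarrow> nat \<Rightarrow> nat \<Rightarrow> nat \<Rightarrow> real" where
  "smooth_corr S H w y K n =
     (\<Prod>h\<in>S. real_of_int (smooth_part f y K (n + h))) * of_bool (\<forall>h\<in>H. smooth_part g y K (n + h) = w h)"

lemma abs_smooth_corr_le: "\<bar>smooth_corr S H w y K n\<bar> \<le> 1"
proof -
  have "\<bar>\<Prod>h\<in>S. real_of_int (smooth_part f y K (n + h))\<bar> = 1"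
    unfolding abs_prod of_int_abs[symmetric] abs_smooth_part by simp
  then show ?thesis by (simp add: smooth_corr_def abs_mult)
qed

lemma abs_corr_le: "n > 0 \<Longrightarrow> \<bar>corr S H w n\<bar> \<le> 1"
proof -
  assume "n > 0"
  then have "\<bar>\<Prod>h\<in>S. real_of_int (f (n + h))\<bar> = 1"
    unfolding abs_prod of_int_abs[symmetric] by (simp add: f_abs)
  then show ?thesis by (simp add: corr_def abs_mult)
qed

lemma smooth_corr_cong:
  assumes "[m = n] (mod smooth_modulus y K)"
  shows "smooth_corr S H w y K m = smooth_corr S H w y K n"
proof -
  have "smooth_part h y K (m + i) = smooth_part h y K (n + i)" for h i
    using assms by (intro smooth_part_cong) (simp add: cong_add_rcancel_nat)
  then show ?thesis by (simp add: smooth_corr_def)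
qed

text \<open>A prime of \<open>P\<close> above y exceeds all shifts in \<open>S\<close> and so
  divides at most one of the n + h. The separate counts therefore add up to the count for the union,
  and the product of signs becomes a single parity, which the sieve can treat.\<close>

lemma corr_eq:
  assumes "n > 0" "finite S" "\<And>h p. h \<in> S \<Longrightarrow> p \<in> P \<Longrightarrow> y < p \<Longrightarrow> h < p"
    and "\<And>h. h \<in> S \<union> H \<Longrightarrow> \<not> exceptional Z P y K z (n + h)"
  shows "corr S H w n = smooth_corr S H w y K n * (-1) ^ card (P \<inter> {y<..z} \<inter> {p. \<exists>h\<in>S. p dvd n + h})"
proof -
  have "card (P \<inter> {y<..z} \<inter> {p. \<exists>h\<in>S. p dvd n + h}) = card (\<Union>h\<in>S. {p\<in>P \<inter> {y<..z}. p dvd n + h})"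
    by (intro arg_cong[where f = card]) auto
  also have "\<dots> = (\<Sum>h\<in>S. card {p\<in>P \<inter> {y<..z}. p dvd n + h})"
  proof (intro card_UN_disjoint ballI impI assms)
    fix h h' assume h: "h \<in> S" "h' \<in> S" "h \<noteq> h'"
    show "{p\<in>P \<inter> {y<..z}. p dvd n + h} \<inter> {p\<in>P \<inter> {y<..z}. p dvd n + h'} = {}"
    proof (rule ccontr)
      assume "\<not> ?thesis"
      then obtain p where p: "p \<in> P" "y < p" "p dvd n + h" "p dvd n + h'" by auto
      then have "[n + h = n + h'] (mod p)" by (metis cong_def dvd_imp_mod_0)
      then have "[h = h'] (mod p)" by (simp add: cong_add_lcancel_nat)
      then show False using h assms(3)[of h p] assms(3)[of h' p] p by (simp add: cong_def)
    qed
  qed auto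
  finally have 1: "(-1) ^ card (P \<inter> {y<..z} \<inter> {p. \<exists>h\<in>S. p dvd n + h})
      = (\<Prod>h\<in>S. (-1 :: real) ^ card {p\<in>P \<inter> {y<..z}. p dvd n + h})"
    by (simp add: power_sum)
  have "(\<Prod>h\<in>S. real_of_int (f (n + h))) = (\<Prod>h\<in>S. real_of_int (smooth_part f y K (n + h)))
      * (\<Prod>h\<in>S. (-1) ^ card {p\<in>P \<inter> {y<..z}. p dvd n + h})"
    unfolding prod.distrib[symmetric] using assms(1,4) by (intro prod.cong refl) (simp add: f_split[where y = y and K = K and z = z])
  moreover have "(\<forall>h\<in>H. g (n + h) = w h) \<longleftrightarrow> (\<forall>h\<in>H. smooth_part g y K (n + h) = w h)"
    using assms(1,4) by (intro ball_cong refl) (simp add: g_split[where y = y and K = K and z = z])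
  ultimately show ?thesis by (simp add: 1 corr_def smooth_corr_def)
qed

text \<open>On each class modulo W the periodic weight is a constant of modulus at most 1, which
  leaves bare parity sums. An n for which some n + h is exceptional costs at most 2; after
  translation by h these are counted among the integers up to N + c.\<close>

lemma sum_corr_le:
  assumes S: "finite S" "finite H" and yK: "y > 0" "K > 0"
    and c: "\<And>h. h \<in> S \<union> H \<Longrightarrow> h \<le> c"
    and shift: "\<And>h p. h \<in> S \<Longrightarrow> p \<in> P \<Longrightarrow> y < p \<Longrightarrow> h < p"
  shows "\<bar>\<Sum>n\<in>{1..N}. corr S H w n\<bar>
    \<le> (\<Sum>r<smooth_modulus y K. \<bar>\<Sum>n | n \<in> {1..N} \<and> [n = r] (mod smooth_modulus y K).
          (-1) ^ card (P \<inter> {y<..z} \<inter> {p. \<exists>h\<in>S. p dvd n + h})\<bar>)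
      + 2 * real (card (S \<union> H)) * (real (N + c) *
          (real y / 2 ^ K + 1 / real y + recip_sum Z y (N + c) + recip_sum P z (N + c)))"
proof -
  define W where "W = smooth_modulus y K"
  define F :: "nat \<Rightarrow> real" where "F n = (-1) ^ card (P \<inter> {y<..z} \<inter> {p. \<exists>h\<in>S. p dvd n + h})" for n
  define G where "G = smooth_corr S H w y K"
  have W: "W > 0" by (simp add: W_def smooth_modulus_pos)
  have "(\<Sum>n\<in>{1..N}. G n * F n) = (\<Sum>r<W. \<Sum>n | n \<in> {1..N} \<and> n mod W = r. G n * F n)"
    using W by (intro sum.group[symmetric]) auto
  also have "\<dots> = (\<Sum>r<W. G r * (\<Sum>n | n \<in> {1..N} \<and> [n = r] (mod W). F n))"
  proof (rule sum.cong)
    fix r assume r: "r \<in> {..<W}"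
    then have "{n. n \<in> {1..N} \<and> n mod W = r} = {n. n \<in> {1..N} \<and> [n = r] (mod W)}" by (auto simp: cong_def)
    then have "(\<Sum>n | n \<in> {1..N} \<and> n mod W = r. G n * F n) = (\<Sum>n | n \<in> {1..N} \<and> [n = r] (mod W). G r * F n)"
      by (intro sum.cong) (auto simp: G_def W_def intro: smooth_corr_cong)
    then show "(\<Sum>n | n \<in> {1..N} \<and> n mod W = r. G n * F n) = G r * (\<Sum>n | n \<in> {1..N} \<and> [n = r] (mod W). F n)"
      by (simp add: sum_distrib_left)
  qed simp
  also have "\<bar>\<dots>\<bar> \<le> (\<Sum>r<W. \<bar>\<Sum>n | n \<in> {1..N} \<and> [n = r] (mod W). F n\<bar>)"
    using abs_smooth_corr_le[of S H w y K]
    by (intro order_trans[OF sum_abs] sum_mono) (auto simp: abs_mult G_def intro!: mult_left_le_one_le)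
  finally have main: "\<bar>\<Sum>n\<in>{1..N}. G n * F n\<bar> \<le> (\<Sum>r<W. \<bar>\<Sum>n | n \<in> {1..N} \<and> [n = r] (mod W). F n\<bar>)" .
  define B where "B = real (card {m\<in>{1..N + c}. exceptional Z P y K z m})"
  have pt: "\<bar>corr S H w n - G n * F n\<bar> \<le> 2 * (\<Sum>h\<in>S \<union> H. of_bool (exceptional Z P y K z (n + h)))"
    if "n > 0" for n
  proof (cases "\<exists>h\<in>S \<union> H. exceptional Z P y K z (n + h)")
    case True
    then obtain h where h: "h \<in> S \<union> H" "exceptional Z P y K z (n + h)" by blast
    have "(1::real) = of_bool (exceptional Z P y K z (n + h))" using h(2) by simp
    also have "\<dots> \<le> (\<Sum>h\<in>S \<union> H. of_bool (exceptional Z P y K z (n + h)))"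
      using S h(1) by (intro member_le_sum) auto
    finally have "2 \<le> 2 * (\<Sum>h\<in>S \<union> H. of_bool (exceptional Z P y K z (n + h)) :: real)" by simp
    moreover have "\<bar>G n * F n\<bar> \<le> 1"
      using abs_smooth_corr_le[of S H w y K n] by (simp add: G_def F_def abs_mult power_abs)
    moreover have "\<bar>corr S H w n\<bar> \<le> 1" using that by (rule abs_corr_le)
    ultimately show ?thesis by linarith
  next
    case False
    then have "corr S H w n = G n * F n"
      unfolding G_def F_def using that S(1) shift by (intro corr_eq) auto
    then show ?thesis by (simp add: sum_nonneg)
  qed
  have "\<bar>(\<Sum>n\<in>{1..N}. corr S H w n) - (\<Sum>n\<in>{1..N}. G n * F n)\<bar>
      \<le> (\<Sum>n\<in>{1..N}. 2 * (\<Sum>h\<in>S \<union> H. of_bool (exceptional Z P y K z (n + h))))"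
    unfolding sum_subtractf[symmetric] by (intro order_trans[OF sum_abs] sum_mono pt) auto
  also have "\<dots> = 2 * (\<Sum>h\<in>S \<union> H. \<Sum>n\<in>{1..N}. of_bool (exceptional Z P y K z (n + h)))"
    unfolding sum_distrib_left[symmetric] by (subst sum.swap) simp
  also have "\<dots> \<le> 2 * (\<Sum>h\<in>S \<union> H. B)"
  proof (intro mult_left_mono sum_mono)
    fix h assume h: "h \<in> S \<union> H"
    have "(\<Sum>n\<in>{1..N}. of_bool (exceptional Z P y K z (n + h))) = real (card ({1..N} \<inter> {n. exceptional Z P y K z (n + h)}))"
      by simp
    also have "card ({1..N} \<inter> {n. exceptional Z P y K z (n + h)})
        = card ((\<lambda>n. n + h) ` ({1..N} \<inter> {n. exceptional Z P y K z (n + h)}))"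
      by (intro card_image[symmetric]) (auto simp: inj_on_def)
    also have "\<dots> \<le> card {m\<in>{1..N + c}. exceptional Z P y K z m}"
      using c[OF h] by (intro card_mono) auto
    finally show "(\<Sum>n\<in>{1..N}. of_bool (exceptional Z P y K z (n + h))) \<le> B" by (simp add: B_def)
  qed simp
  also have "\<dots> = 2 * real (card (S \<union> H)) * B" by simp
  also have "\<dots> \<le> 2 * real (card (S \<union> H)) * (real (N + c) *
          (real y / 2 ^ K + 1 / real y + recip_sum Z y (N + c) + recip_sum P z (N + c)))"
    unfolding B_def by (intro mult_left_mono card_exceptional_le yK) auto
  finally show ?thesis using main unfolding F_def W_def by linarith
qed

end

subsection \<open>Vanishing of correlations\<close>

text \<open>Sieving by the primes up to \<open>2 ^ E\<close> at level \<open>2 ^ (6 * E)\<close> leaves an error of order \<open>2 ^ (12 * E)\<close>,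
  which the choice of \<open>E\<close> below makes \<open>O(\<surd>N)\<close>.\<close>

lemma ex_power_interval:
  assumes "(N::nat) > 0"
  shows "\<exists>E. 2 ^ (24 * E) \<le> N \<and> N < 2 ^ (24 * (E + 1))"
  unfolding power_mult by (rule ex_power_ivl1) (use assms in auto)

text \<open>Each doubling of the exponent adds one interval from a square root, so passing from
  \<open>2 ^ E\<close> to a fixed power of it costs a bounded multiple of
  \<open>\<eta>\<close>.\<close>

lemma recip_sum_doublings_le:
  assumes "\<And>a. a \<ge> b \<Longrightarrow> recip_sum P (2 ^ (a div 2)) (2 ^ a) \<le> \<eta>" "E \<ge> b"
  shows "recip_sum P (2 ^ E) (2 ^ (2 ^ k * E)) \<le> real k * \<eta>"
proof (induction k)
  case 0
  then show ?case by (simp add: recip_sum_def)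
next
  case (Suc k)
  have le: "E \<le> 2 ^ k * E" "2 ^ k * E \<le> 2 ^ Suc k * E" by simp_all
  have "recip_sum P (2 ^ E) (2 ^ (2 ^ Suc k * E)) =
      recip_sum P (2 ^ E) (2 ^ (2 ^ k * E)) + recip_sum P (2 ^ (2 ^ k * E)) (2 ^ (2 ^ Suc k * E))"
    by (intro recip_sum_add power_increasing le) auto
  moreover have "recip_sum P (2 ^ (2 ^ k * E)) (2 ^ (2 ^ Suc k * E)) \<le> \<eta>"
    using assms(1)[of "2 ^ Suc k * E"] le assms(2) by simp
  ultimately show ?case using Suc by (simp add: algebra_simps)
qed

text \<open>The bound is uniform in M because the exponent grows with j: the sum of \<theta>^(j + 2)
  is at most 2 \<theta>^2 <= \<theta>. A fixed exponent would give a bound growing with the number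
  of blocks.\<close>

lemma prod_one_plus_power_le:
  fixes x :: "nat \<Rightarrow> real"
  assumes "\<And>j. j < M \<Longrightarrow> 0 \<le> x j" "\<And>j. j < M \<Longrightarrow> x j \<le> \<theta>" "0 \<le> \<theta>" "\<theta> \<le> 1 / 2"
  shows "(\<Prod>j<M. 1 + x j ^ (j + 2)) \<le> 1 + 2 * \<theta>"
proof -
  have "(\<Prod>j<M. 1 + x j ^ (j + 2)) \<le> (\<Prod>j<M. exp (\<theta> ^ (j + 2)))"
  proof (intro prod_mono conjI)
    fix j assume "j \<in> {..<M}"
    then have "x j ^ (j + 2) \<le> \<theta> ^ (j + 2)" using assms by (intro power_mono) auto
    also have "1 + \<theta> ^ (j + 2) \<le> exp (\<theta> ^ (j + 2))" by (rule exp_ge_add_one_self)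
    finally show "1 + x j ^ (j + 2) \<le> exp (\<theta> ^ (j + 2))" by simp
  qed (use assms in auto)
  also have "\<dots> = exp (\<Sum>j<M. \<theta> ^ (j + 2))" by (simp add: exp_sum)
  also have "(\<Sum>j<M. \<theta> ^ (j + 2)) = \<theta>\<^sup>2 * (\<Sum>j<M. \<theta> ^ j)"
    by (simp add: sum_distrib_left power_add power2_eq_square mult_ac)
  also have "(\<Sum>j<M. \<theta> ^ j) = (1 - \<theta> ^ M) / (1 - \<theta>)"
    using assms by (subst sum_gp_strict) auto
  also have "\<dots> \<le> 1 / (1 / 2)" using assms by (intro frac_le) auto
  then have "exp (\<theta>\<^sup>2 * ((1 - \<theta> ^ M) / (1 - \<theta>))) \<le> exp (\<theta>\<^sup>2 * 2)"
    by (intro exp_le_cancel_iff[THEN iffD2] mult_left_mono) auto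
  also have "\<theta>\<^sup>2 * 2 \<le> \<theta>"
    using assms mult_left_mono[of \<theta> "1 / 2" \<theta>] by (simp add: power2_eq_square)
  then have "exp (\<theta>\<^sup>2 * 2) \<le> exp \<theta>" by simp
  also have "\<dots> \<le> 1 + 2 * \<theta>"
    using exp_bound_half[of \<theta>] exp_bound_lemma[of \<theta>] assms by simp
  finally show ?thesis .
qed

context sparse_parity
begin

lemma block_sieve:
  assumes "finite S" "S \<noteq> {}" "\<And>h. h \<in> S \<Longrightarrow> h \<le> 2 ^ b" "4 * card S \<le> 2 ^ b"
  shows "sieve S (smooth_modulus (2 ^ b) K) (block P (2 ^ b) E) E (2 ^ (6 * E))"
proof
  show "smooth_modulus (2 ^ b) K > 0" by (rule smooth_modulus_pos)
  show "finite (block P (2 ^ b) E j)" for j by (rule finite_block)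
  show "disjoint_family (block P (2 ^ b) E)" by (rule disjoint_family_block)
  fix j p assume "p \<in> block P (2 ^ b) E j"
  then have p: "prime p" "2 ^ b < p" using P(1) by (auto simp: block_def)
  show "prime p" by (rule p)
  show "coprime (smooth_modulus (2 ^ b) K) p" using p by (rule coprime_smooth_modulus)
  show "4 * card S \<le> p" using p assms by simp
  show "h < p" if "h \<in> S" for h using assms(3)[OF that] p by simp
qed (use assms prod_block_le in auto)

text \<open>With k = |S|, the condition 4 k \<eta> <= 1/2 serves twice: every mass is at most 2 k
  \<eta> <= 1/4, as the truncation requires, and \<theta> = 4 k \<eta> <= 1/2 is admissible for the
  majorant. Over all classes the shares N / W add up to N, while the sieve error is multiplied by
  the modulus.\<close>

lemma parity_sum_bound:
  assumes S: "finite S" "S \<noteq> {}" "\<And>h. h \<in> S \<Longrightarrow> h \<le> 2 ^ b" "4 * card S \<le> 2 ^ b"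
    and small: "\<And>a. a \<ge> b \<Longrightarrow> recip_sum P (2 ^ (a div 2)) (2 ^ a) \<le> \<eta>"
    and \<eta>: "\<eta> \<ge> 0" "4 * real (card S) * \<eta> \<le> 1 / 2"
  shows "(\<Sum>r<smooth_modulus (2 ^ b) K. \<bar>\<Sum>n | n \<in> {1..N} \<and> [n = r] (mod smooth_modulus (2 ^ b) K).
          (-1) ^ card (P \<inter> {2 ^ b<..2 ^ E} \<inter> {p. \<exists>h\<in>S. p dvd n + h})\<bar>)
    \<le> real N * (exp (- recip_sum P (2 ^ b) (2 ^ E)) + 16 * real (card S) * \<eta>)
       + real (smooth_modulus (2 ^ b) K) * (3 * 2 ^ (12 * E) + 2)"
proof -
  define W where "W = smooth_modulus (2 ^ b) K"
  define k where "k = real (card S)"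
  have k: "k \<ge> 1" using S by (simp add: k_def Suc_le_eq card_gt_0_iff)
  have W: "W > 0" by (simp add: W_def smooth_modulus_pos)
  interpret sieve S W "block P (2 ^ b) E" E "2 ^ (6 * E)"
    unfolding W_def by (rule block_sieve) fact+
  have mass_eq: "mass j = 2 * k * (\<Sum>p\<in>block P (2 ^ b) E j. 1 / real p)" for j
    by (simp add: mass_def k_def sum_distrib_left)
  have mass0: "mass j \<ge> 0" for j unfolding mass_def by (intro sum_nonneg) auto
  have mass_le: "mass j \<le> 2 * k * \<eta>" for j
    unfolding mass_eq using block_recip_small[OF small \<eta>(1)] k by (intro mult_left_mono) auto
  have "(\<Prod>j<E. 1 + (2 * mass j) ^ (j + 2)) \<le> 1 + 2 * (4 * k * \<eta>)"
    using mass0 mass_le \<eta> k by (intro prod_one_plus_power_le) (auto simp: k_def mult_ac)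
  then have 2: "2 * ((\<Prod>j<E. 1 + (2 * mass j) ^ (j + 2)) - 1) \<le> 16 * k * \<eta>" by simp
  have "(\<Prod>j<E. 1 - mass j / 2) \<le> (\<Prod>j<E. exp (- (mass j / 2)))"
  proof (intro prod_mono conjI)
    fix j
    show "0 \<le> 1 - mass j / 2" using mass_le[of j] \<eta> by (simp add: k_def)
    show "1 - mass j / 2 \<le> exp (- (mass j / 2))" using exp_ge_add_one_self[of "- (mass j / 2)"] by simp
  qed
  also have "\<dots> = exp (- k * (\<Sum>j<E. \<Sum>p\<in>block P (2 ^ b) E j. 1 / real p))"
  proof -
    have "- (mass j / 2) = - k * (\<Sum>p\<in>block P (2 ^ b) E j. 1 / real p)" for j by (simp add: mass_eq)
    then show ?thesis by (simp only: exp_sum[OF finite_lessThan, symmetric] sum_distrib_left)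
  qed
  also have "(\<Sum>j<E. \<Sum>p\<in>block P (2 ^ b) E j. 1 / real p) = (\<Sum>p\<in>(\<Union>j<E. block P (2 ^ b) E j). 1 / real p)"
    using disjoint_family_onD[OF disjoint_family_block[of P "2 ^ b" E]]
    by (intro sum.UNION_disjoint[symmetric]) (auto simp: finite_block)
  also have "\<dots> = recip_sum P (2 ^ b) (2 ^ E)" by (simp add: UN_block_full recip_sum_def)
  also have "exp (- k * recip_sum P (2 ^ b) (2 ^ E)) \<le> exp (- recip_sum P (2 ^ b) (2 ^ E))"
    using mult_right_mono[OF k recip_sum_nonneg[of P "2 ^ b" "2 ^ E"]] by simp
  finally have 1: "(\<Prod>j<E. 1 - mass j / 2) \<le> exp (- recip_sum P (2 ^ b) (2 ^ E))" .
  define C where "C = exp (- recip_sum P (2 ^ b) (2 ^ E)) + 16 * k * \<eta>"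
  define D where "D = 3 * (2::real) ^ (12 * E) + 2"
  have each: "\<bar>\<Sum>n | n \<in> {1..N} \<and> [n = r] (mod W).
          (-1) ^ card (P \<inter> {2 ^ b<..2 ^ E} \<inter> {p. \<exists>h\<in>S. p dvd n + h})\<bar> \<le> real N / real W * C + D" for r
  proof -
    have "mass j \<le> 1 / 4" for j using mass_le[of j] \<eta> by (simp add: k_def)
    then have "\<bar>\<Sum>n\<in>prog r N. (-1) ^ card ((\<Union>j<E. block P (2 ^ b) E j) \<inter> X n)\<bar>
        \<le> real N / real W * ((\<Prod>j<E. 1 - mass j / 2) + 2 * ((\<Prod>j<E. 1 + (2 * mass j) ^ (j + 2)) - 1))
          + 3 * (real (2 ^ (6 * E)))\<^sup>2 + 2"
      by (intro parity_sum_le) auto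
    also have "\<dots> \<le> real N / real W * C + 3 * (real (2 ^ (6 * E)))\<^sup>2 + 2"
      unfolding C_def using 1 2 by (intro add_mono mult_left_mono) auto
    also have "(real (2 ^ (6 * E)))\<^sup>2 = 2 ^ (12 * E)" by (simp add: power_mult[symmetric])
    finally show ?thesis by (simp add: prog_def X_def UN_block_full D_def)
  qed
  have "(\<Sum>r<W. \<bar>\<Sum>n | n \<in> {1..N} \<and> [n = r] (mod W).
          (-1) ^ card (P \<inter> {2 ^ b<..2 ^ E} \<inter> {p. \<exists>h\<in>S. p dvd n + h})\<bar>) \<le> (\<Sum>r<W. real N / real W * C + D)"
    by (intro sum_mono each)
  also have "\<dots> = real N * C + real W * D" using W by (simp add: field_simps)
  finally show ?thesis unfolding W_def C_def D_def k_def .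
qed

text \<open>The order of choices matters: first \<eta>, then b, which fixes the periodic part and
  its modulus W, and only then E with N of size about 2^(24 E). So W times the sieve error 2^(12 E)
  is negligible against N, and the sum over \<open>P\<close> beyond 2^b still diverges and kills the
  main term.\<close>

lemma corr_average_tendsto_0:
  assumes S: "finite S" "S \<noteq> {}" and H: "finite H"
  shows "(\<lambda>N. (\<Sum>n\<in>{1..N}. corr S H w n) / real N) \<longlonglongrightarrow> 0"
proof (rule LIMSEQ_I)
  fix \<epsilon> :: real assume \<epsilon>: "\<epsilon> > 0"
  define k where "k = real (card S)"
  define l where "l = real (card (S \<union> H))"
  have k: "k \<ge> 1" using S by (simp add: k_def Suc_le_eq card_gt_0_iff)
  have l: "l \<ge> 1" using S H by (simp add: l_def Suc_le_eq card_gt_0_iff)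
  define c where "c = Max (S \<union> H)"
  have c: "h \<le> c" if "h \<in> S \<union> H" for h using S H that by (simp add: c_def)
  \<comment> \<open>The first entry gives 4 k \<eta> <= 1/2 for the sieve. The second bounds the
    final 16 k \<eta> + 32 l \<eta> by \<epsilon> / 3, as (96 k + 144 l) / 3 = 32 k + 48 l; the two
    remaining errors take \<epsilon> / 6 each.\<close>
  define \<eta> where "\<eta> = min (1 / (8 * k)) (\<epsilon> / (96 * k + 144 * l))"
  have \<eta>: "\<eta> > 0" using \<epsilon> k l by (simp add: \<eta>_def)
  have \<eta>1: "4 * k * \<eta> \<le> 1 / 2"
  proof -
    have "\<eta> \<le> 1 / (8 * k)" by (simp add: \<eta>_def)
    then show ?thesis using k by (simp add: field_simps)
  qed
  have \<eta>2: "(96 * k + 144 * l) * \<eta> \<le> \<epsilon>"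
  proof -
    have "\<eta> \<le> \<epsilon> / (96 * k + 144 * l)" by (simp add: \<eta>_def)
    then show ?thesis using k l by (simp add: field_simps)
  qed
  have "\<forall>\<^sub>F b in sequentially. recip_sum P (2 ^ (b div 2)) (2 ^ b) \<le> \<eta>"
    by (rule recip_sum_sqrt_small[OF P(1,2) \<eta>])
  then obtain b1 where b1: "\<And>a. a \<ge> b1 \<Longrightarrow> recip_sum P (2 ^ (a div 2)) (2 ^ a) \<le> \<eta>"
    unfolding eventually_sequentially by blast
  have lim: "filterlim (\<lambda>b. 2 ^ b :: nat) at_top sequentially"
    by (rule filterlim_at_top_mono[OF filterlim_ident]) (auto intro: less_imp_le less_exp)
  have "(\<lambda>y::nat. real y / 2 ^ y + 1 / real y) \<longlonglongrightarrow> 0" by real_asymp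
  then have "\<forall>\<^sub>F y::nat in sequentially. real y / 2 ^ y + 1 / real y < \<eta>"
    using \<eta> by (rule order_tendstoD)
  then have "\<forall>\<^sub>F b in sequentially. real (2 ^ b :: nat) / 2 ^ (2 ^ b :: nat) + 1 / real (2 ^ b :: nat) < \<eta>"
    by (rule eventually_compose_filterlim[OF _ lim])
  moreover have "\<forall>\<^sub>F b in sequentially. \<forall>M. recip_sum Z (2 ^ b) M \<le> \<eta>"
    by (rule eventually_compose_filterlim[OF recip_sum_tail_small[OF Z(2) \<eta>] lim])
  moreover have "\<forall>\<^sub>F b in sequentially. (2 ^ b :: nat) \<ge> max c (4 * card S)"
    by (rule eventually_compose_filterlim[OF eventually_ge_at_top lim])
  moreover have "\<forall>\<^sub>F b in sequentially. b \<ge> b1" by (rule eventually_ge_at_top)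
  ultimately have "\<forall>\<^sub>F b in sequentially. real (2 ^ b :: nat) / 2 ^ (2 ^ b :: nat) + 1 / real (2 ^ b :: nat) < \<eta>
      \<and> (\<forall>M. recip_sum Z (2 ^ b) M \<le> \<eta>) \<and> (2 ^ b :: nat) \<ge> max c (4 * card S) \<and> b \<ge> b1"
    by eventually_elim blast
  then obtain b where "real (2 ^ b :: nat) / 2 ^ (2 ^ b :: nat) + 1 / real (2 ^ b :: nat) < \<eta>
      \<and> (\<forall>M. recip_sum Z (2 ^ b) M \<le> \<eta>) \<and> (2 ^ b :: nat) \<ge> max c (4 * card S) \<and> b \<ge> b1"
    using eventually_happens'[OF sequentially_bot] by blast
  then have b: "real (2 ^ b :: nat) / 2 ^ (2 ^ b :: nat) + 1 / real (2 ^ b :: nat) < \<eta>"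
      "\<And>M. recip_sum Z (2 ^ b) M \<le> \<eta>" "c \<le> 2 ^ b" "4 * card S \<le> 2 ^ b" "b \<ge> b1"
    by auto
  define y :: nat where "y = 2 ^ b"
  \<comment> \<open>\<open>K\<close> is taken equal to y, so that the share y / 2^K of high powers
    of small primes vanishes together with 1 / y.\<close>
  define W where "W = smooth_modulus y y"
  have y: "y > 0" by (simp add: y_def)
  have "(\<lambda>E. exp (- recip_sum P y (2 ^ E))) \<longlonglongrightarrow> 0"
  proof (rule filterlim_compose[OF exp_at_bot])
    have "filterlim (\<lambda>E. recip_sum P y (2 ^ E)) at_top sequentially"
      unfolding filterlim_at_top using recip_sum_unbounded[OF P(3)] by blast
    then show "filterlim (\<lambda>E. - recip_sum P y (2 ^ E)) at_bot sequentially"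
      by (simp add: filterlim_uminus_at_top)
  qed
  then have "\<forall>\<^sub>F E in sequentially. exp (- recip_sum P y (2 ^ E)) < \<epsilon> / 6"
    using \<epsilon> by (intro order_tendstoD) auto
  moreover have "(\<lambda>E. real W * (3 * 2 ^ (12 * E) + 2) / 2 ^ (24 * E)) \<longlonglongrightarrow> 0" by real_asymp
  then have "\<forall>\<^sub>F E in sequentially. real W * (3 * 2 ^ (12 * E) + 2) / 2 ^ (24 * E) < \<epsilon> / 6"
    using \<epsilon> by (intro order_tendstoD) auto
  moreover have "\<forall>\<^sub>F E in sequentially. E \<ge> max 1 (max b1 c)" by (rule eventually_ge_at_top)
  ultimately have "\<forall>\<^sub>F E in sequentially. exp (- recip_sum P y (2 ^ E)) < \<epsilon> / 6 \<and>
      real W * (3 * 2 ^ (12 * E) + 2) / 2 ^ (24 * E) < \<epsilon> / 6 \<and> E \<ge> max 1 (max b1 c)"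
    by eventually_elim blast
  then obtain E0 where E0: "\<And>E. E \<ge> E0 \<Longrightarrow> exp (- recip_sum P y (2 ^ E)) < \<epsilon> / 6 \<and>
      real W * (3 * 2 ^ (12 * E) + 2) / 2 ^ (24 * E) < \<epsilon> / 6 \<and> E \<ge> max 1 (max b1 c)"
    unfolding eventually_sequentially by blast
  have "norm ((\<Sum>n\<in>{1..N}. corr S H w n) / real N - 0) < \<epsilon>" if N: "N \<ge> 2 ^ (24 * E0)" for N
  proof -
    have "N > 0" using N by (metis gr0I le_zero_eq power_not_zero zero_neq_numeral)
    then obtain E where E: "2 ^ (24 * E) \<le> N" "N < 2 ^ (24 * (E + 1))" using ex_power_interval by blast
    have "(2::nat) ^ (24 * E0) < 2 ^ (24 * (E + 1))" using N E(2) by linarith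
    then have "E0 \<le> E" by simp
    note E' = E0[OF this]
    have "c \<le> E" "1 \<le> E" "b1 \<le> E" using E' by auto
    have "c < 2 ^ (24 * E)" using \<open>c \<le> E\<close> less_exp[of "24 * E"] by linarith
    then have cN: "c \<le> N" using E(1) by linarith
    \<comment> \<open>E >= 1 gives 24 (E + 1) + 1 <= 64 E, so six doublings of the exponent E reach
      beyond N + c; hence the 6 \<eta> below.\<close>
    have "(2::nat) ^ (24 * (E + 1)) * 2 \<le> 2 ^ (2 ^ 6 * E)"
      unfolding power_Suc2[symmetric] using \<open>1 \<le> E\<close> by (intro power_increasing) auto
    then have "N + c \<le> 2 ^ (2 ^ 6 * E)" using E(2) cN by linarith
    then have "recip_sum P (2 ^ E) (N + c) \<le> recip_sum P (2 ^ E) (2 ^ (2 ^ 6 * E))"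
      by (intro recip_sum_mono) auto
    also have "\<dots> \<le> real 6 * \<eta>" using b1 \<open>b1 \<le> E\<close> by (rule recip_sum_doublings_le)
    finally have tail: "recip_sum P (2 ^ E) (N + c) \<le> 6 * \<eta>" by simp
    have "\<bar>\<Sum>n\<in>{1..N}. corr S H w n\<bar>
      \<le> (\<Sum>r<W. \<bar>\<Sum>n | n \<in> {1..N} \<and> [n = r] (mod W).
          (-1) ^ card (P \<inter> {y<..2 ^ E} \<inter> {p. \<exists>h\<in>S. p dvd n + h})\<bar>)
      + 2 * l * (real (N + c) *
          (real y / 2 ^ y + 1 / real y + recip_sum Z y (N + c) + recip_sum P (2 ^ E) (N + c)))"
      unfolding l_def W_def
    proof (rule sum_corr_le[OF S(1) H y y c])
      fix h p assume "h \<in> S" "p \<in> P" "y < p"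
      then show "h < p" using c[of h] b(3) by (simp add: y_def)
    qed
    also have "\<dots> \<le> (real N * (exp (- recip_sum P y (2 ^ E)) + 16 * k * \<eta>) + real W * (3 * 2 ^ (12 * E) + 2))
      + 2 * l * (real (N + c) * (\<eta> + \<eta> + 6 * \<eta>))"
    proof (intro add_mono mult_left_mono)
      have "h \<le> 2 ^ b" if "h \<in> S" for h using c[of h] b(3) that by simp
      moreover have "recip_sum P (2 ^ (a div 2)) (2 ^ a) \<le> \<eta>" if "a \<ge> b" for a using b1 b(5) that by simp
      ultimately show "(\<Sum>r<W. \<bar>\<Sum>n | n \<in> {1..N} \<and> [n = r] (mod W).
          (-1) ^ card (P \<inter> {y<..2 ^ E} \<inter> {p. \<exists>h\<in>S. p dvd n + h})\<bar>)
        \<le> real N * (exp (- recip_sum P y (2 ^ E)) + 16 * k * \<eta>) + real W * (3 * 2 ^ (12 * E) + 2)"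
        unfolding y_def W_def k_def using S b(4) \<eta> \<eta>1[unfolded k_def] by (intro parity_sum_bound) auto
    qed (use b(1,2) tail l in \<open>auto simp: y_def\<close>)
    also have "\<dots> \<le> real N * (exp (- recip_sum P y (2 ^ E)) + 16 * k * \<eta>)
        + real N * (real W * (3 * 2 ^ (12 * E) + 2) / 2 ^ (24 * E)) + 2 * l * (real (2 * N) * (8 * \<eta>))"
    proof (intro add_mono order_refl mult_left_mono)
      have "real (2 ^ (24 * E)) \<le> real N" using E(1) by (rule of_nat_mono)
      then have "2 ^ (24 * E) * (real W * (3 * 2 ^ (12 * E) + 2) / 2 ^ (24 * E)) \<le> real N * (real W * (3 * 2 ^ (12 * E) + 2) / 2 ^ (24 * E))"
        by (intro mult_right_mono) auto
      then show "real W * (3 * 2 ^ (12 * E) + 2) \<le> real N * (real W * (3 * 2 ^ (12 * E) + 2) / 2 ^ (24 * E))" by simp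
      show "real (N + c) * (\<eta> + \<eta> + 6 * \<eta>) \<le> real (2 * N) * (8 * \<eta>)"
        using cN \<eta> by (intro mult_mono) auto
    qed (use l in auto)
    also have "\<dots> = real N * (exp (- recip_sum P y (2 ^ E)) + real W * (3 * 2 ^ (12 * E) + 2) / 2 ^ (24 * E)
        + (16 * k * \<eta> + 32 * l * \<eta>))"
      by (simp add: algebra_simps)
    also have "\<dots> < real N * \<epsilon>"
    proof (rule mult_strict_left_mono)
      have "16 * k * \<eta> + 32 * l * \<eta> \<le> (96 * k + 144 * l) * \<eta> / 3"
        using \<eta> k l by (simp add: field_simps)
      then show "exp (- recip_sum P y (2 ^ E)) + real W * (3 * 2 ^ (12 * E) + 2) / 2 ^ (24 * E)
        + (16 * k * \<eta> + 32 * l * \<eta>) < \<epsilon>"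
        using E' \<eta>2 \<epsilon> by linarith
    qed (use \<open>N > 0\<close> in simp)
    finally show ?thesis using \<open>N > 0\<close> by (simp add: abs_divide field_simps)
  qed
  then show "\<exists>N0. \<forall>N\<ge>N0. norm ((\<Sum>n\<in>{1..N}. corr S H w n) / real N - 0) < \<epsilon>" by blast
qed

end

subsection \<open>Cylinder sets and convergence of averages\<close>

lemma funpow_left_shift: "(left_shift ^^ n) x k = x (k + int n)"
  by (induction n arbitrary: k) (simp_all add: left_shift_def algebra_simps)

lemma funpow_left_shift_in_full_shift: "x \<in> full_shift V \<Longrightarrow> (left_shift ^^ n) x \<in> full_shift V"
  by (simp add: full_shift_def funpow_left_shift)

lemma extend_by_zero_in_full_shift:
  "0 \<in> V \<Longrightarrow> (\<And>n. n > 0 \<Longrightarrow> \<eta> n \<in> V) \<Longrightarrow> extend_by_zero \<eta> \<in> full_shift V"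
  by (simp add: full_shift_def extend_by_zero_def)

lemma compact_full_shift:
  assumes "finite V"
  shows "compact (full_shift V)"
proof -
  have "full_shift V = PiE UNIV (\<lambda>_. V)" by (auto simp: full_shift_def PiE_UNIV_domain)
  moreover have "compactin (product_topology (\<lambda>_. euclidean) UNIV) (PiE UNIV (\<lambda>_::int. V))"
    using assms by (simp add: compactin_PiE finite_imp_compact)
  ultimately show ?thesis by (simp add: euclidean_product_topology)
qed

lemma continuous_on_coordinate: "continuous_on S (\<lambda>x::int \<Rightarrow> int. \<phi> (x h))"
proof -
  have "continuous_on (range (\<lambda>x::int \<Rightarrow> int. x h)) \<phi>"
    by (subst continuous_on_open_vimage[OF Topological_Spaces.open_discrete]) (simp add: Topological_Spaces.open_discrete)
  then have "continuous_on UNIV (\<lambda>x::int \<Rightarrow> int. \<phi> (x h))"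
    by (rule continuous_on_compose2[OF _ continuous_on_product_coordinates]) simp
  then show ?thesis by (rule continuous_on_subset) simp
qed

lemma continuous_on_left_shift: "continuous_on S left_shift"
  unfolding left_shift_def
  by (rule continuous_on_coordinatewise_then_product) (rule continuous_on_coordinate)

lemma coordinate_borel: "{x::int \<Rightarrow> int. x h \<in> A} \<in> sets borel"
proof -
  have "A \<in> sets borel" by (rule borel_open) (rule Topological_Spaces.open_discrete)
  then have "(\<lambda>x::int \<Rightarrow> int. x h) -` A \<inter> space borel \<in> sets borel"
    by (rule measurable_sets[OF measurable_product_coordinates])
  then show ?thesis by (simp add: vimage_def)
qed

lemma full_shift_borel: "full_shift V \<in> sets borel"
proof -
  have "full_shift V = (\<Inter>k. {x. x k \<in> V})" by (auto simp: full_shift_def)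
  then show ?thesis using coordinate_borel by (auto intro!: sets.countable_INT'')
qed

lemma cylinder_borel:
  assumes "finite H"
  shows "cylinder V H v \<in> sets (restrict_space borel (full_shift V))"
proof -
  have "{x::int \<Rightarrow> int. x h = v h} \<in> sets borel" for h
    using coordinate_borel[of h "{v h}"] by simp
  then have "full_shift V \<inter> (\<Inter>h\<in>H. {x. x h = v h}) \<in> sets borel"
    using assms by (cases "H = {}") (auto intro!: sets.Int sets.finite_INT full_shift_borel)
  moreover have "cylinder V H v = full_shift V \<inter> (\<Inter>h\<in>H. {x. x h = v h})" by (auto simp: cylinder_def)
  ultimately show ?thesis using assms full_shift_borel by (simp add: sets_restrict_space_iff)
qed

text \<open>Cylinders with conflicting prescriptions are disjoint; adjoining the empty set closes
  the family under intersection.\<close>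

definition cylinders :: "int set \<Rightarrow> (int \<Rightarrow> int) set set" where
  "cylinders V = insert {} {cylinder V H v | H v. finite H \<and> v ` H \<subseteq> V}"

lemma Int_stable_cylinders: "Int_stable (cylinders V)"
proof (rule Int_stableI)
  fix A B assume "A \<in> cylinders V" "B \<in> cylinders V"
  then consider "A = {} \<or> B = {}" | H v H' v' where "A = cylinder V H v" "B = cylinder V H' v'"
      "finite H" "finite H'" "v ` H \<subseteq> V" "v' ` H' \<subseteq> V"
    by (auto simp: cylinders_def)
  then show "A \<inter> B \<in> cylinders V"
  proof cases
    case 1
    then show ?thesis by (auto simp: cylinders_def)
  next
    case 2
    show ?thesis
    proof (cases "A \<inter> B = {}")
      case False
      define w where "w = (\<lambda>h. if h \<in> H then v h else v' h)"
      have agree: "v h = v' h" if "h \<in> H" "h \<in> H'" for h using False 2 that by (force simp: cylinder_def)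
      have "A \<inter> B = cylinder V (H \<union> H') w"
        using agree unfolding 2 by (auto simp: cylinder_def w_def)
      moreover have "w ` (H \<union> H') \<subseteq> V" using 2 by (auto simp: w_def)
      ultimately show ?thesis using 2 by (auto simp: cylinders_def)
    qed (simp add: cylinders_def)
  qed
qed

lemma open_contains_window:
  fixes U :: "(int \<Rightarrow> int) set"
  assumes "open U" "x \<in> U"
  shows "\<exists>H. finite H \<and> (\<forall>y. (\<forall>h\<in>H. y h = x h) \<longrightarrow> y \<in> U)"
proof -
  have "openin (product_topology (\<lambda>_. euclidean) UNIV) U" using assms(1) by (simp add: open_fun_def)
  then obtain X where X: "x \<in> (\<Pi>\<^sub>E i\<in>UNIV. X i)" "finite {i. X i \<noteq> topspace (euclidean :: int topology)}"
      "(\<Pi>\<^sub>E i\<in>UNIV. X i) \<subseteq> U"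
    using product_topology_open_contains_basis[OF _ assms(2)] by blast
  have "y \<in> U" if y: "\<forall>h\<in>{i. X i \<noteq> UNIV}. y h = x h" for y
  proof -
    have "y i \<in> X i" for i using y X(1) by (cases "X i = UNIV") (auto simp: PiE_UNIV_domain)
    then show ?thesis using X(3) by (auto simp: PiE_UNIV_domain)
  qed
  then show ?thesis using X(2) by (intro exI[of _ "{i. X i \<noteq> UNIV}"]) simp
qed

lemma countable_cylinders:
  assumes "finite V"
  shows "countable (cylinders V)"
proof -
  define I where "I = (SIGMA H : {H :: int set. finite H}. PiE H (\<lambda>_. V))"
  have "countable I"
    unfolding I_def using assms by (intro countable_SIGMA countable_Collect_finite countable_finite finite_PiE) auto
  moreover have "cylinders V \<subseteq> insert {} ((\<lambda>(H, v). cylinder V H v) ` I)"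
  proof
    fix C assume "C \<in> cylinders V"
    then consider "C = {}" | H v where "C = cylinder V H v" "finite H" "v ` H \<subseteq> V" by (auto simp: cylinders_def)
    then show "C \<in> insert {} ((\<lambda>(H, v). cylinder V H v) ` I)"
    proof cases
      case 2
      then have "(H, restrict v H) \<in> I" by (auto simp: I_def)
      moreover have "C = cylinder V H (restrict v H)" unfolding 2(1) by (auto simp: cylinder_def)
      ultimately show ?thesis by (metis (no_types, lifting) case_prod_conv image_eqI insertI2)
    qed simp
  qed
  ultimately show ?thesis by (meson countable_image countable_insert countable_subset)
qed

text \<open>Over a finite alphabet there are only countably many cylinders, and a relatively open
  set is the union of those inside it.\<close>

lemma sets_eq_sigma_sets_cylinders:
  assumes "finite V"
  shows "sets (restrict_space borel (full_shift V)) = sigma_sets (full_shift V) (cylinders V)"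
proof
  define \<Omega> where "\<Omega> = full_shift V"
  have sub: "cylinders V \<subseteq> Pow \<Omega>" by (auto simp: cylinders_def cylinder_def \<Omega>_def)
  interpret S: sigma_algebra \<Omega> "sigma_sets \<Omega> (cylinders V)" by (rule sigma_algebra_sigma_sets[OF sub])
  have "sigma_sets \<Omega> (cylinders V) \<subseteq> sets (restrict_space borel \<Omega>)"
  proof -
    have "space (restrict_space borel \<Omega>) = \<Omega>" by (simp add: space_restrict_space)
    moreover have "cylinders V \<subseteq> sets (restrict_space borel \<Omega>)"
      using cylinder_borel by (auto simp: cylinders_def \<Omega>_def)
    ultimately show ?thesis using sets.sigma_sets_subset by metis
  qed
  then show "sigma_sets (full_shift V) (cylinders V) \<subseteq> sets (restrict_space borel (full_shift V))"
    unfolding \<Omega>_def .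
  have "\<Omega> \<in> sigma_sets UNIV {U. open U}" unfolding sets_borel[symmetric] \<Omega>_def by (rule full_shift_borel)
  then have "sets (restrict_space borel \<Omega>) = sigma_sets \<Omega> ((\<inter>) \<Omega> ` {U. open U})"
    unfolding sets_restrict_space sets_borel by (rule sigma_sets_Int) simp
  also have "\<dots> \<subseteq> sigma_sets \<Omega> (cylinders V)"
  proof (rule sigma_sets_mono, clarify)
    fix U :: "(int \<Rightarrow> int) set" assume U: "open U"
    have "\<Omega> \<inter> U = (\<Union>C\<in>{C \<in> cylinders V. C \<subseteq> U}. C)"
    proof (intro equalityI subsetI)
      fix x assume x: "x \<in> \<Omega> \<inter> U"
      then obtain H where H: "finite H" "\<forall>y. (\<forall>h\<in>H. y h = x h) \<longrightarrow> y \<in> U"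
        using open_contains_window[OF U] by blast
      have "x ` H \<subseteq> V" using x by (auto simp: \<Omega>_def full_shift_def)
      then have "cylinder V H x \<in> cylinders V" using H(1) by (auto simp: cylinders_def)
      moreover have "cylinder V H x \<subseteq> U" using H(2) by (auto simp: cylinder_def)
      moreover have "x \<in> cylinder V H x" using x by (auto simp: cylinder_def \<Omega>_def)
      ultimately show "x \<in> (\<Union>C\<in>{C \<in> cylinders V. C \<subseteq> U}. C)" by blast
    next
      fix x assume "x \<in> (\<Union>C\<in>{C \<in> cylinders V. C \<subseteq> U}. C)"
      then show "x \<in> \<Omega> \<inter> U" using sub by blast
    qed
    also have "\<dots> \<in> sigma_sets \<Omega> (cylinders V)"
      by (intro S.countable_UN' countable_subset[OF _ countable_cylinders[OF assms]]) auto
    finally show "\<Omega> \<inter> U \<in> sigma_sets \<Omega> (cylinders V)" .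
  qed
  finally show "sets (restrict_space borel (full_shift V)) \<subseteq> sigma_sets (full_shift V) (cylinders V)"
    unfolding \<Omega>_def .
qed

lemma measure_eqI_cylinder:
  assumes V: "finite V"
    and sets: "sets \<mu> = sets (restrict_space borel (full_shift V))" "sets \<nu> = sets (restrict_space borel (full_shift V))"
    and prob: "prob_space \<mu>" "prob_space \<nu>"
    and eq: "\<And>H v. finite H \<Longrightarrow> v ` H \<subseteq> V \<Longrightarrow> measure \<mu> (cylinder V H v) = measure \<nu> (cylinder V H v)"
  shows "\<mu> = \<nu>"
proof -
  interpret \<mu>: prob_space \<mu> by (rule prob)
  interpret \<nu>: prob_space \<nu> by (rule prob)
  show ?thesis
  proof (rule measure_eqI_generator_eq[where E = "cylinders V" and \<Omega> = "full_shift V" and A = "\<lambda>_. full_shift V"])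
    show "cylinders V \<subseteq> Pow (full_shift V)" by (auto simp: cylinders_def cylinder_def)
    fix X assume "X \<in> cylinders V"
    then show "emeasure \<mu> X = emeasure \<nu> X"
      using eq by (auto simp: cylinders_def \<mu>.emeasure_eq_measure \<nu>.emeasure_eq_measure)
  next
    have "full_shift V = cylinder V {} (\<lambda>_. 0)" by (auto simp: cylinder_def)
    then have "full_shift V \<in> cylinders V" unfolding cylinders_def by blast
    then show "range (\<lambda>_::nat. full_shift V) \<subseteq> cylinders V" by auto
  qed (simp_all add: Int_stable_cylinders sets sets_eq_sigma_sets_cylinders[OF V])
qed

text \<open>Uniform continuity in terms of coordinates. Around each point some finite window
  controls \<open>F\<close> up to \<epsilon> / 2; by compactness finitely many centres suffice, and
  the union of their windows works everywhere.\<close>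

lemma continuous_on_full_shift_window:
  fixes F :: "(int \<Rightarrow> int) \<Rightarrow> 'b::metric_space"
  assumes V: "finite V" and F: "continuous_on (full_shift V) F" and "\<epsilon> > 0"
  shows "\<exists>H. finite H \<and> (\<forall>x\<in>full_shift V. \<forall>y\<in>full_shift V. (\<forall>h\<in>H. x h = y h) \<longrightarrow> dist (F x) (F y) < \<epsilon>)"
proof -
  have "\<exists>H. finite H \<and> (\<forall>y\<in>full_shift V. (\<forall>h\<in>H. y h = x h) \<longrightarrow> dist (F y) (F x) < \<epsilon> / 2)"
    if x: "x \<in> full_shift V" for x
  proof -
    obtain U where U: "open U" "x \<in> U" "\<forall>y\<in>full_shift V. y \<in> U \<longrightarrow> F y \<in> ball (F x) (\<epsilon> / 2)"
      using F[unfolded continuous_on_topological, rule_format, OF x, of "ball (F x) (\<epsilon> / 2)"] \<open>\<epsilon> > 0\<close> by auto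
    then show ?thesis
      using open_contains_window[OF U(1,2)] by (metis mem_ball dist_commute)
  qed
  then obtain H where H: "\<And>x. x \<in> full_shift V \<Longrightarrow> finite (H x)"
      "\<And>x y. x \<in> full_shift V \<Longrightarrow> y \<in> full_shift V \<Longrightarrow> \<forall>h\<in>H x. y h = x h \<Longrightarrow> dist (F y) (F x) < \<epsilon> / 2"
    by metis
  define nb where "nb = (\<lambda>x. {y. \<forall>h\<in>H x. y h = x h})"
  have "open (nb x)" if "x \<in> full_shift V" for x
  proof -
    have "open ((\<lambda>y::int \<Rightarrow> int. y h) -` {x h})" for h
      by (rule open_vimage[OF Topological_Spaces.open_discrete continuous_on_product_coordinates])
    moreover have "nb x = (\<Inter>h\<in>H x. (\<lambda>y. y h) -` {x h})" by (auto simp: nb_def)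
    ultimately show ?thesis using H(1)[OF that] by auto
  qed
  then obtain C where C: "C \<subseteq> full_shift V" "finite C" "full_shift V \<subseteq> (\<Union>x\<in>C. nb x)"
    using compactE_image[OF compact_full_shift[OF V], of "full_shift V" nb] by (auto simp: nb_def)
  have "dist (F x) (F y) < \<epsilon>"
    if xy: "x \<in> full_shift V" "y \<in> full_shift V" "\<forall>h\<in>(\<Union>z\<in>C. H z). x h = y h" for x y
  proof -
    obtain z where z: "z \<in> C" "\<forall>h\<in>H z. x h = z h" using C(3) xy(1) by (auto simp: nb_def)
    then have "\<forall>h\<in>H z. y h = z h" using xy(3) by force
    then have "dist (F y) (F z) < \<epsilon> / 2" "dist (F x) (F z) < \<epsilon> / 2"
      using H(2)[of z] z C(1) xy by auto
    then show ?thesis by (metis dist_commute dist_triangle_half_r)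
  qed
  moreover have "finite (\<Union>z\<in>C. H z)" using C H(1) by blast
  ultimately show ?thesis by blast
qed

section \<open>Convergence tested on cylinder frequencies\<close>

definition freq :: "(nat \<Rightarrow> int) \<Rightarrow> int set \<Rightarrow> (int \<Rightarrow> int) \<Rightarrow> real \<Rightarrow> real" where
  "freq \<eta> H v x = (1 / x) * (\<Sum>n = 1..nat \<lfloor>x\<rfloor>. of_bool (\<forall>h\<in>H. extend_by_zero \<eta> (h + int n) = v h))"

text \<open>The indicator of a cylinder depends on finitely many coordinates, hence is continuous
  and may be used as a test function.\<close>

lemma furstenberg_freq:
  assumes V: "finite V" "0 \<in> V" "\<And>n. n > 0 \<Longrightarrow> \<eta> n \<in> V" and H: "finite H"
    and \<nu>: "sets \<nu> = sets (restrict_space borel (full_shift V))" "prob_space \<nu>"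
    and lim: "\<And>F :: (int \<Rightarrow> int) \<Rightarrow> complex. continuous_on (full_shift V) F \<Longrightarrow>
           (\<lambda>j. (1 / x j) *\<^sub>R (\<Sum>n = 1..nat \<lfloor>x j\<rfloor>. F ((left_shift ^^ n) (extend_by_zero \<eta>))))
             \<longlonglongrightarrow> (LINT y|\<nu>. F y)"
  shows "(\<lambda>j. freq \<eta> H v (x j)) \<longlonglongrightarrow> measure \<nu> (cylinder V H v)"
proof -
  interpret prob_space \<nu> by (rule \<nu>)
  define F :: "(int \<Rightarrow> int) \<Rightarrow> complex" where "F = (\<lambda>y. \<Prod>h\<in>H. of_bool (y h = v h))"
  have F_eq: "F y = of_bool (\<forall>h\<in>H. y h = v h)" for y
    unfolding F_def using H by (induction H rule: finite_induct) auto
  have "continuous_on (full_shift V) F"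
    unfolding F_def by (intro continuous_on_prod continuous_on_coordinate)
  from lim[OF this] have "(\<lambda>j. Re ((1 / x j) *\<^sub>R (\<Sum>n = 1..nat \<lfloor>x j\<rfloor>. F ((left_shift ^^ n) (extend_by_zero \<eta>)))))
             \<longlonglongrightarrow> Re (LINT y|\<nu>. F y)" by (rule tendsto_Re)
  moreover have "Re ((1 / x j) *\<^sub>R (\<Sum>n = 1..nat \<lfloor>x j\<rfloor>. F ((left_shift ^^ n) (extend_by_zero \<eta>)))) = freq \<eta> H v (x j)" for j
    by (simp add: F_eq freq_def funpow_left_shift of_bool_def if_distrib[of Re] cong: if_cong)
  moreover have "(LINT y|\<nu>. F y) = (LINT y|\<nu>. complex_of_real (indicator (cylinder V H v) y))"
  proof (rule Bochner_Integration.integral_cong)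
    fix y assume "y \<in> space \<nu>"
    then have "y \<in> full_shift V"
      using sets_eq_imp_space_eq[OF \<nu>(1)] by (simp add: space_restrict_space)
    then show "F y = complex_of_real (indicator (cylinder V H v) y)" by (simp add: F_eq cylinder_def indicator_def)
  qed simp
  moreover have "(LINT y|\<nu>. complex_of_real (indicator (cylinder V H v) y)) = complex_of_real (measure \<nu> (cylinder V H v))"
    unfolding integral_complex_of_real using cylinder_borel[OF H, of V v] \<nu>(1)
    by (simp add: sets.Int_space_eq2)
  ultimately show ?thesis by simp
qed

text \<open>Conversely, cylinders suffice: \<open>F\<close> is uniformly within \<epsilon> / 3 of a
  function of a finite window, which is a finite combination of cylinder indicators, and uniform
  closeness passes to the averages and to the integral.\<close>

lemma furstenberg_criterion:
  assumes V: "finite V" "0 \<in> V" "\<And>n. n > 0 \<Longrightarrow> \<eta> n \<in> V"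
    and \<nu>: "sets \<nu> = sets (restrict_space borel (full_shift V))" "prob_space \<nu>"
    and x: "filterlim x at_top sequentially"
    and lim: "\<And>H v. finite H \<Longrightarrow> v ` H \<subseteq> V \<Longrightarrow> (\<lambda>j. freq \<eta> H v (x j)) \<longlonglongrightarrow> measure \<nu> (cylinder V H v)"
    and F: "continuous_on (full_shift V) (F :: (int \<Rightarrow> int) \<Rightarrow> complex)"
  shows "(\<lambda>j. (1 / x j) *\<^sub>R (\<Sum>n = 1..nat \<lfloor>x j\<rfloor>. F ((left_shift ^^ n) (extend_by_zero \<eta>))))
             \<longlonglongrightarrow> (LINT y|\<nu>. F y)"
proof -
  interpret prob_space \<nu> by (rule \<nu>)
  define avg where "avg = (\<lambda>F j. (1 / x j) *\<^sub>R (\<Sum>n = 1..nat \<lfloor>x j\<rfloor>. F ((left_shift ^^ n) (extend_by_zero \<eta>)) :: complex))"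
  have sp: "space \<nu> = full_shift V"
    using sets_eq_imp_space_eq[OF \<nu>(1)] by (simp add: space_restrict_space)
  have pt: "(left_shift ^^ n) (extend_by_zero \<eta>) \<in> full_shift V" for n
    using V by (intro funpow_left_shift_in_full_shift extend_by_zero_in_full_shift)
  have F_meas: "F \<in> borel_measurable \<nu>"
    using borel_measurable_continuous_on_restrict[OF F] measurable_cong_sets[OF \<nu>(1) refl] by blast
  have "bounded (F ` full_shift V)"
    using F compact_full_shift[OF V(1)] by (intro compact_imp_bounded compact_continuous_image)
  then obtain B where B: "\<And>y. y \<in> full_shift V \<Longrightarrow> norm (F y) \<le> B" by (auto simp: bounded_iff)
  have F_int: "integrable \<nu> F"
    using F_meas B sp by (intro integrable_const_bound[where B = B]) auto
  have "\<forall>\<^sub>F j in sequentially. dist (avg F j) (LINT y|\<nu>. F y) < \<epsilon>" if \<epsilon>: "\<epsilon> > 0" for \<epsilon>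
  proof -
    obtain H where H: "finite H" "\<forall>x\<in>full_shift V. \<forall>y\<in>full_shift V. (\<forall>h\<in>H. x h = y h) \<longrightarrow> dist (F x) (F y) < \<epsilon> / 3"
      using continuous_on_full_shift_window[OF V(1) F, of "\<epsilon> / 3"] \<epsilon> by auto
    define I where "I = PiE H (\<lambda>_. V)"
    have I: "finite I" using H(1) V(1) by (simp add: I_def finite_PiE)
    \<comment> \<open>Positions outside the window are filled with 0; as 0 lies in \<open>V\<close>,
      the representative of a point is again in the full shift.\<close>
    define rep where "rep = (\<lambda>(v :: int \<Rightarrow> int) k. if k \<in> H then v k else 0)"
    define F' where "F' = (\<lambda>y. \<Sum>v\<in>I. F (rep v) * complex_of_real (indicator (cylinder V H v) y))"
    have F': "F' y = F (rep (restrict y H))" if y: "y \<in> full_shift V" for y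
    proof -
      have "restrict y H \<in> I" using y by (auto simp: I_def full_shift_def)
      moreover have "y \<in> cylinder V H v \<longleftrightarrow> v = restrict y H" if "v \<in> I" for v
        using that y by (auto simp: cylinder_def I_def PiE_iff extensional_def restrict_def fun_eq_iff)
      ultimately have "F' y = (\<Sum>v\<in>{restrict y H}. F (rep v))"
        unfolding F'_def using I by (intro sum.mono_neutral_cong_right) (auto simp: indicator_def)
      then show ?thesis by simp
    qed
    have close: "dist (F y) (F' y) < \<epsilon> / 3" if y: "y \<in> full_shift V" for y
    proof -
      have "rep (restrict y H) \<in> full_shift V" using y V(2) by (auto simp: rep_def full_shift_def)
      moreover have "\<forall>h\<in>H. y h = rep (restrict y H) h" by (simp add: rep_def)
      ultimately show ?thesis using H(2) y F'[OF y] by simp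
    qed
    have meas[measurable]: "cylinder V H v \<in> sets \<nu>" for v using cylinder_borel[OF H(1)] \<nu>(1) by simp
    have int': "integrable \<nu> (\<lambda>y. F (rep v) * complex_of_real (indicator (cylinder V H v) y))" for v
      by (intro integrable_mult_right integrable_of_real integrable_real_indicator meas) (simp add: less_top[symmetric])
    then have F'_int: "integrable \<nu> F'" unfolding F'_def by (intro Bochner_Integration.integrable_sum)
    have F'_val: "(LINT y|\<nu>. F' y) = (\<Sum>v\<in>I. F (rep v) * complex_of_real (measure \<nu> (cylinder V H v)))"
      unfolding F'_def using int' meas by (simp add: Bochner_Integration.integral_sum sets.Int_space_eq2)
    have F'_avg: "avg F' j = (\<Sum>v\<in>I. F (rep v) * complex_of_real (freq \<eta> H v (x j)))" for j
    proof -
      have "indicator (cylinder V H v) ((left_shift ^^ n) (extend_by_zero \<eta>)) =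
          (of_bool (\<forall>h\<in>H. extend_by_zero \<eta> (h + int n) = v h) :: real)" for v n
        using pt[of n] by (simp add: cylinder_def indicator_def funpow_left_shift)
      moreover have "(1 / X) *\<^sub>R (\<Sum>n\<in>A. \<Sum>v\<in>I. c v * complex_of_real (b v n)) =
          (\<Sum>v\<in>I. c v * complex_of_real ((1 / X) * (\<Sum>n\<in>A. b v n)))"
        for X and A :: "nat set" and c and b :: "(int \<Rightarrow> int) \<Rightarrow> nat \<Rightarrow> real"
        by (subst sum.swap) (simp add: scaleR_conv_of_real sum_distrib_left mult_ac)
      ultimately show ?thesis unfolding avg_def F'_def freq_def by (simp only:)
    qed
    have "(\<lambda>j. avg F' j) \<longlonglongrightarrow> (LINT y|\<nu>. F' y)"
      unfolding F'_avg F'_val using H(1)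
      by (intro tendsto_sum tendsto_mult tendsto_const tendsto_of_real lim) (auto simp: I_def)
    then have "\<forall>\<^sub>F j in sequentially. dist (avg F' j) (LINT y|\<nu>. F' y) < \<epsilon> / 3"
      using \<epsilon> by (intro tendstoD) auto
    moreover have "\<forall>\<^sub>F j in sequentially. x j > 0"
      using x by (simp add: filterlim_at_top_dense)
    ultimately show ?thesis
    proof eventually_elim
      case (elim j)
      have "norm (avg F j - avg F' j) = norm ((1 / x j) *\<^sub>R (\<Sum>n = 1..nat \<lfloor>x j\<rfloor>.
          F ((left_shift ^^ n) (extend_by_zero \<eta>)) - F' ((left_shift ^^ n) (extend_by_zero \<eta>))))"
        by (simp add: avg_def scaleR_diff_right sum_subtractf)
      also have "\<dots> \<le> (1 / x j) * (\<Sum>n = 1..nat \<lfloor>x j\<rfloor>. \<epsilon> / 3)"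
        unfolding norm_scaleR using elim(2) close[OF pt]
        by (intro mult_mono order_trans[OF norm_sum] sum_mono) (auto simp: dist_norm less_imp_le)
      also have "\<dots> = (real (nat \<lfloor>x j\<rfloor>) / x j) * (\<epsilon> / 3)" by simp
      also have "\<dots> \<le> 1 * (\<epsilon> / 3)"
        using elim(2) \<epsilon> by (intro mult_right_mono) (auto simp: divide_le_eq_1)
      finally have 1: "dist (avg F j) (avg F' j) \<le> \<epsilon> / 3" by (simp add: dist_norm)
      have "norm ((LINT y|\<nu>. F' y) - (LINT y|\<nu>. F y)) = norm (LINT y|\<nu>. F' y - F y)"
        using F_int F'_int by simp
      also have "\<dots> \<le> (LINT y|\<nu>. norm (F' y - F y))" by (rule integral_norm_bound)
      also have "\<dots> \<le> (LINT y|\<nu>. \<epsilon> / 3)"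
        using F_int F'_int close sp by (intro integral_mono) (auto simp: dist_norm norm_minus_commute less_imp_le)
      also have "\<dots> = \<epsilon> / 3" by (simp add: prob_space)
      finally have 2: "dist (LINT y|\<nu>. F' y) (LINT y|\<nu>. F y) \<le> \<epsilon> / 3" by (simp add: dist_norm)
      show ?case
        using 1 2 elim(1) dist_triangle[of "avg F j" "LINT y|\<nu>. F y" "avg F' j"]
          dist_triangle[of "avg F' j" "LINT y|\<nu>. F y" "LINT y|\<nu>. F' y"] by linarith
    qed
  qed
  then show ?thesis unfolding avg_def by (rule tendstoI)
qed

subsection \<open>Random signs and squares\<close>

lemma space_full_shift:
  assumes "sets \<nu> = sets (restrict_space borel (full_shift V))"
  shows "space \<nu> = full_shift V"
  using sets_eq_imp_space_eq[OF assms] by (simp add: space_restrict_space)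

lemma measurable_left_shift:
  assumes "sets \<nu> = sets (restrict_space borel (full_shift V))"
  shows "left_shift \<in> measurable \<nu> \<nu>"
proof -
  have "left_shift \<in> measurable (restrict_space borel (full_shift V)) (restrict_space borel (full_shift V))"
    by (intro measurable_restrict_space3 borel_measurable_continuous_onI continuous_on_left_shift)
      (auto simp: full_shift_def left_shift_def)
  then show ?thesis using measurable_cong_sets[OF assms assms] by simp
qed

lemma measure_distr_left_shift_cylinder:
  assumes \<nu>: "sets \<nu> = sets (restrict_space borel (full_shift V))" and H: "finite H"
  shows "measure (distr \<nu> \<nu> left_shift) (cylinder V H v) = measure \<nu> (cylinder V ((\<lambda>h. h + 1) ` H) (\<lambda>k. v (k - 1)))"
proof -
  have "measure (distr \<nu> \<nu> left_shift) (cylinder V H v) = measure \<nu> (left_shift -` cylinder V H v \<inter> space \<nu>)"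
    using cylinder_borel[OF H] \<nu> by (intro measure_distr measurable_left_shift[OF \<nu>]) simp
  also have "left_shift -` cylinder V H v \<inter> space \<nu> = cylinder V ((\<lambda>h. h + 1) ` H) (\<lambda>k. v (k - 1))"
    unfolding space_full_shift[OF \<nu>] by (auto simp: cylinder_def full_shift_def left_shift_def)
  finally show ?thesis .
qed

definition sign :: "bool \<Rightarrow> int" where
  "sign b = (if b then 1 else -1)"

definition sign_measure :: "(int \<Rightarrow> bool) measure" where
  "sign_measure = (\<Pi>\<^sub>M k\<in>UNIV. measure_pmf (pmf_of_set UNIV))"

definition sign_extension :: "(int \<Rightarrow> int) measure \<Rightarrow> (int \<Rightarrow> int) measure" where
  "sign_extension \<nu> = distr (\<nu> \<Otimes>\<^sub>M sign_measure) (restrict_space borel (full_shift {-1, 0, 1}))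
     (\<lambda>(y, s) k. sign (s k) * y k)"

lemma sign_mult_full_shift:
  assumes "y \<in> full_shift {0, 1}"
  shows "(\<lambda>k. sign (s k) * y k) \<in> full_shift {-1, 0, 1}"
  unfolding full_shift_def mem_Collect_eq
proof
  fix k
  have "y k = 0 \<or> y k = 1" using assms by (simp add: full_shift_def)
  then show "sign (s k) * y k \<in> {-1, 0, 1}" by (auto simp: sign_def)
qed

context
  fixes \<nu> :: "(int \<Rightarrow> int) measure"
  assumes sets_\<nu>: "sets \<nu> = sets (restrict_space borel (full_shift {0, 1}))" and prob_\<nu>: "prob_space \<nu>"
begin

interpretation \<nu>: prob_space \<nu> by (rule prob_\<nu>)

interpretation S: product_prob_space "\<lambda>_::int. measure_pmf (pmf_of_set (UNIV :: bool set))" UNIV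
  by standard

interpretation sign: prob_space sign_measure
  unfolding sign_measure_def by (rule S.prob_space_axioms)

lemma sign_event:
  assumes "finite A"
  shows "{s. \<forall>h\<in>A. s h = b h} \<in> sets sign_measure" "measure sign_measure {s. \<forall>h\<in>A. s h = b h} = (1 / 2) ^ card A"
proof -
  have eq: "{s. \<forall>h\<in>A. s h = b h} = prod_emb UNIV (\<lambda>_. measure_pmf (pmf_of_set UNIV)) A (\<Pi>\<^sub>E h\<in>A. {b h})"
    by (rule set_eqI) (simp add: prod_emb_def restrict_PiE_iff PiE_UNIV_domain Pi_iff)
  show "{s. \<forall>h\<in>A. s h = b h} \<in> sets sign_measure"
    unfolding eq sign_measure_def by (rule sets_PiM_I) (simp_all add: assms)
  show "measure sign_measure {s. \<forall>h\<in>A. s h = b h} = (1 / 2) ^ card A"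
    unfolding eq sign_measure_def
    by (subst S.measure_PiM_emb) (simp_all add: assms measure_pmf_single power_one_over)
qed

text \<open>Where v h = 0 the sign is free and y h must vanish; elsewhere y h = 1 and the sign is
  forced. So the preimage is a rectangle, and only the support contributes factors 1/2.\<close>

lemma sign_extension_vimage:
  assumes v: "v ` H \<subseteq> {-1, 0, 1}"
  shows "(\<lambda>(y, s) k. sign (s k) * y k) -` cylinder {-1, 0, 1} H v \<inter> space (\<nu> \<Otimes>\<^sub>M sign_measure)
    = cylinder {0, 1} H (\<lambda>h. (v h)\<^sup>2) \<times> {s. \<forall>h\<in>cylinder_supp H v. s h = (v h = 1)}"
proof -
  have sp: "space (\<nu> \<Otimes>\<^sub>M sign_measure) = full_shift {0, 1} \<times> UNIV"
    by (simp add: space_pair_measure space_full_shift[OF sets_\<nu>] sign_measure_def space_PiM PiE_UNIV_domain)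
  have pt: "sign b * a = c \<longleftrightarrow> a = c\<^sup>2 \<and> (c \<noteq> 0 \<longrightarrow> b = (c = 1))"
    if "a \<in> {0, 1}" "c \<in> {-1, 0, 1}" for a c :: int and b
    using that by (auto simp: sign_def)
  have *: "(\<lambda>k. sign (s k) * y k) \<in> cylinder {-1, 0, 1} H v \<and> y \<in> full_shift {0, 1} \<longleftrightarrow>
     y \<in> cylinder {0, 1} H (\<lambda>h. (v h)\<^sup>2) \<and> (\<forall>h\<in>cylinder_supp H v. s h = (v h = 1))" for y s
  proof (cases "y \<in> full_shift {0, 1}")
    case True
    then have "sign (s h) * y h = v h \<longleftrightarrow> y h = (v h)\<^sup>2 \<and> (v h \<noteq> 0 \<longrightarrow> s h = (v h = 1))" if "h \<in> H" for h
      using v that by (intro pt) (auto simp: full_shift_def)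
    then show ?thesis using True sign_mult_full_shift[OF True, of s] by (auto simp: cylinder_def cylinder_supp_def)
  qed (simp add: cylinder_def)
  show ?thesis unfolding sp
  proof (rule set_eqI)
    fix z :: "(int \<Rightarrow> int) \<times> (int \<Rightarrow> bool)"
    show "z \<in> (\<lambda>(y, s) k. sign (s k) * y k) -` cylinder {-1, 0, 1} H v \<inter> full_shift {0, 1} \<times> UNIV \<longleftrightarrow>
      z \<in> cylinder {0, 1} H (\<lambda>h. (v h)\<^sup>2) \<times> {s. \<forall>h\<in>cylinder_supp H v. s h = (v h = 1)}"
      using *[of "snd z" "fst z"] by (cases z) simp
  qed
qed

lemma sign_extension_measurable:
  "(\<lambda>(y, s) k. sign (s k) * y k) \<in> measurable (\<nu> \<Otimes>\<^sub>M sign_measure) (restrict_space borel (full_shift {-1, 0, 1}))"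
proof (rule measurable_sigma_sets[OF sets_eq_sigma_sets_cylinders])
  show "cylinders {-1, 0, 1} \<subseteq> Pow (full_shift {-1, 0, 1})" by (auto simp: cylinders_def cylinder_def)
  show "(\<lambda>(y, s) k. sign (s k) * y k) \<in> space (\<nu> \<Otimes>\<^sub>M sign_measure) \<rightarrow> full_shift {-1, 0, 1}"
    by (auto simp: space_pair_measure space_full_shift[OF sets_\<nu>] intro!: sign_mult_full_shift)
  fix C assume "C \<in> cylinders {-1, 0, 1}"
  then consider "C = {}" | H v where "C = cylinder {-1, 0, 1} H v" "finite H" "v ` H \<subseteq> {-1, 0, 1}"
    unfolding cylinders_def by blast
  then show "(\<lambda>(y, s) k. sign (s k) * y k) -` C \<inter> space (\<nu> \<Otimes>\<^sub>M sign_measure) \<in> sets (\<nu> \<Otimes>\<^sub>M sign_measure)"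
  proof cases
    case 2
    then have "finite (cylinder_supp H v)" by (simp add: cylinder_supp_def)
    then show ?thesis
      unfolding 2(1) sign_extension_vimage[OF 2(3)] using cylinder_borel[OF 2(2)] sets_\<nu>
      by (intro pair_measureI sign_event(1)) simp_all
  qed simp
qed simp

lemma sets_sign_extension: "sets (sign_extension \<nu>) = sets (restrict_space borel (full_shift {-1, 0, 1}))"
  by (simp add: sign_extension_def)

lemma prob_space_sign_extension: "prob_space (sign_extension \<nu>)"
  unfolding sign_extension_def
  by (rule prob_space.prob_space_distr[OF prob_space_pair[OF prob_\<nu> sign.prob_space_axioms] sign_extension_measurable])

lemma measure_sign_extension:
  assumes H: "finite H" and v: "v ` H \<subseteq> {-1, 0, 1}"
  shows "measure (sign_extension \<nu>) (cylinder {-1, 0, 1} H v)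
    = (1 / 2) ^ card (cylinder_supp H v) * measure \<nu> (cylinder {0, 1} H (\<lambda>h. (v h)\<^sup>2))"
proof -
  define A where "A = cylinder {0, 1} H (\<lambda>h. (v h)\<^sup>2)"
  define B where "B = {s. \<forall>h\<in>cylinder_supp H v. s h = (v h = 1)}"
  have fin: "finite (cylinder_supp H v)" using H by (simp add: cylinder_supp_def)
  have A: "A \<in> sets \<nu>" using cylinder_borel[OF H] by (simp add: A_def sets_\<nu>)
  have B: "B \<in> sets sign_measure" unfolding B_def by (rule sign_event(1)[OF fin])
  have "measure (sign_extension \<nu>) (cylinder {-1, 0, 1} H v) = measure (\<nu> \<Otimes>\<^sub>M sign_measure) (A \<times> B)"
    unfolding sign_extension_def A_def B_def sign_extension_vimage[OF v, symmetric]
    using H by (intro measure_distr sign_extension_measurable cylinder_borel)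
  also have "\<dots> = measure \<nu> A * measure sign_measure B"
    unfolding measure_def sign.emeasure_pair_measure_Times[OF A B] by (rule enn2real_mult)
  also have "measure sign_measure B = (1 / 2) ^ card (cylinder_supp H v)"
    unfolding B_def by (rule sign_event(2)[OF fin])
  finally show ?thesis by (simp add: A_def)
qed

text \<open>On cylinders, translation preserves the size of the support, and the other factor is
  invariant because \<open>\<nu>\<close> is.\<close>

lemma distr_sign_extension_left_shift:
  assumes inv: "distr \<nu> \<nu> left_shift = \<nu>"
  shows "distr (sign_extension \<nu>) (sign_extension \<nu>) left_shift = sign_extension \<nu>"
proof (rule measure_eqI_cylinder[where V = "{-1, 0, 1}"])
  show "prob_space (distr (sign_extension \<nu>) (sign_extension \<nu>) left_shift)"
    by (rule prob_space.prob_space_distr[OF prob_space_sign_extension measurable_left_shift[OF sets_sign_extension]])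
  fix H :: "int set" and v :: "int \<Rightarrow> int" assume H: "finite H" and v: "v ` H \<subseteq> {-1, 0, 1}"
  let ?H = "(\<lambda>h. h + 1) ` H" and ?v = "\<lambda>k. v (k - 1)"
  have "cylinder_supp ?H ?v = (\<lambda>h. h + 1) ` cylinder_supp H v"
    unfolding cylinder_supp_def by auto
  then have card: "card (cylinder_supp ?H ?v) = card (cylinder_supp H v)"
    by (simp add: card_image)
  have "measure (distr (sign_extension \<nu>) (sign_extension \<nu>) left_shift) (cylinder {-1, 0, 1} H v)
      = measure (sign_extension \<nu>) (cylinder {-1, 0, 1} ?H ?v)"
    by (rule measure_distr_left_shift_cylinder[OF sets_sign_extension H])
  also have "\<dots> = (1 / 2) ^ card (cylinder_supp H v) * measure \<nu> (cylinder {0, 1} ?H (\<lambda>k. (v (k - 1))\<^sup>2))"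
    using H v by (subst measure_sign_extension) (auto simp: card)
  also have "measure \<nu> (cylinder {0, 1} ?H (\<lambda>k. (v (k - 1))\<^sup>2)) = measure \<nu> (cylinder {0, 1} H (\<lambda>h. (v h)\<^sup>2))"
    using measure_distr_left_shift_cylinder[OF sets_\<nu> H, of "\<lambda>h. (v h)\<^sup>2"] inv by simp
  also have "(1 / 2) ^ card (cylinder_supp H v) * \<dots> = measure (sign_extension \<nu>) (cylinder {-1, 0, 1} H v)"
    by (rule measure_sign_extension[OF H v, symmetric])
  finally show "measure (distr (sign_extension \<nu>) (sign_extension \<nu>) left_shift) (cylinder {-1, 0, 1} H v)
      = measure (sign_extension \<nu>) (cylinder {-1, 0, 1} H v)" .
qed (simp_all add: sets_sign_extension prob_space_sign_extension)

end

section \<open>Squaring as a factor map of shifts\<close>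

definition square_map :: "(int \<Rightarrow> int) \<Rightarrow> int \<Rightarrow> int" where
  "square_map x = (\<lambda>k. (x k)\<^sup>2)"

lemma continuous_on_square_map: "continuous_on S square_map"
  unfolding square_map_def
  by (rule continuous_on_coordinatewise_then_product) (rule continuous_on_coordinate[where \<phi> = "\<lambda>a. a\<^sup>2"])

lemma square_map_full_shift: "x \<in> full_shift {-1, 0, 1} \<Longrightarrow> square_map x \<in> full_shift {0, 1}"
  unfolding full_shift_def square_map_def mem_Collect_eq
proof
  fix k assume "\<forall>k. x k \<in> {-1, 0, 1}"
  then have "x k \<in> {-1, 0, 1}" by blast
  then show "(x k)\<^sup>2 \<in> {0, 1}" by auto
qed

text \<open>Squaring is continuous, commutes with the shift and maps the extended sequence
  \<open>\<eta>\<close> to the extended \<open>\<eta>'\<close>, as 0 is its own square. The second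
  conclusion keeps the cutoffs \<open>x\<close>: uniqueness identifies only the measure, while
  comparing frequencies needs both limits along one sequence.\<close>

lemma furstenberg_square:
  assumes \<nu>: "furstenberg_measure {-1, 0, 1} \<eta> \<nu>"
    and x: "filterlim x at_top sequentially"
      "\<And>F :: (int \<Rightarrow> int) \<Rightarrow> complex. continuous_on (full_shift {-1, 0, 1}) F \<Longrightarrow>
           (\<lambda>j. (1 / x j) *\<^sub>R (\<Sum>n = 1..nat \<lfloor>x j\<rfloor>. F ((left_shift ^^ n) (extend_by_zero \<eta>))))
             \<longlonglongrightarrow> (LINT y|\<nu>. F y)"
    and sq: "\<And>n. n > 0 \<Longrightarrow> (\<eta> n)\<^sup>2 = \<eta>' n"
  defines "\<mu> \<equiv> distr \<nu> (restrict_space borel (full_shift {0, 1})) square_map"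
  shows "furstenberg_measure {0, 1} \<eta>' \<mu>"
    "continuous_on (full_shift {0, 1}) (F :: (int \<Rightarrow> int) \<Rightarrow> complex) \<Longrightarrow>
           (\<lambda>j. (1 / x j) *\<^sub>R (\<Sum>n = 1..nat \<lfloor>x j\<rfloor>. F ((left_shift ^^ n) (extend_by_zero \<eta>'))))
             \<longlonglongrightarrow> (LINT y|\<mu>. F y)"
proof -
  have sets: "sets \<nu> = sets (restrict_space borel (full_shift {-1, 0, 1}))" and prob: "prob_space \<nu>"
    and inv: "distr \<nu> \<nu> left_shift = \<nu>" using \<nu> by (auto simp: furstenberg_measure_def)
  have "square_map \<in> measurable (restrict_space borel (full_shift {-1, 0, 1})) (restrict_space borel (full_shift {0, 1}))"
    by (intro measurable_restrict_space3 borel_measurable_continuous_onI continuous_on_square_map)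
      (auto simp: square_map_full_shift)
  then have meas: "square_map \<in> measurable \<nu> (restrict_space borel (full_shift {0, 1}))"
    using measurable_cong_sets[OF sets refl] by blast
  have sets_\<mu>: "sets \<mu> = sets (restrict_space borel (full_shift {0, 1}))" by (simp add: \<mu>_def)
  have comm: "square_map ((left_shift ^^ n) (extend_by_zero \<eta>)) = (left_shift ^^ n) (extend_by_zero \<eta>')" for n
    by (rule ext) (simp add: square_map_def funpow_left_shift extend_by_zero_def sq)
  have lim: "(\<lambda>j. (1 / x j) *\<^sub>R (\<Sum>n = 1..nat \<lfloor>x j\<rfloor>. F ((left_shift ^^ n) (extend_by_zero \<eta>'))))
             \<longlonglongrightarrow> (LINT y|\<mu>. F y)" if F: "continuous_on (full_shift {0, 1}) F" for F :: "(int \<Rightarrow> int) \<Rightarrow> complex"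
  proof -
    have "continuous_on (full_shift {-1, 0, 1}) (\<lambda>y. F (square_map y))"
      by (rule continuous_on_compose2[OF F continuous_on_square_map]) (auto simp: square_map_full_shift)
    from x(2)[OF this] show ?thesis
      unfolding comm \<mu>_def using borel_measurable_continuous_on_restrict[OF F] by (simp add: integral_distr[OF meas])
  qed
  show "(\<lambda>j. (1 / x j) *\<^sub>R (\<Sum>n = 1..nat \<lfloor>x j\<rfloor>. F ((left_shift ^^ n) (extend_by_zero \<eta>'))))
             \<longlonglongrightarrow> (LINT y|\<mu>. F y)" if "continuous_on (full_shift {0, 1}) F" using that by (rule lim)
  have "distr \<mu> \<mu> left_shift = distr \<nu> (restrict_space borel (full_shift {0, 1})) (left_shift \<circ> square_map)"
  proof -
    have "distr \<mu> \<mu> left_shift = distr \<mu> (restrict_space borel (full_shift {0, 1})) left_shift"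
      by (rule distr_cong) (simp_all add: sets_\<mu>)
    also have "\<dots> = distr \<nu> (restrict_space borel (full_shift {0, 1})) (left_shift \<circ> square_map)"
      unfolding \<mu>_def by (intro distr_distr meas measurable_left_shift) simp
    finally show ?thesis .
  qed
  also have "left_shift \<circ> square_map = square_map \<circ> left_shift"
    by (rule ext) (simp add: left_shift_def square_map_def)
  also have "distr \<nu> (restrict_space borel (full_shift {0, 1})) (square_map \<circ> left_shift) = distr (distr \<nu> \<nu> left_shift) (restrict_space borel (full_shift {0, 1})) square_map"
    by (rule distr_distr[symmetric, OF meas measurable_left_shift[OF sets]])
  also have "\<dots> = \<mu>" by (simp add: inv \<mu>_def)
  finally have "distr \<mu> \<mu> left_shift = \<mu>" .
  moreover have "prob_space \<mu>" unfolding \<mu>_def by (rule prob_space.prob_space_distr[OF prob meas])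
  ultimately show "furstenberg_measure {0, 1} \<eta>' \<mu>"
    unfolding furstenberg_measure_def using sets_\<mu> x(1) lim by blast
qed

subsection \<open>Frequencies of cylinders\<close>

lemma prime_factors_mult_coprime:
  fixes m n :: nat
  assumes "m > 0" "n > 0" "coprime m n"
  shows "prime_factors (m * n) = prime_factors m \<union> prime_factors n"
    "prime_factors m \<inter> prime_factors n = {}"
proof -
  show "prime_factors (m * n) = prime_factors m \<union> prime_factors n"
    using assms by (simp add: prime_factors_product)
  show "prime_factors m \<inter> prime_factors n = {}"
  proof (rule equals0I)
    fix p assume "p \<in> prime_factors m \<inter> prime_factors n"
    then have "prime p" "p dvd m" "p dvd n" by (auto simp: in_prime_factors_iff)
    then show False using assms(3) coprime_common_divisor_nat[of m n p] by auto
  qed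
qed

lemma multiplicative_small_omega: "multiplicative_fun (\<lambda>n. (-1 :: int) ^ small_omega_in P n)"
  unfolding multiplicative_fun_def
proof (intro conjI allI impI)
  show "(-1 :: int) ^ small_omega_in P 1 = 1" by (simp add: small_omega_in_def)
  fix m n :: nat assume *: "0 < m" "0 < n" "coprime m n"
  have "prime_factors (m * n) \<inter> P = prime_factors m \<inter> P \<union> prime_factors n \<inter> P"
    using prime_factors_mult_coprime[OF *] by auto
  then have "small_omega_in P (m * n) = small_omega_in P m + small_omega_in P n"
    unfolding small_omega_in_def using prime_factors_mult_coprime(2)[OF *]
    by (simp only:) (rule card_Un_disjoint, auto)
  then show "(-1 :: int) ^ small_omega_in P (m * n) = (-1) ^ small_omega_in P m * (-1) ^ small_omega_in P n"
    by (simp add: power_add)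
qed

lemma multiplicative_big_Omega: "multiplicative_fun (\<lambda>n. (-1 :: int) ^ big_Omega_in P n)"
  unfolding multiplicative_fun_def
proof (intro conjI allI impI)
  show "(-1 :: int) ^ big_Omega_in P 1 = 1" by (simp add: big_Omega_in_def)
  fix m n :: nat assume *: "0 < m" "0 < n" "coprime m n"
  note pf = prime_factors_mult_coprime[OF *]
  have mult: "multiplicity p (m * n) = multiplicity p m + multiplicity p n" if "prime p" for p
    using that * by (intro prime_elem_multiplicity_mult_distrib) auto
  have "big_Omega_in P (m * n) = (\<Sum>p\<in>prime_factors m \<inter> P \<union> prime_factors n \<inter> P. multiplicity p (m * n))"
    unfolding big_Omega_in_def pf(1) by (intro sum.cong) auto
  also have "\<dots> = (\<Sum>p\<in>prime_factors m \<inter> P. multiplicity p (m * n)) + (\<Sum>p\<in>prime_factors n \<inter> P. multiplicity p (m * n))"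
    using pf(2) by (intro sum.union_disjoint) auto
  also have "(\<Sum>p\<in>prime_factors m \<inter> P. multiplicity p (m * n)) = big_Omega_in P m"
    unfolding big_Omega_in_def
  proof (rule sum.cong)
    fix p assume p: "p \<in> prime_factors m \<inter> P"
    then have "\<not> p dvd n" using pf(2) *(2) by (auto simp: in_prime_factors_iff)
    moreover have "prime p" using p by auto
    ultimately show "multiplicity p (m * n) = multiplicity p m"
      by (simp add: mult not_dvd_imp_multiplicity_0)
  qed simp
  also have "(\<Sum>p\<in>prime_factors n \<inter> P. multiplicity p (m * n)) = big_Omega_in P n"
    unfolding big_Omega_in_def
  proof (rule sum.cong)
    fix p assume p: "p \<in> prime_factors n \<inter> P"
    then have "\<not> p dvd m" using pf(2) *(1) by (auto simp: in_prime_factors_iff)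
    moreover have "prime p" using p by auto
    ultimately show "multiplicity p (m * n) = multiplicity p n"
      by (simp add: mult not_dvd_imp_multiplicity_0)
  qed simp
  finally show "(-1 :: int) ^ big_Omega_in P (m * n) = (-1) ^ big_Omega_in P m * (-1) ^ big_Omega_in P n"
    by (simp add: power_add)
qed

lemma omega_in_prime:
  assumes "prime p"
  shows "small_omega_in P p = of_bool (p \<in> P)" "big_Omega_in P p = of_bool (p \<in> P)"
proof -
  have "prime_factors p = {p}" using assms by (simp add: prime_factorization_prime)
  then show "small_omega_in P p = of_bool (p \<in> P)" "big_Omega_in P p = of_bool (p \<in> P)"
    using assms by (auto simp: small_omega_in_def big_Omega_in_def)
qed

text \<open>At a prime with g p = 0 the term of the pretentious sum is exactly 1 / p, whatever the
  character and the twist.\<close>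

lemma pretentious_zeros_summable:
  assumes g: "\<And>n. n > 0 \<Longrightarrow> g n \<in> {0, 1::int}" and pret: "pretentious (\<lambda>n. of_int (g n))"
  shows "(\<lambda>p. 1 / real p) summable_on {p. prime p \<and> g p \<noteq> 1}"
proof -
  obtain \<psi> and t :: real where
    "(\<lambda>p. (1 - Re (of_int (g p) * cnj (\<psi> p) * of_nat p powr (- (\<i> * of_real t)))) / real p) summable_on {p. prime p}"
    using pret unfolding pretentious_def by blast
  then have "(\<lambda>p. (1 - Re (of_int (g p) * cnj (\<psi> p) * of_nat p powr (- (\<i> * of_real t)))) / real p)
      summable_on {p. prime p \<and> g p \<noteq> 1}"
    by (rule summable_on_subset_banach) auto
  then show ?thesis
  proof (rule summable_on_cong[THEN iffD1, rotated])
    fix p assume "p \<in> {p. prime p \<and> g p \<noteq> 1}"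
    then have "g p = 0" using g[of p] by (auto simp: prime_gt_0_nat)
    then show "(1 - Re (of_int (g p) * cnj (\<psi> p) * of_nat p powr (- (\<i> * of_real t)))) / real p = 1 / real p" by simp
  qed
qed

section \<open>Averages under shifts and real cutoffs\<close>

lemma average_shift_tendsto_0:
  fixes a :: "nat \<Rightarrow> real"
  assumes "(\<lambda>N. (\<Sum>n\<in>{1..N}. a (n + c)) / real N) \<longlonglongrightarrow> 0"
  shows "(\<lambda>N. (\<Sum>n\<in>{1..N}. a n) / real N) \<longlonglongrightarrow> 0"
proof -
  have eq: "(\<Sum>n\<in>{1..N + c}. a n) = (\<Sum>n\<in>{1..c}. a n) + (\<Sum>n\<in>{1..N}. a (n + c))" for N
    by (induction N) (simp_all add: add.commute)
  have "(\<lambda>N. (\<Sum>n\<in>{1..c}. a n) * (1 / real (N + c)) + (\<Sum>n\<in>{1..N}. a (n + c)) / real N * (real N / real (N + c)))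
      \<longlonglongrightarrow> (\<Sum>n\<in>{1..c}. a n) * 0 + 0 * 1"
  proof (intro tendsto_add tendsto_mult tendsto_const assms)
    show "(\<lambda>N. 1 / real (N + c)) \<longlonglongrightarrow> 0" by real_asymp
    show "(\<lambda>N. real N / real (N + c)) \<longlonglongrightarrow> 1" by real_asymp
  qed
  then have lim: "(\<lambda>N. (\<Sum>n\<in>{1..c}. a n) * (1 / real (N + c)) + (\<Sum>n\<in>{1..N}. a (n + c)) / real N * (real N / real (N + c)))
      \<longlonglongrightarrow> 0"
    by (simp only: mult_zero_right mult_zero_left add_0)
  have "(\<lambda>N. (\<Sum>n\<in>{1..N + c}. a n) / real (N + c)) \<longlonglongrightarrow> 0"
  proof (rule Lim_transform_eventually[OF lim])
    show "\<forall>\<^sub>F N in sequentially. (\<Sum>n\<in>{1..c}. a n) * (1 / real (N + c)) + (\<Sum>n\<in>{1..N}. a (n + c)) / real N * (real N / real (N + c))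
        = (\<Sum>n\<in>{1..N + c}. a n) / real (N + c)"
      using eventually_gt_at_top[of 0] unfolding eq by eventually_elim (simp add: add_divide_distrib)
  qed
  then show ?thesis by (rule LIMSEQ_offset)
qed

text \<open>Dividing by x instead of its integer part can only shrink the modulus of the
  average.\<close>

lemma average_real_cutoff_tendsto_0:
  fixes a :: "nat \<Rightarrow> real"
  assumes "(\<lambda>N. (\<Sum>n\<in>{1..N}. a n) / real N) \<longlonglongrightarrow> 0" and x: "filterlim x at_top sequentially"
  shows "(\<lambda>j. (1 / x j) * (\<Sum>n = 1..nat \<lfloor>x j\<rfloor>. a n)) \<longlonglongrightarrow> 0"
proof -
  define A where "A = (\<lambda>N. (\<Sum>n\<in>{1..N}. a n) / real N)"
  have "filterlim (\<lambda>j. nat \<lfloor>x j\<rfloor>) at_top sequentially"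
    using x by (intro filterlim_compose[OF filterlim_nat_sequentially] filterlim_compose[OF filterlim_floor_sequentially])
  then have "(\<lambda>j. A (nat \<lfloor>x j\<rfloor>)) \<longlonglongrightarrow> 0"
    using assms(1) unfolding A_def by (rule filterlim_compose[rotated])
  then have "(\<lambda>j. norm (A (nat \<lfloor>x j\<rfloor>))) \<longlonglongrightarrow> 0" by (rule tendsto_norm_zero)
  then show ?thesis
  proof (rule Lim_null_comparison[rotated])
    have "\<forall>\<^sub>F j in sequentially. x j > 0" using x by (simp add: filterlim_at_top_dense)
    then show "\<forall>\<^sub>F j in sequentially. norm ((1 / x j) * (\<Sum>n = 1..nat \<lfloor>x j\<rfloor>. a n)) \<le> norm (A (nat \<lfloor>x j\<rfloor>))"
    proof eventually_elim
      case (elim j)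
      define N where "N = nat \<lfloor>x j\<rfloor>"
      have N: "real N \<le> x j" using elim by (simp add: N_def)
      show ?case unfolding N_def[symmetric]
      proof (cases "N = 0")
        case False
        then have "\<bar>\<Sum>n = 1..N. a n\<bar> / x j \<le> \<bar>\<Sum>n = 1..N. a n\<bar> / real N"
          using N elim by (intro divide_left_mono) auto
        then show "norm ((1 / x j) * (\<Sum>n = 1..N. a n)) \<le> norm (A N)"
          using elim by (simp add: A_def abs_mult)
      qed simp
    qed
  qed
qed

context sparse_parity
begin

text \<open>For signs a and v the indicator of a = v is (1 + v a) / 2. Multiplied out over the
  support, the empty set gives the subtracted main term and every other \<open>S\<close> a
  correlation. If g misses the squared pattern, everything vanishes, since f g = v at a position
  forces g = v^2 there. The map \<open>i\<close> carries integer positions to natural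
  shifts.\<close>

lemma cylinder_expansion:
  assumes g: "\<And>n. n > 0 \<Longrightarrow> g n \<in> {0, 1}" and H: "finite H" and v: "v ` H \<subseteq> {-1, 0, 1}"
    and n: "n > 0" and i: "inj_on i H" and w: "\<And>h. h \<in> H \<Longrightarrow> w (i h) = (v h)\<^sup>2"
  shows "of_bool (\<forall>h\<in>H. f (n + i h) * g (n + i h) = v h)
      - (1 / 2) ^ card (cylinder_supp H v) * of_bool (\<forall>h\<in>H. g (n + i h) = (v h)\<^sup>2)
    = (\<Sum>S\<in>Pow (cylinder_supp H v) - {{}}. (1 / 2) ^ card (cylinder_supp H v) * (\<Prod>h\<in>S. real_of_int (v h)) * corr (i ` S) (i ` H) w n)"
proof -
  define A where "A = cylinder_supp H v"
  have A: "finite A" "A \<subseteq> H" using H by (auto simp: A_def cylinder_supp_def)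
  have fv: "f (n + i h) = 1 \<or> f (n + i h) = -1" for h using f_abs[of "n + i h"] n by (auto simp: abs_if split: if_splits)
  define b where "b = (\<forall>h\<in>H. g (n + i h) = (v h)\<^sup>2)"
  have "of_bool (\<forall>h\<in>H. f (n + i h) * g (n + i h) = v h)
      = (1 / 2) ^ card A * (\<Prod>h\<in>A. 1 + real_of_int (v h) * real_of_int (f (n + i h))) * of_bool b"
  proof (cases b)
    case True
    have iff: "f (n + i h) * g (n + i h) = v h \<longleftrightarrow> (h \<in> A \<longrightarrow> f (n + i h) = v h)" if "h \<in> H" for h
      using True that v by (auto simp: b_def A_def cylinder_supp_def)
    have "(1 / 2) ^ card A * (\<Prod>h\<in>A. 1 + real_of_int (v h) * real_of_int (f (n + i h)))
        = (\<Prod>h\<in>A. (1 + real_of_int (v h) * real_of_int (f (n + i h))) / 2)"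
      by (simp add: prod_dividef power_one_over)
    also have "\<dots> = (\<Prod>h\<in>A. of_bool (f (n + i h) = v h))"
    proof (rule prod.cong)
      fix h assume "h \<in> A"
      then have "v h = 1 \<or> v h = -1" using v by (auto simp: A_def cylinder_supp_def)
      then show "(1 + real_of_int (v h) * real_of_int (f (n + i h))) / 2 = of_bool (f (n + i h) = v h)"
        using fv[of h] by auto
    qed simp
    also have "\<dots> = of_bool (\<forall>h\<in>A. f (n + i h) = v h)"
      using A(1) by (induction A rule: finite_induct) auto
    finally show ?thesis using iff A(2) True by (auto intro!: arg_cong[where f = of_bool])
  next
    case False
    then obtain h where h: "h \<in> H" "g (n + i h) \<noteq> (v h)\<^sup>2" by (auto simp: b_def)
    have "f (n + i h) * g (n + i h) \<noteq> v h"
    proof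
      assume "f (n + i h) * g (n + i h) = v h"
      then have "(v h)\<^sup>2 = (f (n + i h) * g (n + i h))\<^sup>2" by simp
      also have "\<dots> = g (n + i h)" using fv[of h] g[of "n + i h"] n by auto
      finally show False using h(2) by simp
    qed
    then show ?thesis using False h(1) by auto
  qed
  also have "(\<Prod>h\<in>A. 1 + real_of_int (v h) * real_of_int (f (n + i h)))
      = (\<Sum>S\<in>Pow A. \<Prod>h\<in>S. real_of_int (v h) * real_of_int (f (n + i h)))"
    using prod_add[OF A(1), of "\<lambda>h. real_of_int (v h) * real_of_int (f (n + i h))" "\<lambda>_. 1"] by (simp add: add.commute)
  also have "\<dots> = 1 + (\<Sum>S\<in>Pow A - {{}}. \<Prod>h\<in>S. real_of_int (v h) * real_of_int (f (n + i h)))"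
    using A(1) by (subst sum.remove[of _ "{}"]) auto
  finally have "of_bool (\<forall>h\<in>H. f (n + i h) * g (n + i h) = v h) - (1 / 2) ^ card A * of_bool b
      = (\<Sum>S\<in>Pow A - {{}}. (1 / 2) ^ card A * ((\<Prod>h\<in>S. real_of_int (v h) * real_of_int (f (n + i h))) * of_bool b))"
    by (simp add: algebra_simps sum_distrib_left sum_distrib_right)
  also have "\<dots> = (\<Sum>S\<in>Pow A - {{}}. (1 / 2) ^ card A * (\<Prod>h\<in>S. real_of_int (v h)) * corr (i ` S) (i ` H) w n)"
  proof (rule sum.cong)
    fix S assume "S \<in> Pow A - {{}}"
    then have "inj_on i S" using inj_on_subset[OF i] A(2) by blast
    then have "corr (i ` S) (i ` H) w n = (\<Prod>h\<in>S. real_of_int (f (n + i h))) * of_bool b"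
      using w by (simp add: corr_def prod.reindex b_def)
    then show "(1 / 2) ^ card A * ((\<Prod>h\<in>S. real_of_int (v h) * real_of_int (f (n + i h))) * of_bool b)
        = (1 / 2) ^ card A * (\<Prod>h\<in>S. real_of_int (v h)) * corr (i ` S) (i ` H) w n"
      by (simp add: prod.distrib)
  qed simp
  finally show ?thesis unfolding A_def b_def .
qed

text \<open>Only correlations over nonempty \<open>S\<close> remain, each of mean 0. The difference
  form holds along every \<open>x\<close>, whereas the frequencies of g are known to converge only
  along suitable cutoffs.\<close>

lemma freq_diff_tendsto_0:
  assumes g: "\<And>n. n > 0 \<Longrightarrow> g n \<in> {0, 1}" and H: "finite H" and v: "v ` H \<subseteq> {-1, 0, 1}"
    and x: "filterlim x at_top sequentially"
  shows "(\<lambda>j. freq (\<lambda>n. f n * g n) H v (x j)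
      - (1 / 2) ^ card (cylinder_supp H v) * freq g H (\<lambda>h. (v h)\<^sup>2) (x j)) \<longlonglongrightarrow> 0"
proof -
  define s where "s = card (cylinder_supp H v)"
  \<comment> \<open>Translation by c makes all h + c nonnegative, so for n > 0 the window at n + c
    never reads the zeros of the extension.\<close>
  define c where "c = nat (Max (insert 0 (abs ` H)))"
  have c: "h + int c \<ge> 0" if "h \<in> H" for h
  proof -
    have "\<bar>h\<bar> \<le> Max (insert 0 (abs ` H))" using H that by (intro Max_ge) auto
    then have "int c = Max (insert 0 (abs ` H))" unfolding c_def by linarith
    with \<open>\<bar>h\<bar> \<le> Max (insert 0 (abs ` H))\<close> show ?thesis by linarith
  qed
  define i where "i = (\<lambda>h. nat (h + int c))"
  have i: "inj_on i H" using c by (intro inj_onI) (simp add: i_def eq_nat_nat_iff)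
  have ext: "extend_by_zero \<eta> (h + int (n + c)) = \<eta> (n + i h)" if "h \<in> H" "n > 0" for h n \<eta>
  proof -
    have "nat (h + int (n + c)) = n + i h" "h + int (n + c) > 0" using c[OF that(1)] that(2) by (auto simp: i_def nat_add_distrib)
    then show ?thesis by (simp add: extend_by_zero_def)
  qed
  define d :: "nat \<Rightarrow> real" where "d = (\<lambda>n. of_bool (\<forall>h\<in>H. extend_by_zero (\<lambda>n. f n * g n) (h + int n) = v h)
      - (1 / 2) ^ s * of_bool (\<forall>h\<in>H. extend_by_zero g (h + int n) = (v h)\<^sup>2))"
  define w where "w = (\<lambda>m. (v (int m - int c))\<^sup>2)"
  have w: "w (i h) = (v h)\<^sup>2" if "h \<in> H" for h using c[OF that] by (simp add: w_def i_def)
  define AA where "AA = Pow (cylinder_supp H v) - {{}}"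
  have d_eq: "d (n + c) = (\<Sum>S\<in>AA. (1 / 2) ^ s * (\<Prod>h\<in>S. real_of_int (v h)) * corr (i ` S) (i ` H) w n)" if "n > 0" for n
  proof -
    have 1: "(\<forall>h\<in>H. extend_by_zero (\<lambda>n. f n * g n) (h + int (n + c)) = v h) \<longleftrightarrow> (\<forall>h\<in>H. f (n + i h) * g (n + i h) = v h)"
      using that by (intro ball_cong refl) (simp only: ext)
    have 2: "(\<forall>h\<in>H. extend_by_zero g (h + int (n + c)) = (v h)\<^sup>2) \<longleftrightarrow> (\<forall>h\<in>H. g (n + i h) = (v h)\<^sup>2)"
      using that by (intro ball_cong refl) (simp only: ext)
    show ?thesis
      unfolding d_def s_def AA_def 1 2 by (rule cylinder_expansion[OF g H v that i w])
  qed
  have "(\<lambda>N. (\<Sum>n\<in>{1..N}. d (n + c)) / real N) \<longlonglongrightarrow> 0"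
  proof -
    have "(\<Sum>n\<in>{1..N}. d (n + c)) / real N = (\<Sum>S\<in>AA. (1 / 2) ^ s * (\<Prod>h\<in>S. real_of_int (v h)) *
        ((\<Sum>n\<in>{1..N}. corr (i ` S) (i ` H) w n) / real N))" for N
    proof -
      have "(\<Sum>n\<in>{1..N}. d (n + c)) = (\<Sum>n\<in>{1..N}. \<Sum>S\<in>AA. (1 / 2) ^ s * (\<Prod>h\<in>S. real_of_int (v h)) * corr (i ` S) (i ` H) w n)"
        by (intro sum.cong refl d_eq) auto
      also have "\<dots> = (\<Sum>S\<in>AA. (1 / 2) ^ s * (\<Prod>h\<in>S. real_of_int (v h)) * (\<Sum>n\<in>{1..N}. corr (i ` S) (i ` H) w n))"
        by (subst sum.swap) (simp add: sum_distrib_left)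
      finally have eq: "(\<Sum>n\<in>{1..N}. d (n + c)) = \<dots>" .
      show ?thesis unfolding eq by (subst sum_divide_distrib) (simp only: times_divide_eq_right)
    qed
    moreover have "(\<lambda>N. (\<Sum>S\<in>AA. (1 / 2) ^ s * (\<Prod>h\<in>S. real_of_int (v h)) *
        ((\<Sum>n\<in>{1..N}. corr (i ` S) (i ` H) w n) / real N))) \<longlonglongrightarrow> 0"
    proof (intro tendsto_null_sum tendsto_mult_right_zero corr_average_tendsto_0)
      fix S assume "S \<in> AA"
      then have "S \<subseteq> H" "S \<noteq> {}" by (auto simp: AA_def cylinder_supp_def)
      then show "finite (i ` S)" "i ` S \<noteq> {}" using H finite_subset by auto
    qed (use H in simp)
    ultimately show ?thesis by simp
  qed
  then have "(\<lambda>N. (\<Sum>n\<in>{1..N}. d n) / real N) \<longlonglongrightarrow> 0" by (rule average_shift_tendsto_0)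
  then have "(\<lambda>j. (1 / x j) * (\<Sum>n = 1..nat \<lfloor>x j\<rfloor>. d n)) \<longlonglongrightarrow> 0"
    using x by (rule average_real_cutoff_tendsto_0)
  moreover have "(1 / x j) * (\<Sum>n = 1..nat \<lfloor>x j\<rfloor>. d n) = freq (\<lambda>n. f n * g n) H v (x j)
      - (1 / 2) ^ s * freq g H (\<lambda>h. (v h)\<^sup>2) (x j)" for j
    unfolding d_def freq_def sum_subtractf sum_distrib_left[symmetric] by (simp only: right_diff_distrib mult_ac)
  ultimately show ?thesis unfolding s_def by simp
qed

end

theorem theorem8p2:
  fixes g f :: "nat \<Rightarrow> int" and P :: "nat set" and \<nu>\<^sub>g :: "(int \<Rightarrow> int) measure"
  assumes "\<And>n. n > 0 \<Longrightarrow> g n \<in> {0, 1}"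
    and "multiplicative_fun g"
    and "pretentious (\<lambda>n. of_int (g n))"
    and "unique_furstenberg_measure {0, 1} g \<nu>\<^sub>g"
    and "P \<subseteq> {p. prime p}"
    and "\<not> (\<lambda>p. 1 / real p) summable_on P"
    and "has_relative_prime_density P 0"
    and "f = (\<lambda>n. (-1) ^ big_Omega_in P n) \<or> f = (\<lambda>n. (-1) ^ small_omega_in P n)"
  shows "\<exists>\<nu>\<^sub>f\<^sub>g. unique_furstenberg_measure {-1, 0, 1} (\<lambda>n. f n * g n) \<nu>\<^sub>f\<^sub>g \<and>
    (\<forall>H v. finite H \<and> v ` H \<subseteq> {-1, 0, 1} \<longrightarrow>
       measure \<nu>\<^sub>f\<^sub>g (cylinder {-1, 0, 1} H v) =
         (1 / 2) ^ card (cylinder_supp H v) *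
         measure \<nu>\<^sub>g (square_set (cylinder {-1, 0, 1} H v)))"
proof -
  define fg where "fg = (\<lambda>n. f n * g n)"
  have "(-1 :: int) ^ k = 1 \<or> (-1 :: int) ^ k = -1" for k by (cases "even k") simp_all
  then have f_cases: "f n = 1 \<or> f n = -1" for n using assms(8) by blast
  interpret sparse_parity f g P "{p. prime p \<and> g p \<noteq> 1}"
  proof
    show "multiplicative_fun f"
      using assms(8) multiplicative_big_Omega[of P] multiplicative_small_omega[of P] by auto
    show "(\<lambda>p. 1 / real p) summable_on {p. prime p \<and> g p \<noteq> 1}"
      using assms(1,3) by (rule pretentious_zeros_summable)
    show "f p = (if p \<in> P then -1 else 1)" if "prime p" for p
      using assms(8) by (auto simp: omega_in_prime[OF that])
    show "\<bar>f n\<bar> = 1" for n using f_cases[of n] by auto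
  qed (use assms in simp_all)
  have fg_range: "fg n \<in> {-1, 0, 1}" "(fg n)\<^sup>2 = g n" if "n > 0" for n
    using assms(1)[OF that] f_cases[of n] by (auto simp: fg_def)
  have g_furst: "furstenberg_measure {0, 1} g \<nu>\<^sub>g"
    and g_unique: "\<And>\<nu>'. furstenberg_measure {0, 1} g \<nu>' \<Longrightarrow> \<nu>' = \<nu>\<^sub>g"
    using assms(4) by (auto simp: unique_furstenberg_measure_def)
  have g_sets: "sets \<nu>\<^sub>g = sets (restrict_space borel (full_shift {0, 1}))" and g_prob: "prob_space \<nu>\<^sub>g"
    and g_inv: "distr \<nu>\<^sub>g \<nu>\<^sub>g left_shift = \<nu>\<^sub>g"
    using g_furst by (auto simp: furstenberg_measure_def)
  \<comment> \<open>Any cutoffs along which g has the limit \<open>\<nu>\<^sub>g\<close> are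
    allowed: existence takes them from the measure of g, uniqueness from a competing measure of f
    g.\<close>
  have transfer: "(\<lambda>j. freq fg H v (x j)) \<longlonglongrightarrow> measure (sign_extension \<nu>\<^sub>g) (cylinder {-1, 0, 1} H v)"
    if x: "filterlim x at_top sequentially"
      and lim: "\<And>F :: (int \<Rightarrow> int) \<Rightarrow> complex. continuous_on (full_shift {0, 1}) F \<Longrightarrow>
           (\<lambda>j. (1 / x j) *\<^sub>R (\<Sum>n = 1..nat \<lfloor>x j\<rfloor>. F ((left_shift ^^ n) (extend_by_zero g))))
             \<longlonglongrightarrow> (LINT y|\<nu>\<^sub>g. F y)"
      and H: "finite H" and v: "v ` H \<subseteq> {-1, 0, 1}" for x H v
  proof -
    define s where "s = card (cylinder_supp H v)"
    have "(\<lambda>j. freq g H (\<lambda>h. (v h)\<^sup>2) (x j)) \<longlonglongrightarrow> measure \<nu>\<^sub>g (cylinder {0, 1} H (\<lambda>h. (v h)\<^sup>2))"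
      by (rule furstenberg_freq[OF _ _ _ H g_sets g_prob lim]) (use assms(1) in auto)
    then have "(\<lambda>j. (freq fg H v (x j) - (1 / 2) ^ s * freq g H (\<lambda>h. (v h)\<^sup>2) (x j))
        + (1 / 2) ^ s * freq g H (\<lambda>h. (v h)\<^sup>2) (x j))
        \<longlonglongrightarrow> 0 + (1 / 2) ^ s * measure \<nu>\<^sub>g (cylinder {0, 1} H (\<lambda>h. (v h)\<^sup>2))"
      unfolding fg_def s_def
      by (intro tendsto_add tendsto_mult tendsto_const freq_diff_tendsto_0 assms(1) H v x)
    then show ?thesis by (simp add: measure_sign_extension[OF g_sets g_prob H v] s_def)
  qed
  have "furstenberg_measure {-1, 0, 1} fg (sign_extension \<nu>\<^sub>g)"
  proof -
    obtain x where x: "filterlim x at_top sequentially" and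
      lim: "\<And>F :: (int \<Rightarrow> int) \<Rightarrow> complex. continuous_on (full_shift {0, 1}) F \<Longrightarrow>
           (\<lambda>j. (1 / x j) *\<^sub>R (\<Sum>n = 1..nat \<lfloor>x j\<rfloor>. F ((left_shift ^^ n) (extend_by_zero g))))
             \<longlonglongrightarrow> (LINT y|\<nu>\<^sub>g. F y)"
      using g_furst unfolding furstenberg_measure_def by blast
    have "(\<lambda>j. (1 / x j) *\<^sub>R (\<Sum>n = 1..nat \<lfloor>x j\<rfloor>. F ((left_shift ^^ n) (extend_by_zero fg))))
             \<longlonglongrightarrow> (LINT y|sign_extension \<nu>\<^sub>g. F y)"
      if "continuous_on (full_shift {-1, 0, 1}) F" for F :: "(int \<Rightarrow> int) \<Rightarrow> complex"
      by (rule furstenberg_criterion[OF _ _ fg_range(1) sets_sign_extension[OF g_sets g_prob]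
            prob_space_sign_extension[OF g_sets g_prob] x transfer[OF x lim] that]) simp_all
    then show ?thesis
      unfolding furstenberg_measure_def
      using x sets_sign_extension[OF g_sets g_prob] prob_space_sign_extension[OF g_sets g_prob]
        distr_sign_extension_left_shift[OF g_sets g_prob g_inv] by blast
  qed
  moreover have "\<nu>' = sign_extension \<nu>\<^sub>g" if \<nu>': "furstenberg_measure {-1, 0, 1} fg \<nu>'" for \<nu>'
  proof -
    obtain x where x: "filterlim x at_top sequentially" and
      lim: "\<And>F :: (int \<Rightarrow> int) \<Rightarrow> complex. continuous_on (full_shift {-1, 0, 1}) F \<Longrightarrow>
           (\<lambda>j. (1 / x j) *\<^sub>R (\<Sum>n = 1..nat \<lfloor>x j\<rfloor>. F ((left_shift ^^ n) (extend_by_zero fg))))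
             \<longlonglongrightarrow> (LINT y|\<nu>'. F y)"
      using \<nu>' unfolding furstenberg_measure_def by blast
    have sets: "sets \<nu>' = sets (restrict_space borel (full_shift {-1, 0, 1}))" and prob: "prob_space \<nu>'"
      using \<nu>' by (auto simp: furstenberg_measure_def)
    note square = furstenberg_square[OF \<nu>' x lim fg_range(2)]
    \<comment> \<open>The square of f g is g, so the image of the competitor is a Furstenberg
      measure of g and must be \<open>\<nu>\<^sub>g\<close>; thereby the competitor's own cutoffs
      qualify for \<open>transfer\<close>.\<close>
    have push: "distr \<nu>' (restrict_space borel (full_shift {0, 1})) square_map = \<nu>\<^sub>g"
      by (rule g_unique[OF square(1)])
    show ?thesis
    proof (rule measure_eqI_cylinder[OF _ sets sets_sign_extension[OF g_sets g_prob] prob prob_space_sign_extension[OF g_sets g_prob]])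
      fix H :: "int set" and v :: "int \<Rightarrow> int" assume H: "finite H" and v: "v ` H \<subseteq> {-1, 0, 1}"
      have "(\<lambda>j. freq fg H v (x j)) \<longlonglongrightarrow> measure \<nu>' (cylinder {-1, 0, 1} H v)"
        by (rule furstenberg_freq[OF _ _ fg_range(1) H sets prob lim]) auto
      moreover have "(\<lambda>j. freq fg H v (x j)) \<longlonglongrightarrow> measure (sign_extension \<nu>\<^sub>g) (cylinder {-1, 0, 1} H v)"
        by (rule transfer[OF x square(2)[unfolded push] H v])
      ultimately show "measure \<nu>' (cylinder {-1, 0, 1} H v) = measure (sign_extension \<nu>\<^sub>g) (cylinder {-1, 0, 1} H v)"
        by (rule LIMSEQ_unique)
    qed simp
  qed
  ultimately have "unique_furstenberg_measure {-1, 0, 1} (\<lambda>n. f n * g n) (sign_extension \<nu>\<^sub>g)"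
    unfolding unique_furstenberg_measure_def fg_def by blast
  moreover have "measure (sign_extension \<nu>\<^sub>g) (cylinder {-1, 0, 1} H v) =
      (1 / 2) ^ card (cylinder_supp H v) * measure \<nu>\<^sub>g (square_set (cylinder {-1, 0, 1} H v))"
    if "finite H" "v ` H \<subseteq> {-1, 0, 1}" for H v
    using measure_sign_extension[OF g_sets g_prob that] by (simp add: square_set_cylinder[OF that(2)])
  ultimately show ?thesis by blast
qed

end
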